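(* In every sharp theory with purification, every random reversible (RaRe) channel is a noisy operation.
   Context: Framework. A causal operational probabilistic theory (OPT) has systems $A,B,\dots$ (including a trivial system $I$), with associative composites $AB$ ($AI=IA=A$; $AB$ and $BA$ related by a reversible swap), and tests. A test from $A$ to $B$ is a finite family $\{\mathcal C_i\}_{i\in X}$ of transformations from $A$ to $B$. Tests are closed under sequential composition, parallel composition $\otimes$ and coarse-graining (summing transformations over the blocks of a partition of $X$); identities $\mathcal I_A$ and swaps are one-outcome tests; systems and transformations form a strict symmetric monoidal category. Tests on $I$ are probability distributions, numbers compose by multiplication, and all probabilities in $[0,1]$ are available. A state of $A$ is a transformation $I\to A$, an effect is a transformation $A\to I$, $(a|\rho)\in[0,1]$ is their composition; tests $A\to I$ are observation-tests. States (effects) are equal iff they have the same pairing with all effects (states); transformations $\mathcal C,\mathcal C'$ from $A$ to $B$ are equal iff $(\mathcal C\otimes\mathcal I_S)\rho=(\mathcal C'\otimes\mathcal I_S)\rho$ for every system $S$ and state $\rho$ of $AS$. The spanned real vector spaces are finite-dimensional; the sets of states, effects and transformations are closed (hence compact). $\mathcal T_n\to\mathcal T$ means $(E|(\mathcal T_n\otimes\mathcal I_S)|\rho)\to(E|(\mathcal T\otimes\mathcal I_S)|\rho)$ for all $S$, states $\rho$, effects $E$. Every test $\{\mathcal A_i\}$ from $A$ to $B$ has the form $\mathcal A_i=(\mathcal I_B\otimes e_i)\mathcal A$ with $\mathcal A$ a deterministic transformation from $A$ to some $BX$ and $\{e_i\}$ an observation-test on $X$. A channel is a deterministic (one-outcome-test)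 transformation; it is reversible if it has an inverse channel. A transformation $\mathcal T$ is pure if whenever $\mathcal T=\sum_{i\in X_0}\mathcal D_i$ with $X_0\subseteq X$ and $\{\mathcal D_i\}_{i\in X}$ a test, every $\mathcal D_i$, $i\in X_0$, is a multiple of $\mathcal T$. Causality: every system has a unique deterministic effect $u_A$; the marginal on $A$ of a state of $AB$ is obtained by applying $u_B$. A state is normalised if $(u|\rho)=1$. Tests may be chosen conditionally on earlier outcomes and randomised, so normalised states form a convex set; every nonzero state is a multiple of a normalised one. A sharp theory with purification is a causal OPT satisfying: Purity Preservation (sequential and parallel compositions of pure transformations are pure); Pure Sharpness (for every system there is a pure effect $a$ and a state $\rho$ with $(a|\rho)=1$); Purification (every normalised state $\rho$ of $A$ is the marginal of a normalised pure state of some composite $AB$, and if two normalised pure states $\Psi,\Psi'$ of $AB$ have the same marginal on $A$ then $\Psi'=(\mathcal I_A\otimes\mathcal U)\Psi$ for a reversible channel $\mathcal U$ on $B$). In such a theory each system $A$ has a unique normalised state $\chi_A$ invariant under all reversible channels on $A$ (the microcanonical state), and $\chi_{AB}=\chi_A\otimes\chi_B$. Operations. A RaRe channel on $A$ is a channel $\sum_ip_i\,\mathcal U_i$ with $\{p_i\}$ a probability distribution and $\mathcal U_i$ reversible channels on $A$. A channel $\mathcal B$ from $A$ to $A'$ is a basic noisy operation if there are systems $E,E'$ with $AE$ and $A'E'$ operationally equivalent (i.e. connected by a reversible channel) and a reversible channel $\mathcal U$ from $AE$ to $A'E'$ with $\mathcal B=(\mathcal I_{A'}\otimes u_{E'})\,\mathcal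 U\,(\mathcal I_A\otimes\chi_E)$. A noisy operation is a limit of a sequence of basic noisy operations. *)

theory Defs
  imports Complex_Main
begin

section \<open>Raw data of an operational probabilistic theory\<close>

text \<open>
  The elements of \<open>'s\<close> are the systems. Transformations live in one type \<open>'t\<close>; only those that
  occur in a test from \<open>A\<close> to \<open>B\<close> count as transformations from \<open>A\<close> to \<open>B\<close>, and every law below
  is typed in this way.
  A test is the list of its transformations, the outcome set being the set of list positions.
  \<open>val\<close> reads off the probability that a transformation \<open>I \<rightarrow> I\<close> represents.
\<close>

record ('s, 't) opt =
  triv :: 's
  sys_comp :: "'s \<Rightarrow> 's \<Rightarrow> 's"  (infixl "\<boxdot>\<index>" 75)
  idt :: "'s \<Rightarrow> 't"  ("\<I>\<index> _" [1000] 1000)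
  sys_swap :: "'s \<Rightarrow> 's \<Rightarrow> 't"
  seq :: "'t \<Rightarrow> 't \<Rightarrow> 't"  (infixl "\<cdot>\<index>" 70)
  par :: "'t \<Rightarrow> 't \<Rightarrow> 't"  (infixl "\<boxtimes>\<index>" 75)
  tests :: "'s \<Rightarrow> 's \<Rightarrow> 't list set"
  val :: "'t \<Rightarrow> real"

text \<open>\<open>G \<cdot> F\<close> is \<open>G\<close> after \<open>F\<close>.\<close>

definition transf :: "('s, 't) opt \<Rightarrow> 's \<Rightarrow> 's \<Rightarrow> 't set"
  where "transf \<Theta> A B = {T. \<exists>Ts \<in> tests \<Theta> A B. T \<in> set Ts}"

definition states :: "('s, 't) opt \<Rightarrow> 's \<Rightarrow> 't set"
  where "states \<Theta> A = transf \<Theta> (triv \<Theta>) A"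

definition effects :: "('s, 't) opt \<Rightarrow> 's \<Rightarrow> 't set"
  where "effects \<Theta> A = transf \<Theta> A (triv \<Theta>)"

definition channel :: "('s, 't) opt \<Rightarrow> 's \<Rightarrow> 's \<Rightarrow> 't \<Rightarrow> bool"
  where "channel \<Theta> A B C \<longleftrightarrow> [C] \<in> tests \<Theta> A B"

definition reversible :: "('s, 't) opt \<Rightarrow> 's \<Rightarrow> 's \<Rightarrow> 't \<Rightarrow> bool"
  where "reversible \<Theta> A B U \<longleftrightarrow> channel \<Theta> A B U \<and>
    (\<exists>V. channel \<Theta> B A V \<and> V \<cdot> U = \<I> A \<and> U \<cdot> V = \<I> B)"
  for \<Theta> (structure)

text \<open>\<open>(E|(T \<otimes> I\<^sub>S)|\<rho>)\<close> for a state \<open>\<rho>\<close> of \<open>AS\<close>, a transformation \<open>T\<close> from \<open>A\<close> to \<open>B\<close> and an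
  effect \<open>E\<close> of \<open>BS\<close>.\<close>

definition prob :: "('s, 't) opt \<Rightarrow> 's \<Rightarrow> 't \<Rightarrow> 't \<Rightarrow> 't \<Rightarrow> real"
  where "prob \<Theta> S E T \<rho> = val \<Theta> (E \<cdot> ((T \<boxtimes> \<I> S) \<cdot> \<rho>))"
  for \<Theta> (structure)

text \<open>
  A transformation \<open>T\<close> is identified with the function \<open>(S, \<rho>, E) \<mapsto> prob \<Theta> S E T \<rho>\<close>, so the real
  vector space spanned by the transformations from \<open>A\<close> to \<open>B\<close> is a space of real functions.
  Real linear combinations of transformations (sums, multiples, mixtures) are taken there:
  \<open>lincomb \<Theta> A B T J c D\<close> says that \<open>T = (\<Sum>j\<in>J. c j D j)\<close>.
\<close>

definition lincomb ::
    "('s, 't) opt \<Rightarrow> 's \<Rightarrow> 's \<Rightarrow> 't \<Rightarrow> 'j set \<Rightarrow> ('j \<Rightarrow> real) \<Rightarrow> ('j \<Rightarrow> 't) \<Rightarrow> bool"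
  where "lincomb \<Theta> A B T J c D \<longleftrightarrow>
    (\<forall>S. \<forall>\<rho> \<in> states \<Theta> (A \<boxdot> S). \<forall>E \<in> effects \<Theta> (B \<boxdot> S).
      prob \<Theta> S E T \<rho> = (\<Sum>j\<in>J. c j * prob \<Theta> S E (D j) \<rho>))"
  for \<Theta> (structure)

definition is_sum :: "('s, 't) opt \<Rightarrow> 's \<Rightarrow> 's \<Rightarrow> 't \<Rightarrow> 'j set \<Rightarrow> ('j \<Rightarrow> 't) \<Rightarrow> bool"
  where "is_sum \<Theta> A B T J D \<longleftrightarrow> lincomb \<Theta> A B T J (\<lambda>_. 1) D"

definition is_multiple :: "('s, 't) opt \<Rightarrow> 's \<Rightarrow> 's \<Rightarrow> 't \<Rightarrow> 't \<Rightarrow> bool"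
  where "is_multiple \<Theta> A B D T \<longleftrightarrow> (\<exists>c. lincomb \<Theta> A B D {()} (\<lambda>_. c) (\<lambda>_. T))"

definition tends_to :: "('s, 't) opt \<Rightarrow> 's \<Rightarrow> 's \<Rightarrow> (nat \<Rightarrow> 't) \<Rightarrow> 't \<Rightarrow> bool"
  where "tends_to \<Theta> A B F T \<longleftrightarrow>
    (\<forall>S. \<forall>\<rho> \<in> states \<Theta> (A \<boxdot> S). \<forall>E \<in> effects \<Theta> (B \<boxdot> S).
      (\<lambda>n. prob \<Theta> S E (F n) \<rho>) \<longlonglongrightarrow> prob \<Theta> S E T \<rho>)"
  for \<Theta> (structure)

definition pure :: "('s, 't) opt \<Rightarrow> 's \<Rightarrow> 's \<Rightarrow> 't \<Rightarrow> bool"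
  where "pure \<Theta> A B T \<longleftrightarrow> T \<in> transf \<Theta> A B \<and>
    (\<forall>Ds \<in> tests \<Theta> A B. \<forall>X\<^sub>0 \<subseteq> {..<length Ds}.
      is_sum \<Theta> A B T X\<^sub>0 (\<lambda>i. Ds ! i) \<longrightarrow> (\<forall>i \<in> X\<^sub>0. is_multiple \<Theta> A B (Ds ! i) T))"

text \<open>The deterministic effect; it is unique in a causal theory.\<close>

definition discard :: "('s, 't) opt \<Rightarrow> 's \<Rightarrow> 't"  ("\<u>\<index> _" [1000] 1000)
  where "discard \<Theta> A = (THE u. channel \<Theta> A (triv \<Theta>) u)"

definition normalised :: "('s, 't) opt \<Rightarrow> 's \<Rightarrow> 't \<Rightarrow> bool"
  where "normalised \<Theta> A \<rho> \<longleftrightarrow> \<rho> \<in> states \<Theta> A \<and> val \<Theta> (\<u> A \<cdot> \<rho>) = 1"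
  for \<Theta> (structure)

text \<open>The marginal on \<open>A\<close> of a state of \<open>AB\<close>.\<close>

definition marginal :: "('s, 't) opt \<Rightarrow> 's \<Rightarrow> 's \<Rightarrow> 't \<Rightarrow> 't"
  where "marginal \<Theta> A B \<rho> = (\<I> A \<boxtimes> \<u> B) \<cdot> \<rho>"
  for \<Theta> (structure)

definition pure_state :: "('s, 't) opt \<Rightarrow> 's \<Rightarrow> 't \<Rightarrow> bool"
  where "pure_state \<Theta> A \<Psi> \<longleftrightarrow> normalised \<Theta> A \<Psi> \<and> pure \<Theta> (triv \<Theta>) A \<Psi>"


section \<open>Causal operational probabilistic theories\<close>

text \<open>
  Conditional tests subsume sequential composition of tests, and together with the tests on the
  trivial system and parallel composition they also give randomised tests. In \<open>coarse_grain\<close> the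
  \<open>j\<close>-th block of the partition is the set of all \<open>i\<close> with \<open>f i = j\<close>.
  Addition and limits are defined through probabilities, which makes composition bilinear and makes
  a transformation determined by its expansion as a \<open>lincomb\<close>.
\<close>

locale opt_theory =
  fixes \<Theta> :: "('s, 't) opt" (structure)
  assumes comp_assoc: "A \<boxdot> B \<boxdot> C = A \<boxdot> (B \<boxdot> C)"
    and comp_triv: "A \<boxdot> triv \<Theta> = A" "triv \<Theta> \<boxdot> A = A"
  \<comment> \<open>closure of tests\<close>
    and idt_test: "channel \<Theta> A A (\<I> A)"
    and swap_test: "channel \<Theta> (A \<boxdot> B) (B \<boxdot> A) (sys_swap \<Theta> A B)"
    and conditional_test: "\<lbrakk>Cs \<in> tests \<Theta> A B; length Dss = length Cs; set Dss \<subseteq> tests \<Theta> B C\<rbrakk> \<Longrightarrow>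
      concat (map (\<lambda>(F, Ds). map (\<lambda>D. D \<cdot> F) Ds) (zip Cs Dss)) \<in> tests \<Theta> A C"
    and par_test: "\<lbrakk>Cs \<in> tests \<Theta> A B; Ds \<in> tests \<Theta> A' B'\<rbrakk> \<Longrightarrow>
      [F \<boxtimes> G. F \<leftarrow> Cs, G \<leftarrow> Ds] \<in> tests \<Theta> (A \<boxdot> A') (B \<boxdot> B')"
    and coarse_grain: "\<lbrakk>Cs \<in> tests \<Theta> A B; f ` {..<length Cs} = {..<m}\<rbrakk> \<Longrightarrow>
      \<exists>Ds \<in> tests \<Theta> A B. length Ds = m \<and>
        (\<forall>j<m. is_sum \<Theta> A B (Ds ! j) {i. i < length Cs \<and> f i = j} (\<lambda>i. Cs ! i))"
  \<comment> \<open>strict symmetric monoidal category\<close>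
    and seq_assoc: "\<lbrakk>F \<in> transf \<Theta> A B; G \<in> transf \<Theta> B C; H \<in> transf \<Theta> C D\<rbrakk> \<Longrightarrow>
      H \<cdot> G \<cdot> F = H \<cdot> (G \<cdot> F)"
    and seq_idt: "F \<in> transf \<Theta> A B \<Longrightarrow> F \<cdot> \<I> A = F" "F \<in> transf \<Theta> A B \<Longrightarrow> \<I> B \<cdot> F = F"
    and par_assoc: "\<lbrakk>F \<in> transf \<Theta> A B; G \<in> transf \<Theta> A' B'; H \<in> transf \<Theta> A'' B''\<rbrakk> \<Longrightarrow>
      F \<boxtimes> G \<boxtimes> H = F \<boxtimes> (G \<boxtimes> H)"
    and par_triv: "F \<in> transf \<Theta> A B \<Longrightarrow> F \<boxtimes> \<I> (triv \<Theta>) = F"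
      "F \<in> transf \<Theta> A B \<Longrightarrow> \<I> (triv \<Theta>) \<boxtimes> F = F"
    and par_idt: "\<I> A \<boxtimes> \<I> B = \<I> (A \<boxdot> B)"
    and interchange: "\<lbrakk>F \<in> transf \<Theta> A B; G \<in> transf \<Theta> B C; F' \<in> transf \<Theta> A' B'; G' \<in> transf \<Theta> B' C'\<rbrakk> \<Longrightarrow>
      (G \<boxtimes> G') \<cdot> (F \<boxtimes> F') = (G \<cdot> F) \<boxtimes> (G' \<cdot> F')"
    and swap_natural: "\<lbrakk>F \<in> transf \<Theta> A B; G \<in> transf \<Theta> A' B'\<rbrakk> \<Longrightarrow>
      sys_swap \<Theta> B B' \<cdot> (F \<boxtimes> G) = (G \<boxtimes> F) \<cdot> sys_swap \<Theta> A A'"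
    and swap_swap: "sys_swap \<Theta> B A \<cdot> sys_swap \<Theta> A B = \<I> (A \<boxdot> B)"
    and swap_comp: "sys_swap \<Theta> A (B \<boxdot> C) = (\<I> B \<boxtimes> sys_swap \<Theta> A C) \<cdot> (sys_swap \<Theta> A B \<boxtimes> \<I> C)"
  \<comment> \<open>probabilities\<close>
    and triv_test: "ps \<in> tests \<Theta> (triv \<Theta>) (triv \<Theta>) \<Longrightarrow>
      (\<forall>p \<in> set ps. 0 \<le> val \<Theta> p) \<and> sum_list (map (val \<Theta>) ps) = 1"
    and triv_test_exists: "\<lbrakk>\<forall>r \<in> set rs. 0 \<le> r; sum_list rs = 1\<rbrakk> \<Longrightarrow>
      \<exists>ps \<in> tests \<Theta> (triv \<Theta>) (triv \<Theta>). map (val \<Theta>) ps = rs"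
    and val_seq: "\<lbrakk>p \<in> transf \<Theta> (triv \<Theta>) (triv \<Theta>); q \<in> transf \<Theta> (triv \<Theta>) (triv \<Theta>)\<rbrakk> \<Longrightarrow>
      val \<Theta> (q \<cdot> p) = val \<Theta> q * val \<Theta> p"
  \<comment> \<open>operational equality\<close>
    and state_eqI: "\<lbrakk>\<rho> \<in> states \<Theta> A; \<sigma> \<in> states \<Theta> A;
      \<And>a. a \<in> effects \<Theta> A \<Longrightarrow> val \<Theta> (a \<cdot> \<rho>) = val \<Theta> (a \<cdot> \<sigma>)\<rbrakk> \<Longrightarrow> \<rho> = \<sigma>"
    and effect_eqI: "\<lbrakk>a \<in> effects \<Theta> A; b \<in> effects \<Theta> A;
      \<And>\<rho>. \<rho> \<in> states \<Theta> A \<Longrightarrow> val \<Theta> (a \<cdot> \<rho>) = val \<Theta> (b \<cdot> \<rho>)\<rbrakk> \<Longrightarrow> a = b"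
    and transf_eqI: "\<lbrakk>F \<in> transf \<Theta> A B; G \<in> transf \<Theta> A B;
      \<And>S \<rho>. \<rho> \<in> states \<Theta> (A \<boxdot> S) \<Longrightarrow> (F \<boxtimes> \<I> S) \<cdot> \<rho> = (G \<boxtimes> \<I> S) \<cdot> \<rho>\<rbrakk> \<Longrightarrow> F = G"
  \<comment> \<open>finite dimension and closedness; a pointwise limit of functions from a finite-dimensional
    space stays in that space, so nothing is lost by quantifying over all convergent sequences\<close>
    and finite_dim: "\<exists>\<F>. finite \<F> \<and> \<F> \<subseteq> transf \<Theta> A B \<and>
      (\<forall>T \<in> transf \<Theta> A B. \<exists>c. lincomb \<Theta> A B T \<F> c (\<lambda>F. F))"
    and closed_transf: "\<lbrakk>\<And>n. Ts n \<in> transf \<Theta> A B;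
      \<And>S \<rho> E. \<lbrakk>\<rho> \<in> states \<Theta> (A \<boxdot> S); E \<in> effects \<Theta> (B \<boxdot> S)\<rbrakk> \<Longrightarrow> convergent (\<lambda>n. prob \<Theta> S E (Ts n) \<rho>)\<rbrakk> \<Longrightarrow>
      \<exists>T \<in> transf \<Theta> A B. tends_to \<Theta> A B Ts T"
  \<comment> \<open>every test arises from a channel followed by an observation-test\<close>
    and test_dilation: "Cs \<in> tests \<Theta> A B \<Longrightarrow>
      \<exists>X F es. channel \<Theta> A (B \<boxdot> X) F \<and> es \<in> tests \<Theta> X (triv \<Theta>) \<and> Cs = map (\<lambda>e. (\<I> B \<boxtimes> e) \<cdot> F) es"

locale causal_opt_theory = opt_theory +
  assumes causality: "\<exists>!u. channel \<Theta> A (triv \<Theta>) u"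
    and state_normalisable: "\<lbrakk>\<rho> \<in> states \<Theta> A; \<exists>a \<in> effects \<Theta> A. val \<Theta> (a \<cdot> \<rho>) \<noteq> 0\<rbrakk> \<Longrightarrow>
      \<exists>\<sigma>. normalised \<Theta> A \<sigma> \<and> is_multiple \<Theta> (triv \<Theta>) A \<rho> \<sigma>"

locale sharp_theory_with_purification = causal_opt_theory +
  assumes purity_preservation_seq: "\<lbrakk>pure \<Theta> A B F; pure \<Theta> B C G\<rbrakk> \<Longrightarrow> pure \<Theta> A C (G \<cdot> F)"
    and purity_preservation_par: "\<lbrakk>pure \<Theta> A B F; pure \<Theta> A' B' G\<rbrakk> \<Longrightarrow>
      pure \<Theta> (A \<boxdot> A') (B \<boxdot> B') (F \<boxtimes> G)"
    and pure_sharpness: "\<exists>a \<rho>. pure \<Theta> A (triv \<Theta>) a \<and> \<rho> \<in> states \<Theta> A \<and> val \<Theta> (a \<cdot> \<rho>) = 1"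
    and purification_exists: "normalised \<Theta> A \<rho> \<Longrightarrow>
      \<exists>B \<Psi>. pure_state \<Theta> (A \<boxdot> B) \<Psi> \<and> marginal \<Theta> A B \<Psi> = \<rho>"
    and purification_unique: "\<lbrakk>pure_state \<Theta> (A \<boxdot> B) \<Psi>; pure_state \<Theta> (A \<boxdot> B) \<Psi>';
      marginal \<Theta> A B \<Psi> = marginal \<Theta> A B \<Psi>'\<rbrakk> \<Longrightarrow>
      \<exists>U. reversible \<Theta> B B U \<and> \<Psi>' = (\<I> A \<boxtimes> U) \<cdot> \<Psi>"


section \<open>Random reversible and noisy operations\<close>

text \<open>The microcanonical state. Its existence and uniqueness are theorems about sharp theories with
  purification, not assumptions.\<close>

definition microcanonical :: "('s, 't) opt \<Rightarrow> 's \<Rightarrow> 't"  ("\<chi>\<index> _" [1000] 1000)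
  where "microcanonical \<Theta> A = (THE \<rho>. normalised \<Theta> A \<rho> \<and> (\<forall>U. reversible \<Theta> A A U \<longrightarrow> U \<cdot> \<rho> = \<rho>))"
  for \<Theta> (structure)

definition rare_channel :: "('s, 't) opt \<Rightarrow> 's \<Rightarrow> 't \<Rightarrow> bool"
  where "rare_channel \<Theta> A R \<longleftrightarrow> channel \<Theta> A A R \<and>
    (\<exists>(n::nat) (p :: nat \<Rightarrow> real) U. (\<forall>i<n. 0 \<le> p i) \<and> (\<Sum>i<n. p i) = 1 \<and>
      (\<forall>i<n. reversible \<Theta> A A (U i)) \<and> lincomb \<Theta> A A R {..<n} p U)"

definition op_equivalent :: "('s, 't) opt \<Rightarrow> 's \<Rightarrow> 's \<Rightarrow> bool"
  where "op_equivalent \<Theta> A B \<longleftrightarrow> (\<exists>U. reversible \<Theta> A B U)"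

definition basic_noisy_operation :: "('s, 't) opt \<Rightarrow> 's \<Rightarrow> 's \<Rightarrow> 't \<Rightarrow> bool"
  where "basic_noisy_operation \<Theta> A A' B \<longleftrightarrow> channel \<Theta> A A' B \<and>
    (\<exists>E E' U. op_equivalent \<Theta> (A \<boxdot> E) (A' \<boxdot> E') \<and> reversible \<Theta> (A \<boxdot> E) (A' \<boxdot> E') U \<and>
      B = (\<I> A' \<boxtimes> \<u> E') \<cdot> U \<cdot> (\<I> A \<boxtimes> \<chi> E))"
  for \<Theta> (structure)

definition noisy_operation :: "('s, 't) opt \<Rightarrow> 's \<Rightarrow> 's \<Rightarrow> 't \<Rightarrow> bool"
  where "noisy_operation \<Theta> A A' N \<longleftrightarrow> N \<in> transf \<Theta> A A' \<and>
    (\<exists>F. (\<forall>n. basic_noisy_operation \<Theta> A A' (F n)) \<and> tends_to \<Theta> A A' F N)"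

end

theory Submission
  imports Defs
begin

text \<open>A control system \<open>F\<close> whose microcanonical state is a mixture of a pure state \<open>\<phi>\<close> and a state that is
  perfectly distinguishable from it allows one to apply a reversible channel coherently conditioned on
  \<open>\<phi>\<close>. Discarding \<open>F\<close> then mixes two noisy operations with fixed weights \<open>\<lambda>\<close> and \<open>1 - \<lambda>\<close>, and such
  mixtures, iterated, approximate every convex combination of reversible channels.

  The controlled channel comes from purification. A pure channel from a system to itself is reversible,
  because it maps a purification of the microcanonical state to a purification of the same state. It
  remains to see that a pure transformation that is deterministic on products of microcanonical states is
  a channel, which holds because the microcanonical state of a composite is the product of the
  microcanonical states: both are uniform mixtures of perfectly distinguishable pure states, obtained by
  splitting off one pure state after the other from the system and its purification in parallel.
  As control system one takes \<open>A\<close> itself, unless its microcanonical state is pure; in that case the identity is the only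
  reversible channel on \<open>A\<close>.\<close>

text \<open>Ancillas of a noisy operation have to be microcanonical, so the mixing ratio cannot be
  chosen: it is the weight of a pure state in the microcanonical state of the control. Two noisy
  operations with reversible dilations \<open>V1\<close> and \<open>V2\<close> over a common
  environment are mixed by applying \<open>V2\<close> and then, under control, \<open>V\<close>,
  which is \<open>V1\<close> after the inverse of \<open>V2\<close>. The obstacle is that
  \<open>V\<close> cannot be controlled directly. The construction needs a pure state fixed by
  \<open>V\<close>: on such a state the dilation of the controlled operation must leave nothing but
  the control in its environment, and this is what allows the environment to be turned back into the
  control. No fixed pure state is at hand for a general \<open>V\<close>. The swap of two copies of
  a system has one, which is enough to control \<open>V\<close> together with its inverse on a
  second copy. The second copy is prepared in the microcanonical state and discarded, so the
  unwanted inverse leaves no trace.\<close>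

text \<open>Transformations are tagged with their source and target, so that the side conditions of the
  categorical laws are decided by rewriting and every equation of arrows is also an equation of types.\<close>

datatype ('s, 't) arrow = Arr (src: 's) (raw: 't) (tgt: 's)

lemma arrow_eqI: "src f = src g \<Longrightarrow> tgt f = tgt g \<Longrightarrow> raw f = raw g \<Longrightarrow> f = g"
  by (simp add: arrow.expand)

section \<open>Real analysis\<close>

text \<open>Bolzano-Weierstrass for finitely many sequences at once: each new sequence is thinned to
  a monotone subsequence, and thinning preserves the convergence already achieved.\<close>

lemma convergent_subseq_finite:
  fixes f :: "'k \<Rightarrow> nat \<Rightarrow> real"
  assumes "finite K" "\<And>k n. k \<in> K \<Longrightarrow> 0 \<le> f k n \<and> f k n \<le> 1"
  shows "\<exists>r::nat \<Rightarrow> nat. strict_mono r \<and> (\<forall>k\<in>K. convergent (\<lambda>n. f k (r n)))"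
  using assms
proof (induction K rule: finite_induct)
  case empty
  show ?case by (intro exI[of _ id]) (simp add: strict_mono_def)
next
  case (insert k K)
  then obtain r where r: "strict_mono r" "\<forall>k\<in>K. convergent (\<lambda>n. f k (r n))" by auto
  obtain q where q: "strict_mono q" "monoseq (\<lambda>n. f k (r (q n)))"
    using seq_monosub[of "\<lambda>n. f k (r n)"] by auto
  have "Bseq (\<lambda>n. f k (r (q n)))"
    by (rule BseqI'[of _ 1]) (use insert.prems in auto)
  then have "convergent (\<lambda>n. f k (r (q n)))" using q(2) Bseq_monoseq_convergent by blast
  moreover have "convergent (\<lambda>n. f j (r (q n)))" if j: "j \<in> K" for j
    using convergent_subseq_convergent[of "\<lambda>n. f j (r n)" q] r(2) j q(1) by (simp add: o_def)
  ultimately show ?case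
    using strict_mono_o[OF r(1) q(1)] by (intro exI[of _ "\<lambda>n. r (q n)"]) (auto simp: o_def)
qed

text \<open>The extreme value theorem for a sequentially compact set and an upper semicontinuous
  function. Semicontinuity is the right generality, since the lemma is later applied to the negative
  of a supremum over the group of reversible channels.\<close>

lemma attains_max:
  fixes g :: "'x \<Rightarrow> real"
  assumes "X \<noteq> {}" "\<And>x. x \<in> X \<Longrightarrow> g x \<le> B"
    and sub: "\<And>s. (\<And>n. s n \<in> X) \<Longrightarrow> \<exists>x\<in>X. \<exists>r::nat\<Rightarrow>nat. strict_mono r \<and>
      (\<forall>e>0. \<forall>\<^sub>F n in sequentially. g (s (r n)) \<le> g x + e)"
  shows "\<exists>x\<in>X. \<forall>y\<in>X. g y \<le> g x"
proof -
  define M where "M = Sup (g ` X)"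
  have bdd: "bdd_above (g ` X)" using assms(2) by (intro bdd_aboveI2)
  have le: "g y \<le> M" if "y \<in> X" for y using that bdd by (auto simp: M_def intro: cSup_upper)
  have "\<exists>y\<in>X. M - 1 / (real n + 1) < g y" for n
  proof -
    have "M - 1 / (real n + 1) < Sup (g ` X)" by (simp add: M_def add_pos_nonneg)
    then show ?thesis using assms(1) bdd by (auto simp: less_cSup_iff)
  qed
  then obtain s where s: "\<And>n. s n \<in> X" "\<And>n. M - 1 / (real n + 1) < g (s n)" by metis
  obtain x r where x: "x \<in> X" "strict_mono r" "\<And>e. e > 0 \<Longrightarrow> \<forall>\<^sub>F n in sequentially. g (s (r n)) \<le> g x + e"
    using sub[of s] s(1) by blast
  have "M \<le> g x + e" if e: "e > 0" for e
  proof -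
    have "(\<lambda>n. 1 / (real n + 1)) \<longlonglongrightarrow> 0" using LIMSEQ_inverse_real_of_nat by (simp add: inverse_eq_divide add.commute)
    then have "(\<lambda>n. 1 / (real (r n) + 1)) \<longlonglongrightarrow> 0"
      using LIMSEQ_subseq_LIMSEQ[OF _ x(2), of "\<lambda>n. 1 / (real n + 1)"] by (simp add: o_def)
    then have "\<forall>\<^sub>F n in sequentially. 1 / (real (r n) + 1) < e / 2"
      using e by (intro order_tendstoD(2)[of _ 0]) auto
    moreover have "\<forall>\<^sub>F n in sequentially. g (s (r n)) \<le> g x + e / 2" using x(3)[of "e / 2"] e by simp
    ultimately have "\<forall>\<^sub>F n in sequentially. M \<le> g x + e"
    proof eventually_elim
      case (elim n)
      then show ?case using s(2)[of "r n"] by linarith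
    qed
    then show ?thesis by simp
  qed
  then have "M \<le> g x" by (rule field_le_epsilon)
  then show ?thesis using x(1) le by force
qed

text \<open>Lagrange interpolation: the coordinates of a vector in a finite-dimensional space of functions
  on \<open>D\<close> can be taken to be its values at finitely many points, which bounds them.\<close>

lemma interpolation:
  fixes v :: "'f \<Rightarrow> 'e \<Rightarrow> real"
  assumes "finite F"
  shows "\<exists>K b m. finite K \<and> K \<subseteq> D \<and>
    (\<forall>f\<in>F. \<forall>a\<in>D. v f a = (\<Sum>k\<in>K. v f k * b k a)) \<and>
    (\<forall>k\<in>K. \<forall>a\<in>D. b k a = (\<Sum>f\<in>F. m k f * v f a)) \<and>
    (\<forall>k\<in>K. \<forall>j\<in>K. b k j = (if k = j then 1 else (0::real)))"
  using assms
proof (induction F rule: finite_induct)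
  case empty
  show ?case by (intro exI[of _ "{}"]) auto
next
  case (insert f0 F)
  obtain K b m where H: "finite K \<and> K \<subseteq> D \<and>
    (\<forall>f\<in>F. \<forall>a\<in>D. v f a = (\<Sum>k\<in>K. v f k * b k a)) \<and>
    (\<forall>k\<in>K. \<forall>a\<in>D. b k a = (\<Sum>f\<in>F. m k f * v f a)) \<and>
    (\<forall>k\<in>K. \<forall>j\<in>K. b k j = (if k = j then 1 else (0::real)))"
    using insert.IH by (elim exE) (rule that)
  then have K: "finite K" "K \<subseteq> D" by simp_all
  have v: "\<And>f a. f \<in> F \<Longrightarrow> a \<in> D \<Longrightarrow> v f a = (\<Sum>k\<in>K. v f k * b k a)" using H by blast
  have m: "\<And>k a. k \<in> K \<Longrightarrow> a \<in> D \<Longrightarrow> b k a = (\<Sum>f\<in>F. m k f * v f a)" using H by blast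
  have d: "\<And>k j. k \<in> K \<Longrightarrow> j \<in> K \<Longrightarrow> b k j = (if k = j then 1 else (0::real))" using H by blast
  \<comment> \<open>The residual of \<open>v f0\<close> after interpolation at the current nodes. It
    vanishes at them, so a point where it does not vanish is a genuinely new node.\<close>
  define r where "r a = v f0 a - (\<Sum>k\<in>K. v f0 k * b k a)" for a
  have rK: "r j = 0" if "j \<in> K" for j
  proof -
    have "(\<Sum>k\<in>K. v f0 k * b k j) = (\<Sum>k\<in>K. if k = j then v f0 k else 0)"
    proof (rule sum.cong)
      fix k assume "k \<in> K"
      then show "v f0 k * b k j = (if k = j then v f0 k else 0)" using d[of k j] that by simp
    qed simp
    then show ?thesis using K(1) that by (simp add: r_def)
  qed
  show ?case
  proof (cases "\<forall>a\<in>D. r a = 0")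
    case True
    define m' where "m' k f = (if f = f0 then 0 else m k f)" for k f
    have "b k a = (\<Sum>f\<in>insert f0 F. m' k f * v f a)" if "k \<in> K" "a \<in> D" for k a
    proof -
      have "(\<Sum>f\<in>F. m k f * v f a) = (\<Sum>f\<in>F. m' k f * v f a)"
        using insert.hyps by (intro sum.cong) (auto simp: m'_def)
      then show ?thesis using m that insert.hyps by (simp add: m'_def)
    qed
    moreover have "v f0 a = (\<Sum>k\<in>K. v f0 k * b k a)" if "a \<in> D" for a
      using True that by (simp add: r_def)
    ultimately show ?thesis using K v d
      by (intro exI[of _ K] exI[of _ b] exI[of _ m'] conjI ballI) (auto simp del: sum.insert)
  next
    case False
    then obtain a0 where a0: "a0 \<in> D" "r a0 \<noteq> 0" by blast
    then have a0K: "a0 \<notin> K" using rK by blast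
    define b0 where "b0 a = r a / r a0" for a
    \<comment> \<open>The normalised residual becomes the basis function of the new node; the old
      basis functions are corrected so that they vanish there.\<close>
    define b' where "b' k a = (if k = a0 then b0 a else b k a - b k a0 * b0 a)" for k a
    define m0 where "m0 f = (if f = f0 then 1 else - (\<Sum>k\<in>K. v f0 k * m k f)) / r a0" for f
    define m' where "m' k f = (if k = a0 then m0 f else (if f = f0 then 0 else m k f) - b k a0 * m0 f)" for k f
    have b0: "b0 a0 = 1" "\<And>j. j \<in> K \<Longrightarrow> b0 j = 0" using a0 rK by (auto simp: b0_def)
    have e: "(\<Sum>k\<in>insert a0 K. c k * b' k a) = (\<Sum>k\<in>K. c k * b k a) + (c a0 - (\<Sum>k\<in>K. c k * b k a0)) * b0 a" for c a
    proof -
      have "(\<Sum>k\<in>K. c k * b' k a) = (\<Sum>k\<in>K. c k * b k a - c k * b k a0 * b0 a)"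
        by (intro sum.cong) (use a0K in \<open>auto simp: b'_def algebra_simps\<close>)
      also have "\<dots> = (\<Sum>k\<in>K. c k * b k a) - (\<Sum>k\<in>K. c k * b k a0) * b0 a"
        by (simp add: sum_subtractf sum_distrib_right)
      finally have "(\<Sum>k\<in>K. c k * b' k a) = (\<Sum>k\<in>K. c k * b k a) - (\<Sum>k\<in>K. c k * b k a0) * b0 a" .
      moreover have "b' a0 a = b0 a" by (simp add: b'_def)
      ultimately show ?thesis using K(1) a0K by (simp add: algebra_simps)
    qed
    have 1: "v f a = (\<Sum>k\<in>insert a0 K. v f k * b' k a)" if f: "f \<in> insert f0 F" and a: "a \<in> D" for f a
    proof (cases "f = f0")
      case True
      have "v f0 a = (\<Sum>k\<in>K. v f0 k * b k a) + r a0 * b0 a" using a0 by (simp add: r_def b0_def)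
      then show ?thesis unfolding e True by (simp add: r_def)
    next
      case False
      then have "f \<in> F" using f by simp
      then show ?thesis unfolding e using v[of f a] v[of f a0] a a0 by simp
    qed
    have f0F: "(\<Sum>f\<in>insert f0 F. c f * v f a) = c f0 * v f0 a + (\<Sum>f\<in>F. c f * v f a)" for c a
      using insert.hyps by simp
    have m0: "b0 a = (\<Sum>f\<in>insert f0 F. m0 f * v f a)" if a: "a \<in> D" for a
    proof -
      have "(\<Sum>k\<in>K. v f0 k * b k a) = (\<Sum>k\<in>K. \<Sum>f\<in>F. v f0 k * m k f * v f a)"
        by (intro sum.cong) (use m a in \<open>auto simp: sum_distrib_left mult.assoc\<close>)
      also have "\<dots> = (\<Sum>f\<in>F. (\<Sum>k\<in>K. v f0 k * m k f) * v f a)"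
        by (subst sum.swap) (simp add: sum_distrib_right)
      finally have "r a = v f0 a - (\<Sum>f\<in>F. (\<Sum>k\<in>K. v f0 k * m k f) * v f a)" by (simp add: r_def)
      moreover have "(\<Sum>f\<in>F. m0 f * v f a) = (\<Sum>f\<in>F. - ((\<Sum>k\<in>K. v f0 k * m k f) * v f a) / r a0)"
        by (intro sum.cong) (use insert.hyps in \<open>auto simp: m0_def\<close>)
      ultimately show ?thesis unfolding f0F b0_def
        by (simp add: m0_def sum_negf sum_divide_distrib[symmetric] diff_divide_distrib)
    qed
    have 2: "b' k a = (\<Sum>f\<in>insert f0 F. m' k f * v f a)" if k: "k \<in> insert a0 K" and a: "a \<in> D" for k a
    proof (cases "k = a0")
      case True then show ?thesis using m0[OF a] by (simp add: b'_def m'_def)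
    next
      case False
      then have kK: "k \<in> K" using k by simp
      have "(\<Sum>f\<in>F. m k f * v f a) = (\<Sum>f\<in>F. (if f = f0 then 0 else m k f) * v f a)"
        by (intro sum.cong) (use insert.hyps in auto)
      then have "b k a = (\<Sum>f\<in>insert f0 F. (if f = f0 then 0 else m k f) * v f a)"
        unfolding f0F using m[OF kK a] by simp
      then have "b' k a = (\<Sum>f\<in>insert f0 F. (if f = f0 then 0 else m k f) * v f a) - b k a0 * (\<Sum>f\<in>insert f0 F. m0 f * v f a)"
        using False m0[OF a] by (simp add: b'_def)
      also have "\<dots> = (\<Sum>f\<in>insert f0 F. m' k f * v f a)"
        unfolding sum_distrib_left sum_subtractf[symmetric]
        by (intro sum.cong) (use False in \<open>auto simp: m'_def algebra_simps\<close>)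
      finally show ?thesis .
    qed
    have 3: "b' k j = (if k = j then 1 else 0)" if "k \<in> insert a0 K" "j \<in> insert a0 K" for k j
      using that d b0 a0K by (auto simp: b'_def)
    show ?thesis
      by (intro exI[of _ "insert a0 K"] exI[of _ b'] exI[of _ m'] conjI ballI)
        (use K a0 in simp, use K a0 in simp, rule 1, assumption+, rule 2, assumption+, rule 3, assumption+)
  qed
qed

text \<open>Splitting an interval in the ratio \<open>l : 1 - l\<close> shrinks it by a factor \<open>max l (1 - l) < 1\<close>.\<close>

lemma weights_dense:
  fixes M :: "real set"
  assumes l: "0 < l" "l < 1" and M: "0 \<in> M" "1 \<in> M" "\<And>a b. a \<in> M \<Longrightarrow> b \<in> M \<Longrightarrow> l * a + (1 - l) * b \<in> M"
    and t: "0 \<le> t" "t \<le> 1" and e: "e > 0"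
  shows "\<exists>s\<in>M. \<bar>s - t\<bar> < e \<and> 0 \<le> s \<and> s \<le> 1"
proof -
  define r where "r = max l (1 - l)"
  have r: "0 \<le> r" "r < 1" "l \<le> r" "1 - l \<le> r" using l by (auto simp: r_def)
  have *: "\<exists>a\<in>M. \<exists>b\<in>M. 0 \<le> a \<and> a \<le> t \<and> t \<le> b \<and> b \<le> 1 \<and> b - a \<le> r ^ k" for k
  proof (induction k)
    case 0
    show ?case using M t by (intro bexI[of _ 0] bexI[of _ 1]) auto
  next
    case (Suc k)
    then obtain a b where ab: "a \<in> M" "b \<in> M" "0 \<le> a" "a \<le> t" "t \<le> b" "b \<le> 1" "b - a \<le> r ^ k" by blast
    define m where "m = l * a + (1 - l) * b"
    have m: "m \<in> M" using M(3)[OF ab(1,2)] by (simp add: m_def)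
    have 1: "m - a = (1 - l) * (b - a)" "b - m = l * (b - a)" by (auto simp: m_def algebra_simps)
    have le: "(1 - l) * (b - a) \<le> r * r ^ k" "l * (b - a) \<le> r * r ^ k"
      using ab r l by (auto intro!: mult_mono)
    have nn: "0 \<le> (1 - l) * (b - a)" "0 \<le> l * (b - a)" using ab l by auto
    have am: "a \<le> m" using 1(1) nn(1) by linarith
    have mb: "m \<le> b" using 1(2) nn(2) by linarith
    have d: "m - a \<le> r ^ Suc k" "b - m \<le> r ^ Suc k" unfolding 1 using le by simp_all
    show ?case
    proof (cases "t \<le> m")
      case True
      then have "0 \<le> a \<and> a \<le> t \<and> t \<le> m \<and> m \<le> 1 \<and> m - a \<le> r ^ Suc k" using ab(3-6) mb d(1) by linarith
      then show ?thesis using ab(1) m by blast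
    next
      case False
      then have "0 \<le> m \<and> m \<le> t \<and> t \<le> b \<and> b \<le> 1 \<and> b - m \<le> r ^ Suc k" using ab(3-6) am d(2) by linarith
      then show ?thesis using ab(2) m by blast
    qed
  qed
  obtain k where k: "r ^ k < e" using real_arch_pow_inv[OF e r(2)] by blast
  obtain a b where "a \<in> M" "0 \<le> a" "a \<le> t" "t \<le> b" "b \<le> 1" "b - a \<le> r ^ k" using * by blast
  then show ?thesis using k by (intro bexI[of _ a]) auto
qed

text \<open>\<open>D\<close> is closed under mixing in one fixed ratio only. This makes it closed
  under mixing with a dense set of weights, so its closure \<open>cl\<close> is convex and contains
  the simplex spanned by the vertices.\<close>

lemma simplex_dense:
  fixes D :: "(nat \<Rightarrow> real) set" and p :: "nat \<Rightarrow> real"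
  assumes l: "0 < l" "l < 1"
    and vert: "\<And>i. i < n \<Longrightarrow> (\<lambda>j. if j = i then 1 else 0) \<in> D"
    and mix: "\<And>x y. x \<in> D \<Longrightarrow> y \<in> D \<Longrightarrow> (\<lambda>i. l * x i + (1 - l) * y i) \<in> D"
    and bnd: "\<And>x i. x \<in> D \<Longrightarrow> 0 \<le> x i \<and> x i \<le> 1"
    and p: "\<And>i. i < n \<Longrightarrow> 0 \<le> p i" "(\<Sum>i<n. p i) = 1"
  shows "\<exists>q. (\<forall>m. q m \<in> D) \<and> (\<forall>i<n. (\<lambda>m. q m i) \<longlonglongrightarrow> p i)"
proof -
  define cl where "cl x \<longleftrightarrow> (\<forall>e>0. \<exists>y\<in>D. \<forall>i<n. \<bar>y i - x i\<bar> < e)" for x :: "nat \<Rightarrow> real"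
  \<comment> \<open>The weights under which \<open>D\<close> is closed. Mixing two mixtures of the
    same points in the ratio given by \<open>l\<close> averages their weights, so
    \<open>weights_dense\<close> applies to \<open>M\<close>.\<close>
  define M where "M = {t. \<forall>x\<in>D. \<forall>y\<in>D. (\<lambda>i. t * x i + (1 - t) * y i) \<in> D}"
  have M01: "0 \<in> M" "1 \<in> M" by (auto simp: M_def)
  have Mmix: "l * a + (1 - l) * b \<in> M" if "a \<in> M" "b \<in> M" for a b
    unfolding M_def
  proof (intro CollectI ballI)
    fix x y assume x: "x \<in> D" "y \<in> D"
    have "(\<lambda>i. l * (a * x i + (1 - a) * y i) + (1 - l) * (b * x i + (1 - b) * y i)) \<in> D"
      using that x by (intro mix) (auto simp: M_def)
    moreover have "(\<lambda>i. l * (a * x i + (1 - a) * y i) + (1 - l) * (b * x i + (1 - b) * y i))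
        = (\<lambda>i. (l * a + (1 - l) * b) * x i + (1 - (l * a + (1 - l) * b)) * y i)"
      by (rule ext) (simp add: algebra_simps)
    ultimately show "(\<lambda>i. (l * a + (1 - l) * b) * x i + (1 - (l * a + (1 - l) * b)) * y i) \<in> D" by simp
  qed
  have conv: "cl (\<lambda>i. t * x i + (1 - t) * y i)" if x: "cl x" and y: "cl y" and t: "0 \<le> t" "t \<le> 1" for x y t
    unfolding cl_def
  proof (intro allI impI)
    fix e :: real assume e: "e > 0"
    obtain x' where x': "x' \<in> D" "\<forall>i<n. \<bar>x' i - x i\<bar> < e / 2" using x e unfolding cl_def by (meson half_gt_zero)
    obtain y' where y': "y' \<in> D" "\<forall>i<n. \<bar>y' i - y i\<bar> < e / 2" using y e unfolding cl_def by (meson half_gt_zero)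
    obtain s where s: "s \<in> M" "\<bar>s - t\<bar> < e / 2" using weights_dense[OF l M01 Mmix t, of "e / 2"] e by auto
    have "\<bar>s * x' i + (1 - s) * y' i - (t * x i + (1 - t) * y i)\<bar> < e" if i: "i < n" for i
    proof -
      have "s * x' i + (1 - s) * y' i - (t * x i + (1 - t) * y i)
          = (s - t) * (x' i - y' i) + (t * (x' i - x i) + (1 - t) * (y' i - y i))" by (simp add: algebra_simps)
      also have "\<bar>\<dots>\<bar> \<le> \<bar>(s - t) * (x' i - y' i)\<bar> + (\<bar>t * (x' i - x i)\<bar> + \<bar>(1 - t) * (y' i - y i)\<bar>)" by linarith
      also have "\<bar>(s - t) * (x' i - y' i)\<bar> \<le> \<bar>s - t\<bar>"
      proof -
        have "\<bar>x' i - y' i\<bar> \<le> 1" using bnd[OF x'(1), of i] bnd[OF y'(1), of i] by linarith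
        then show ?thesis by (simp add: abs_mult mult_left_le)
      qed
      also have "\<bar>t * (x' i - x i)\<bar> \<le> t * (e / 2)" unfolding abs_mult using x'(2) i t by (intro mult_mono) (auto simp: less_imp_le)
      also have "\<bar>(1 - t) * (y' i - y i)\<bar> \<le> (1 - t) * (e / 2)" unfolding abs_mult using y'(2) i t by (intro mult_mono) (auto simp: less_imp_le)
      also have "t * (e / 2) + (1 - t) * (e / 2) = e / 2" by (simp add: field_simps)
      also have "\<bar>s - t\<bar> + e / 2 < e" using s(2) by linarith
      finally show ?thesis by simp
    qed
    moreover have "(\<lambda>i. s * x' i + (1 - s) * y' i) \<in> D" using s(1) x'(1) y'(1) by (auto simp: M_def)
    ultimately show "\<exists>z\<in>D. \<forall>i<n. \<bar>z i - (t * x i + (1 - t) * y i)\<bar> < e" by (intro bexI) auto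
  qed
  have cong: "cl x" if "cl y" "\<And>i. i < n \<Longrightarrow> x i = y i" for x y
    using that unfolding cl_def by simp
  have vcl: "cl (\<lambda>j. if j = i then 1 else 0)" if "i < n" for i
    using vert[OF that] unfolding cl_def by (auto intro!: bexI[of _ "\<lambda>j. if j = i then 1 else 0"])
  \<comment> \<open>Induction on a bound for the support: \<open>p\<close> is a mixture of the
    vertex of its last coordinate with the renormalised rest \<open>q\<close>.\<close>
  have main: "k \<le> n \<Longrightarrow> (\<And>i. i < n \<Longrightarrow> 0 \<le> p i) \<Longrightarrow> (\<And>i. k \<le> i \<Longrightarrow> i < n \<Longrightarrow> p i = 0) \<Longrightarrow> (\<Sum>i<k. p i) = 1 \<Longrightarrow> cl p" for k p
  proof (induction k arbitrary: p)
    case (Suc k)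
    have s0: "0 \<le> (\<Sum>i<k. p i)" using Suc.prems(1,2) by (intro sum_nonneg) auto
    have s: "(\<Sum>i<k. p i) = 1 - p k" using Suc.prems(4) by simp
    have pk: "0 \<le> p k" "p k \<le> 1" using s s0 Suc.prems(1,2) by auto
    show ?case
    proof (cases "p k = 1")
      case True
      then have "(\<Sum>i<k. p i) = 0" using s by simp
      then have "\<forall>i\<in>{..<k}. p i = 0" using Suc.prems(1,2) by (subst (asm) sum_nonneg_eq_0_iff) auto
      then have "p i = (if i = k then 1 else 0)" if "i < n" for i
        using True Suc.prems(3)[of i] that by (cases "i < k"; cases "i = k") auto
      then show ?thesis using cong[OF vcl[of k], of p] Suc.prems(1) by simp
    next
      case False
      then have p1: "p k < 1" using pk by simp
      define q where "q i = (if i = k then 0 else p i / (1 - p k))" for i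
      have "(\<Sum>i<k. q i) = (\<Sum>i<k. p i / (1 - p k))" by (intro sum.cong) (auto simp: q_def)
      also have "\<dots> = 1" using s p1 by (simp add: sum_divide_distrib[symmetric])
      finally have "cl q" using Suc.prems(1-3) p1 by (intro Suc.IH) (auto simp: q_def)
      then have "cl (\<lambda>i. p k * (if i = k then 1 else 0) + (1 - p k) * q i)"
        using Suc.prems(1) pk by (intro conv vcl) auto
      then show ?thesis by (rule cong) (use p1 in \<open>auto simp: q_def\<close>)
    qed
  qed simp
  have "cl p" using main[of n p] p by auto
  then have "\<forall>m. \<exists>y\<in>D. \<forall>i<n. \<bar>y i - p i\<bar> < 1 / real (Suc m)" unfolding cl_def by simp
  then obtain q where q: "\<And>m. q m \<in> D" "\<And>m i. i < n \<Longrightarrow> \<bar>q m i - p i\<bar> < 1 / real (Suc m)" by metis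
  have "(\<lambda>m. q m i) \<longlonglongrightarrow> p i" if i: "i < n" for i
  proof -
    have "(\<lambda>m. q m i - p i) \<longlonglongrightarrow> 0"
      by (rule LIMSEQ_norm_0) (use q(2)[OF i] in simp)
    then show ?thesis by (simp add: LIM_zero_iff)
  qed
  then show ?thesis using q(1) by blast
qed

section \<open>Typed arrows and sums\<close>

context opt_theory
begin

abbreviation I0 where "I0 \<equiv> triv \<Theta>"

definition ok :: "('s, 't) arrow \<Rightarrow> bool"
  where "ok f \<longleftrightarrow> raw f \<in> transf \<Theta> (src f) (tgt f)"

abbreviation hom :: "('s, 't) arrow \<Rightarrow> 's \<Rightarrow> 's \<Rightarrow> bool"
  where "hom f A B \<equiv> ok f \<and> src f = A \<and> tgt f = B"

definition cmp :: "('s, 't) arrow \<Rightarrow> ('s, 't) arrow \<Rightarrow> ('s, 't) arrow"  (infixr "\<odot>" 70)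
  where "g \<odot> f = Arr (src f) (raw g \<cdot> raw f) (tgt g)"

definition tens :: "('s, 't) arrow \<Rightarrow> ('s, 't) arrow \<Rightarrow> ('s, 't) arrow"  (infixr "\<otimes>" 75)
  where "f \<otimes> g = Arr (src f \<boxdot> src g) (raw f \<boxtimes> raw g) (tgt f \<boxdot> tgt g)"

definition idn :: "'s \<Rightarrow> ('s, 't) arrow" where "idn A = Arr A (\<I> A) A"

definition Sw :: "'s \<Rightarrow> 's \<Rightarrow> ('s, 't) arrow"
  where "Sw A B = Arr (A \<boxdot> B) (sys_swap \<Theta> A B) (B \<boxdot> A)"

definition chan :: "('s, 't) arrow \<Rightarrow> bool"
  where "chan f \<longleftrightarrow> channel \<Theta> (src f) (tgt f) (raw f)"

abbreviation nst :: "('s, 't) arrow \<Rightarrow> 's \<Rightarrow> bool"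
  where "nst x A \<equiv> chan x \<and> src x = I0 \<and> tgt x = A"

definition pr :: "('s, 't) arrow \<Rightarrow> real" where "pr f = val \<Theta> (raw f)"

section \<open>Closure properties and categorical laws of typed arrows\<close>

lemma transf_test: "Ts \<in> tests \<Theta> A B \<Longrightarrow> F \<in> set Ts \<Longrightarrow> F \<in> transf \<Theta> A B"
  by (auto simp: transf_def)

lemma transf_seq:
  assumes "F \<in> transf \<Theta> A B" "G \<in> transf \<Theta> B C"
  shows "G \<cdot> F \<in> transf \<Theta> A C"
proof -
  obtain Fs Gs where F: "Fs \<in> tests \<Theta> A B" "F \<in> set Fs" and G: "Gs \<in> tests \<Theta> B C" "G \<in> set Gs"
    using assms by (auto simp: transf_def)
  let ?L = "concat (map (\<lambda>(F, Ds). map (\<lambda>D. D \<cdot> F) Ds) (zip Fs (replicate (length Fs) Gs)))"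
  have "?L \<in> tests \<Theta> A C"
    by (rule conditional_test[OF F(1)]) (use G in auto)
  moreover have "(F, Gs) \<in> set (zip Fs (replicate (length Fs) Gs))"
    using F(2) by (auto simp: set_zip in_set_conv_nth)
  then have "G \<cdot> F \<in> set ?L"
    using G(2) by force
  ultimately show ?thesis by (rule transf_test)
qed

lemma transf_par:
  assumes "F \<in> transf \<Theta> A B" "G \<in> transf \<Theta> A' B'"
  shows "F \<boxtimes> G \<in> transf \<Theta> (A \<boxdot> A') (B \<boxdot> B')"
proof -
  obtain Fs Gs where F: "Fs \<in> tests \<Theta> A B" "F \<in> set Fs" and G: "Gs \<in> tests \<Theta> A' B'" "G \<in> set Gs"
    using assms by (auto simp: transf_def)
  show ?thesis
    by (rule transf_test[OF par_test[OF F(1) G(1)]]) (use F G in force)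
qed

lemma channel_transf: "channel \<Theta> A B C \<Longrightarrow> C \<in> transf \<Theta> A B"
  by (force simp: channel_def transf_def)

lemma chan_ok: "chan f \<Longrightarrow> ok f"
  by (auto simp: chan_def ok_def channel_transf)

lemma st_cmp [simp]: "src (g \<odot> f) = src f" "tgt (g \<odot> f) = tgt g" "raw (g \<odot> f) = raw g \<cdot> raw f"
  by (simp_all add: cmp_def)

lemma st_tens [simp]: "src (f \<otimes> g) = src f \<boxdot> src g" "tgt (f \<otimes> g) = tgt f \<boxdot> tgt g"
  "raw (f \<otimes> g) = raw f \<boxtimes> raw g"
  by (simp_all add: tens_def)

lemma st_idn [simp]: "src (idn A) = A" "tgt (idn A) = A" "raw (idn A) = \<I> A"
  by (simp_all add: idn_def)

lemma st_Sw [simp]: "src (Sw A B) = A \<boxdot> B" "tgt (Sw A B) = B \<boxdot> A" "raw (Sw A B) = sys_swap \<Theta> A B"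
  by (simp_all add: Sw_def)

declare comp_triv [simp] comp_assoc [simp]

lemma chan_Id [simp]: "chan (idn A)" by (simp add: chan_def idt_test)
lemma chan_Sw [simp]: "chan (Sw A B)" by (simp add: chan_def swap_test)

lemma channel_seq:
  assumes "channel \<Theta> A B F" "channel \<Theta> B C G" shows "channel \<Theta> A C (G \<cdot> F)"
  using conditional_test[of "[F]" A B "[[G]]" C] assms by (simp add: channel_def)

lemma channel_par:
  assumes "channel \<Theta> A B F" "channel \<Theta> A' B' G" shows "channel \<Theta> (A \<boxdot> A') (B \<boxdot> B') (F \<boxtimes> G)"
  using par_test[of "[F]" A B "[G]" A' B'] assms by (simp add: channel_def)

lemma chan_cmp [simp]: "chan f \<Longrightarrow> chan g \<Longrightarrow> tgt f = src g \<Longrightarrow> chan (g \<odot> f)"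
  by (auto simp: chan_def intro: channel_seq)
lemma chan_tens [simp]: "chan f \<Longrightarrow> chan g \<Longrightarrow> chan (f \<otimes> g)"
  by (auto simp: chan_def intro: channel_par)

lemma ok_cmp [simp]: "ok f \<Longrightarrow> ok g \<Longrightarrow> tgt f = src g \<Longrightarrow> ok (g \<odot> f)"
  by (auto simp: ok_def intro: transf_seq)
lemma ok_tens [simp]: "ok f \<Longrightarrow> ok g \<Longrightarrow> ok (f \<otimes> g)"
  by (auto simp: ok_def intro: transf_par)
lemma ok_idn [simp]: "ok (idn A)" by (rule chan_ok) simp
lemma ok_Sw [simp]: "ok (Sw A B)" by (rule chan_ok) simp

lemma cmp_assoc [simp]:
  "ok f \<Longrightarrow> ok g \<Longrightarrow> ok h \<Longrightarrow> tgt f = src g \<Longrightarrow> tgt g = src h \<Longrightarrow> (h \<odot> g) \<odot> f = h \<odot> (g \<odot> f)"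
  by (rule arrow_eqI) (auto simp: ok_def intro: seq_assoc)
lemma cmp_Id [simp]: "ok f \<Longrightarrow> src f = A \<Longrightarrow> f \<odot> idn A = f"
  by (rule arrow_eqI) (auto simp: ok_def intro: seq_idt)
lemma Id_cmp [simp]: "ok f \<Longrightarrow> tgt f = A \<Longrightarrow> idn A \<odot> f = f"
  by (rule arrow_eqI) (auto simp: ok_def intro: seq_idt)
lemma tens_assoc [simp]: "ok f \<Longrightarrow> ok g \<Longrightarrow> ok h \<Longrightarrow> (f \<otimes> g) \<otimes> h = f \<otimes> (g \<otimes> h)"
  by (rule arrow_eqI) (auto simp: ok_def intro: par_assoc)
lemma tens_Id0 [simp]: "ok f \<Longrightarrow> f \<otimes> idn I0 = f" "ok f \<Longrightarrow> idn I0 \<otimes> f = f"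
  by (rule arrow_eqI; auto simp: ok_def par_triv)+
lemma Id_tens_Id [simp]: "idn A \<otimes> idn B = idn (A \<boxdot> B)"
  by (rule arrow_eqI) (auto simp: par_idt)
lemma exch:
  "ok f \<Longrightarrow> ok g \<Longrightarrow> ok f' \<Longrightarrow> ok g' \<Longrightarrow> tgt f = src g \<Longrightarrow> tgt f' = src g' \<Longrightarrow>
   (g \<otimes> g') \<odot> (f \<otimes> f') = (g \<odot> f) \<otimes> (g' \<odot> f')"
  by (rule arrow_eqI) (auto simp: ok_def intro: interchange)
lemma exch3:
  "ok f \<Longrightarrow> ok g \<Longrightarrow> ok f' \<Longrightarrow> ok g' \<Longrightarrow> ok x \<Longrightarrow> tgt f = src g \<Longrightarrow> tgt f' = src g' \<Longrightarrow>
   tgt x = src f \<boxdot> src f' \<Longrightarrow> (g \<otimes> g') \<odot> (f \<otimes> f') \<odot> x = ((g \<odot> f) \<otimes> (g' \<odot> f')) \<odot> x"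
  using cmp_assoc[of x "f \<otimes> f'" "g \<otimes> g'"] exch[of f g f' g'] by simp
lemma cmp_effR:
  assumes "ok f" "ok g" "ok a" "tgt a = I0" "tgt f = src g" shows "g \<odot> (f \<otimes> a) = (g \<odot> f) \<otimes> a"
  using exch[of f g a "idn I0"] assms by simp
lemma cmp_effL:
  assumes "ok f" "ok g" "ok a" "tgt a = I0" "tgt f = src g" shows "g \<odot> (a \<otimes> f) = a \<otimes> (g \<odot> f)"
  using exch[of a "idn I0" f g] assms by simp
lemma cmp_stR:
  assumes "ok f" "ok g" "ok a" "src a = I0" "tgt f = src g" shows "(g \<otimes> a) \<odot> f = (g \<odot> f) \<otimes> a"
  using exch[of f g "idn I0" a] assms by simp
lemma cmp_stL:
  assumes "ok f" "ok g" "ok a" "src a = I0" "tgt f = src g" shows "(a \<otimes> g) \<odot> f = a \<otimes> (g \<odot> f)"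
  using exch[of "idn I0" a f g] assms by simp

lemma Sw_nat: "ok f \<Longrightarrow> ok g \<Longrightarrow> Sw (tgt f) (tgt g) \<odot> (f \<otimes> g) = (g \<otimes> f) \<odot> Sw (src f) (src g)"
  by (rule arrow_eqI) (auto simp: ok_def intro: swap_natural)
lemma Sw_Sw [simp]: "Sw B A \<odot> Sw A B = idn (A \<boxdot> B)"
  by (rule arrow_eqI) (auto simp: swap_swap)
lemma Sw_Sw' [simp]:
  assumes "ok x" "tgt x = A \<boxdot> B" shows "Sw B A \<odot> Sw A B \<odot> x = x"
  using cmp_assoc[of x "Sw A B" "Sw B A"] assms by simp

lemma Sw_comp: "Sw A (B \<boxdot> C) = (idn B \<otimes> Sw A C) \<odot> (Sw A B \<otimes> idn C)"
  by (rule arrow_eqI) (simp_all add: swap_comp)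

text \<open>The hexagon law with two trivial factors makes the swap with the trivial system
  idempotent; being invertible, it is the identity.\<close>

lemma Sw_triv [simp]: "Sw A I0 = idn A" "Sw I0 A = idn A"
proof -
  have *: "Sw A I0 = idn A" for A
  proof -
    have "Sw A I0 = Sw A I0 \<odot> Sw A I0"
      using Sw_comp[of A I0 I0] by simp
    then have "Sw I0 A \<odot> Sw A I0 = Sw I0 A \<odot> (Sw A I0 \<odot> Sw A I0)" by simp
    then show ?thesis by simp
  qed
  show "Sw A I0 = idn A" by (rule *)
  have "Sw I0 A \<odot> Sw A I0 = idn A" using Sw_Sw[of I0 A] by simp
  then show "Sw I0 A = idn A" by (simp add: *)
qed

lemma tens_swap:
  assumes "ok f" "ok g"
  shows "g \<otimes> f = Sw (tgt f) (tgt g) \<odot> (f \<otimes> g) \<odot> Sw (src g) (src f)"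
proof -
  have "Sw (tgt f) (tgt g) \<odot> (f \<otimes> g) \<odot> Sw (src g) (src f)
      = (Sw (tgt f) (tgt g) \<odot> (f \<otimes> g)) \<odot> Sw (src g) (src f)"
    using assms by simp
  also have "\<dots> = g \<otimes> f" using assms by (simp add: Sw_nat)
  finally show ?thesis by simp
qed

lemma Sw_state:
  assumes "ok f" "ok g" "src f = I0" shows "Sw (tgt f) (tgt g) \<odot> (f \<otimes> g) = g \<otimes> f"
  using Sw_nat[of f g] assms by simp

lemma scalar_comm: "ok s \<Longrightarrow> ok f \<Longrightarrow> src s = I0 \<Longrightarrow> tgt s = I0 \<Longrightarrow> f \<otimes> s = s \<otimes> f"
  using Sw_nat[of s f] by simp

lemma pr_test: "ps \<in> tests \<Theta> I0 I0 \<Longrightarrow> p \<in> set ps \<Longrightarrow> 0 \<le> val \<Theta> p \<and> val \<Theta> p \<le> 1"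
proof -
  assume ps: "ps \<in> tests \<Theta> I0 I0" and p: "p \<in> set ps"
  have a: "\<forall>p \<in> set ps. 0 \<le> val \<Theta> p" "sum_list (map (val \<Theta>) ps) = 1"
    using triv_test[OF ps] by auto
  have "val \<Theta> p \<le> sum_list (map (val \<Theta>) ps)"
    by (rule member_le_sum_list) (use a p in auto)
  then show ?thesis using a p by auto
qed

lemma pr_bounds: "hom s I0 I0 \<Longrightarrow> 0 \<le> pr s" "hom s I0 I0 \<Longrightarrow> pr s \<le> 1"
  using pr_test by (auto simp: pr_def ok_def transf_def)

lemma pr_Id [simp]: "pr (idn I0) = 1"
  using triv_test[of "[\<I> I0]"] idt_test[of I0] by (simp add: pr_def channel_def)

lemma pr_cmp:
  assumes "hom s I0 I0" "hom t I0 I0" shows "pr (s \<odot> t) = pr s * pr t"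
  using val_seq[of "raw t" "raw s"] assms by (auto simp: pr_def ok_def)

text \<open>The Eckmann-Hilton argument: both operations share the unit and satisfy the interchange
  law.\<close>

lemma scalar_tens: "hom s I0 I0 \<Longrightarrow> hom t I0 I0 \<Longrightarrow> s \<otimes> t = s \<odot> t"
  using cmp_effR[of "idn I0" s t] scalar_comm[of s t] cmp_effL[of "idn I0" t s]
  by (metis cmp_Id ok_idn st_idn(1,2) tens_Id0(2))

lemma pr_tens [simp]: "hom s I0 I0 \<Longrightarrow> hom t I0 I0 \<Longrightarrow> pr (s \<otimes> t) = pr s * pr t"
  by (simp add: scalar_tens pr_cmp)

lemma state_ext:
  assumes "hom x I0 A" "hom y I0 A" "\<And>a. hom a A I0 \<Longrightarrow> pr (a \<odot> x) = pr (a \<odot> y)" shows "x = y"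
proof (rule arrow_eqI)
  show "raw x = raw y"
  proof (rule state_eqI[of _ A])
    fix a assume "a \<in> effects \<Theta> A"
    then show "val \<Theta> (a \<cdot> raw x) = val \<Theta> (a \<cdot> raw y)"
      using assms(3)[of "Arr A a I0"] by (simp add: ok_def effects_def pr_def)
  qed (use assms in \<open>auto simp: ok_def states_def\<close>)
qed (use assms in auto)

lemma effect_ext:
  assumes "hom a A I0" "hom b A I0" "\<And>x. hom x I0 A \<Longrightarrow> pr (a \<odot> x) = pr (b \<odot> x)" shows "a = b"
proof (rule arrow_eqI)
  show "raw a = raw b"
  proof (rule effect_eqI[of _ A])
    fix x assume "x \<in> states \<Theta> A"
    then show "val \<Theta> (raw a \<cdot> x) = val \<Theta> (raw b \<cdot> x)"
      using assms(3)[of "Arr I0 x A"] by (simp add: ok_def states_def pr_def)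
  qed (use assms in \<open>auto simp: ok_def effects_def\<close>)
qed (use assms in auto)

lemma scalar_ext:
  assumes "hom s I0 I0" "hom t I0 I0" "pr s = pr t" shows "s = t"
  using assms by (intro state_ext[of s I0 t]) (auto simp: pr_cmp)

lemma scalar_test_ex:
  assumes "0 \<le> p" "p \<le> 1"
  obtains s t where "hom s I0 I0" "hom t I0 I0" "pr s = p" "pr t = 1 - p" "[raw s, raw t] \<in> tests \<Theta> I0 I0"
proof -
  obtain ps where ps: "ps \<in> tests \<Theta> I0 I0" "map (val \<Theta>) ps = [p, 1 - p]"
    using triv_test_exists[of "[p, 1 - p]"] assms by auto
  then obtain s t where st: "ps = [s, t]" "val \<Theta> s = p" "val \<Theta> t = 1 - p" by (auto simp: map_eq_Cons_conv)
  show thesis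
    by (rule that[of "Arr I0 s I0" "Arr I0 t I0"]) (use st ps in \<open>auto simp: ok_def pr_def intro: transf_test\<close>)
qed

text \<open>A scalar is an arrow \<open>s : I \<rightarrow> I\<close>; the multiple of \<open>f\<close> by \<open>s\<close> is the arrow \<open>s \<otimes> f\<close>.\<close>

definition scal :: "real \<Rightarrow> ('s, 't) arrow" where "scal p = (SOME s. hom s I0 I0 \<and> pr s = p)"

lemma scal:
  assumes "0 \<le> p" "p \<le> 1"
  shows "ok (scal p)" "src (scal p) = I0" "tgt (scal p) = I0" "pr (scal p) = p"
proof -
  have "\<exists>s. hom s I0 I0 \<and> pr s = p" using scalar_test_ex[OF assms] by metis
  from someI_ex[OF this] show "ok (scal p)" "src (scal p) = I0" "tgt (scal p) = I0" "pr (scal p) = p"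
    by (auto simp: scal_def)
qed

section \<open>Probabilities on extended systems and linear relations between arrows\<close>

definition ap :: "'s \<Rightarrow> ('s, 't) arrow \<Rightarrow> ('s, 't) arrow \<Rightarrow> ('s, 't) arrow \<Rightarrow> real"
  where "ap S E f x = pr (E \<odot> (f \<otimes> idn S) \<odot> x)"

text \<open>A relation and not an operation, since a real linear combination of transformations need
  not be a transformation.\<close>

definition lin :: "('s, 't) arrow \<Rightarrow> 'j set \<Rightarrow> ('j \<Rightarrow> real) \<Rightarrow> ('j \<Rightarrow> ('s, 't) arrow) \<Rightarrow> bool"
  where "lin f J c D \<longleftrightarrow> ok f \<and> (\<forall>j\<in>J. hom (D j) (src f) (tgt f)) \<and>
    (\<forall>S x E. hom x I0 (src f \<boxdot> S) \<longrightarrow> hom E (tgt f \<boxdot> S) I0 \<longrightarrow>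
      ap S E f x = (\<Sum>j\<in>J. c j * ap S E (D j) x))"

lemma ap_prob: "ap S E f x = prob \<Theta> S (raw E) (raw f) (raw x)"
  by (simp add: ap_def prob_def pr_def)

lemma lin_lincomb:
  assumes "ok f" "\<And>j. j \<in> J \<Longrightarrow> hom (D j) (src f) (tgt f)"
  shows "lin f J c D \<longleftrightarrow> lincomb \<Theta> (src f) (tgt f) (raw f) J c (\<lambda>j. raw (D j))"
proof
  assume L: "lin f J c D"
  show "lincomb \<Theta> (src f) (tgt f) (raw f) J c (\<lambda>j. raw (D j))"
    unfolding lincomb_def
  proof (intro allI ballI)
    fix S x E assume "x \<in> states \<Theta> (src f \<boxdot> S)" "E \<in> effects \<Theta> (tgt f \<boxdot> S)"
    then show "prob \<Theta> S E (raw f) x = (\<Sum>j\<in>J. c j * prob \<Theta> S E (raw (D j)) x)"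
      using L[unfolded lin_def, THEN conjunct2, THEN conjunct2, rule_format, of "Arr I0 x (src f \<boxdot> S)" S "Arr (tgt f \<boxdot> S) E I0"]
      by (simp add: ok_def states_def effects_def ap_prob)
  qed
next
  assume L: "lincomb \<Theta> (src f) (tgt f) (raw f) J c (\<lambda>j. raw (D j))"
  show "lin f J c D"
    unfolding lin_def ap_prob
  proof (intro conjI allI impI)
    fix S x E assume "hom x I0 (src f \<boxdot> S)" "hom E (tgt f \<boxdot> S) I0"
    then have "raw x \<in> states \<Theta> (src f \<boxdot> S)" "raw E \<in> effects \<Theta> (tgt f \<boxdot> S)"
      by (auto simp: ok_def states_def effects_def)
    then show "prob \<Theta> S (raw E) (raw f) (raw x) = (\<Sum>j\<in>J. c j * prob \<Theta> S (raw E) (raw (D j)) (raw x))"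
      using L by (simp add: lincomb_def)
  qed (use assms in auto)
qed

lemma ap_cmpL:
  "hom x I0 (src f \<boxdot> S) \<Longrightarrow> hom E (tgt g \<boxdot> S) I0 \<Longrightarrow> ok f \<Longrightarrow> ok g \<Longrightarrow> tgt f = src g \<Longrightarrow>
   ap S E (g \<odot> f) x = ap S (E \<odot> (g \<otimes> idn S)) f x"
  by (simp add: ap_def exch3)

lemma ap_cmpR:
  "hom x I0 (src f \<boxdot> S) \<Longrightarrow> hom E (tgt g \<boxdot> S) I0 \<Longrightarrow> ok f \<Longrightarrow> ok g \<Longrightarrow> tgt f = src g \<Longrightarrow>
   ap S E (g \<odot> f) x = ap S E g ((f \<otimes> idn S) \<odot> x)"
  by (simp add: ap_def exch3)

text \<open>The factor \<open>g\<close> acts on part of the reference system and can be absorbed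
  into the effect. This is where linearity in a tensor factor comes from.\<close>

lemma ap_tensR:
  assumes "hom x I0 (src f \<boxdot> (src g \<boxdot> S))" "hom E (tgt f \<boxdot> (tgt g \<boxdot> S)) I0" "ok f" "ok g"
  shows "ap S E (f \<otimes> g) x = ap (src g \<boxdot> S) (E \<odot> (idn (tgt f) \<otimes> (g \<otimes> idn S))) f x"
proof -
  have "(idn (tgt f) \<otimes> (g \<otimes> idn S)) \<odot> (f \<otimes> idn (src g \<boxdot> S)) \<odot> x = (f \<otimes> (g \<otimes> idn S)) \<odot> x"
    using assms by (subst exch3) auto
  then show ?thesis using assms by (simp add: ap_def)
qed

lemma lin_cmpL:
  "lin f J c D \<Longrightarrow> ok g \<Longrightarrow> src g = tgt f \<Longrightarrow> lin (g \<odot> f) J c (\<lambda>j. g \<odot> D j)"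
  by (auto simp: lin_def ap_cmpL intro!: sum.cong)

lemma lin_cmpR:
  "lin f J c D \<Longrightarrow> ok g \<Longrightarrow> tgt g = src f \<Longrightarrow> lin (f \<odot> g) J c (\<lambda>j. D j \<odot> g)"
  by (auto simp: lin_def ap_cmpR intro!: sum.cong)

lemma lin_tensR: "lin f J c D \<Longrightarrow> ok g \<Longrightarrow> lin (f \<otimes> g) J c (\<lambda>j. D j \<otimes> g)"
  by (auto simp: lin_def ap_tensR intro!: sum.cong)

lemma lin_cong: "lin f J c D \<Longrightarrow> f = g \<Longrightarrow> (\<And>j. j \<in> J \<Longrightarrow> D j = D' j) \<Longrightarrow> lin g J c D'"
  by (simp add: lin_def)

lemma lin_tensL:
  assumes "lin f J c D" "ok g" shows "lin (g \<otimes> f) J c (\<lambda>j. g \<otimes> D j)"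
proof -
  have "lin (Sw (tgt f) (tgt g) \<odot> (f \<otimes> g) \<odot> Sw (src g) (src f)) J c
      (\<lambda>j. Sw (tgt f) (tgt g) \<odot> (D j \<otimes> g) \<odot> Sw (src g) (src f))"
    using assms by (intro lin_cmpL lin_cmpR lin_tensR) (auto simp: lin_def)
  then show ?thesis
    by (rule lin_cong) (use assms in \<open>auto simp: lin_def tens_swap[of f g] tens_swap[of "D _" g]\<close>)
qed

lemma lin_pr:
  assumes "lin f J c D" "src f = I0" "tgt f = I0" shows "pr f = (\<Sum>j\<in>J. c j * pr (D j))"
proof -
  have "ap I0 (idn I0) f (idn I0) = (\<Sum>j\<in>J. c j * ap I0 (idn I0) (D j) (idn I0))"
    using assms(1)[unfolded lin_def, THEN conjunct2, THEN conjunct2, rule_format, of "idn I0" I0 "idn I0"]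
    by (simp add: assms)
  also have "\<dots> = (\<Sum>j\<in>J. c j * pr (D j))"
    by (rule sum.cong) (use assms in \<open>auto simp: lin_def ap_def\<close>)
  finally show ?thesis using assms by (simp add: ap_def lin_def)
qed

lemma ap_ext:
  assumes "ok f" "hom g (src f) (tgt f)"
    "\<And>S x E. hom x I0 (src f \<boxdot> S) \<Longrightarrow> hom E (tgt f \<boxdot> S) I0 \<Longrightarrow> ap S E f x = ap S E g x"
  shows "f = g"
proof (rule arrow_eqI)
  show "raw f = raw g"
  proof (rule transf_eqI[of _ "src f" "tgt f"])
    fix S x assume x: "x \<in> states \<Theta> (src f \<boxdot> S)"
    then have okx: "ok (Arr I0 x (src f \<boxdot> S))" by (simp add: ok_def states_def)
    have "(f \<otimes> idn S) \<odot> (Arr I0 x (src f \<boxdot> S)) = (g \<otimes> idn S) \<odot> (Arr I0 x (src f \<boxdot> S))"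
      by (rule state_ext[of _ "tgt f \<boxdot> S"])
        (use assms okx assms(3)[of "Arr I0 x (src f \<boxdot> S)" S] in \<open>auto simp: ap_def\<close>)
    then have "raw ((f \<otimes> idn S) \<odot> (Arr I0 x (src f \<boxdot> S))) = raw ((g \<otimes> idn S) \<odot> (Arr I0 x (src f \<boxdot> S)))" by simp
    then show "(raw f \<boxtimes> \<I> S) \<cdot> x = (raw g \<boxtimes> \<I> S) \<cdot> x" by simp
  qed (use assms in \<open>auto simp: ok_def\<close>)
qed (use assms in auto)

lemma lin_unique: "lin f J c D \<Longrightarrow> lin g J c D \<Longrightarrow> src g = src f \<Longrightarrow> tgt g = tgt f \<Longrightarrow> f = g"
  by (rule ap_ext) (auto simp: lin_def)

text \<open>For a state the reference system adds nothing: the reference state \<open>r\<close> can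
  be absorbed into the effect. Sums and limits of states can therefore be tested on the effects of
  \<open>A\<close> alone.\<close>

lemma state_hom_ap:
  assumes "hom x I0 A" "hom r I0 S" "hom E (A \<boxdot> S) I0"
  shows "ap S E x r = pr ((E \<odot> (idn A \<otimes> r)) \<odot> x)"
proof -
  have "(x \<otimes> idn S) \<odot> r = (idn A \<otimes> r) \<odot> x"
    using assms cmp_stL[of r "idn S" x] cmp_stR[of x "idn A" r] by simp
  then show ?thesis using assms by (simp add: ap_def)
qed

lemma lin_stateI:
  assumes "hom x I0 A" "\<And>j. j \<in> J \<Longrightarrow> hom (D j) I0 A"
    "\<And>a. hom a A I0 \<Longrightarrow> pr (a \<odot> x) = (\<Sum>j\<in>J. c j * pr (a \<odot> D j))"
  shows "lin x J c D"
  unfolding lin_def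
proof (intro conjI allI impI ballI)
  fix S r E assume r: "hom r I0 (src x \<boxdot> S)" "hom E (tgt x \<boxdot> S) I0"
  have "ap S E x r = (\<Sum>j\<in>J. c j * pr ((E \<odot> (idn A \<otimes> r)) \<odot> D j))"
    using assms r assms(3)[of "E \<odot> (idn A \<otimes> r)"] by (subst state_hom_ap[of _ A]) auto
  also have "\<dots> = (\<Sum>j\<in>J. c j * ap S E (D j) r)"
    by (rule sum.cong) (use assms r in \<open>auto simp: state_hom_ap[of _ A]\<close>)
  finally show "ap S E x r = (\<Sum>j\<in>J. c j * ap S E (D j) r)" .
qed (use assms in auto)

text \<open>Indexing by the booleans lets the lemmas on \<open>lin\<close> carry over without
  reindexing.\<close>

definition add :: "('s, 't) arrow \<Rightarrow> ('s, 't) arrow \<Rightarrow> ('s, 't) arrow \<Rightarrow> bool"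
  where "add f g h \<longleftrightarrow> lin f UNIV (\<lambda>_. 1) (\<lambda>b. if b then g else h)"

lemma add_iff: "add f g h \<longleftrightarrow> ok f \<and> hom g (src f) (tgt f) \<and> hom h (src f) (tgt f) \<and>
    (\<forall>S x E. hom x I0 (src f \<boxdot> S) \<longrightarrow> hom E (tgt f \<boxdot> S) I0 \<longrightarrow> ap S E f x = ap S E g x + ap S E h x)"
  by (auto simp: add_def lin_def UNIV_bool split: if_splits)

lemma add_cmpL: "add f g h \<Longrightarrow> ok k \<Longrightarrow> src k = tgt f \<Longrightarrow> add (k \<odot> f) (k \<odot> g) (k \<odot> h)"
  unfolding add_def by (drule lin_cmpL[where g = k]) (auto elim!: lin_cong)
lemma add_cmpR: "add f g h \<Longrightarrow> ok k \<Longrightarrow> tgt k = src f \<Longrightarrow> add (f \<odot> k) (g \<odot> k) (h \<odot> k)"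
  unfolding add_def by (drule lin_cmpR[where g = k]) (auto elim!: lin_cong)
lemma add_tensL: "add f g h \<Longrightarrow> ok k \<Longrightarrow> add (k \<otimes> f) (k \<otimes> g) (k \<otimes> h)"
  unfolding add_def by (drule lin_tensL[where g = k]) (auto elim!: lin_cong)
lemma add_tensR: "add f g h \<Longrightarrow> ok k \<Longrightarrow> add (f \<otimes> k) (g \<otimes> k) (h \<otimes> k)"
  unfolding add_def by (drule lin_tensR[where g = k]) (auto elim!: lin_cong)
lemma add_pr0: "add f g h \<Longrightarrow> src f = I0 \<Longrightarrow> tgt f = I0 \<Longrightarrow> pr f = pr g + pr h"
  unfolding add_def by (drule lin_pr) (auto simp: UNIV_bool)
lemma add_type: "add f g h \<Longrightarrow> ok f \<and> ok g \<and> ok h \<and> src g = src f \<and> src h = src f \<and> tgt g = tgt f \<and> tgt h = tgt f"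
  by (auto simp: add_iff)
lemma add_eff: "add a b c \<Longrightarrow> tgt a = I0 \<Longrightarrow> hom x I0 (src a) \<Longrightarrow> pr (a \<odot> x) = pr (b \<odot> x) + pr (c \<odot> x)"
  using add_pr0[OF add_cmpR[of a b c x]] by simp
lemma add_st: "add x y z \<Longrightarrow> src x = I0 \<Longrightarrow> hom a (tgt x) I0 \<Longrightarrow> pr (a \<odot> x) = pr (a \<odot> y) + pr (a \<odot> z)"
  using add_pr0[OF add_cmpL[of x y z a]] by simp
lemma add_ap: "add f g h \<Longrightarrow> hom x I0 (src f \<boxdot> S) \<Longrightarrow> hom E (tgt f \<boxdot> S) I0 \<Longrightarrow> ap S E f x = ap S E g x + ap S E h x"
  by (simp add: add_iff)

lemma ap_nonneg: "ok f \<Longrightarrow> hom x I0 (src f \<boxdot> S) \<Longrightarrow> hom E (tgt f \<boxdot> S) I0 \<Longrightarrow> 0 \<le> ap S E f x"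
  unfolding ap_def by (rule pr_bounds) auto

lemma ap_scalar:
  assumes "hom s I0 I0" "ok f" "hom x I0 (src f \<boxdot> S)" "hom E (tgt f \<boxdot> S) I0"
  shows "ap S E (s \<otimes> f) x = pr s * ap S E f x"
proof -
  have "E \<odot> ((s \<otimes> f) \<otimes> idn S) \<odot> x = s \<otimes> (E \<odot> (f \<otimes> idn S) \<odot> x)"
    using assms by (simp add: cmp_stL cmp_effL)
  then show ?thesis using assms by (simp add: ap_def)
qed

lemma scalar_cancel:
  assumes "hom s I0 I0" "pr s \<noteq> 0" "ok f" "ok g" "s \<otimes> f = s \<otimes> g" "src g = src f" "tgt g = tgt f"
  shows "f = g"
proof (rule ap_ext)
  fix S x E assume "hom x I0 (src f \<boxdot> S)" "hom E (tgt f \<boxdot> S) I0"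
  then show "ap S E f x = ap S E g x"
    using assms ap_scalar[of s f x S E] ap_scalar[of s g x S E] by simp
qed (use assms in auto)

section \<open>Tests of arrows and purity\<close>

definition arrow_test :: "'s \<Rightarrow> 's \<Rightarrow> ('s, 't) arrow list \<Rightarrow> bool"
  where "arrow_test A B Fs \<longleftrightarrow> (\<forall>F\<in>set Fs. src F = A \<and> tgt F = B) \<and> map raw Fs \<in> tests \<Theta> A B"

lemma arrow_test_hom: "arrow_test A B Fs \<Longrightarrow> F \<in> set Fs \<Longrightarrow> hom F A B"
  by (auto simp: arrow_test_def ok_def intro: transf_test)

lemma arrow_test_raw: "Ts \<in> tests \<Theta> A B \<Longrightarrow> arrow_test A B (map (\<lambda>T. Arr A T B) Ts)"
  by (simp add: arrow_test_def o_def)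

lemma ok_arrow_test:
  assumes "hom f A B" obtains Fs where "arrow_test A B Fs" "f \<in> set Fs"
proof -
  obtain Ts where Ts: "Ts \<in> tests \<Theta> A B" "raw f \<in> set Ts" using assms by (auto simp: ok_def transf_def)
  have "f = Arr A (raw f) B" by (rule arrow_eqI) (use assms in auto)
  then have "f \<in> set (map (\<lambda>T. Arr A T B) Ts)" using Ts(2) by auto
  then show thesis using that arrow_test_raw[OF Ts(1)] by blast
qed

lemma arrow_test_chan: "arrow_test A B [f] \<longleftrightarrow> chan f \<and> src f = A \<and> tgt f = B"
  by (auto simp: arrow_test_def chan_def channel_def)

lemma arrow_test_coarse:
  assumes "arrow_test A B Cs" "f ` {..<length Cs} = {..<m}"
  obtains Ds where "arrow_test A B Ds" "length Ds = m"
    "\<forall>j<m. lin (Ds ! j) {i. i < length Cs \<and> f i = j} (\<lambda>_. 1) (\<lambda>i. Cs ! i)"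
proof -
  obtain Ts where Ts: "Ts \<in> tests \<Theta> A B" "length Ts = m"
    "\<And>j. j < m \<Longrightarrow> is_sum \<Theta> A B (Ts ! j) {i. i < length Cs \<and> f i = j} (\<lambda>i. map raw Cs ! i)"
  proof -
    have "map raw Cs \<in> tests \<Theta> A B" "f ` {..<length (map raw Cs)} = {..<m}"
      using assms by (simp_all add: arrow_test_def)
    from coarse_grain[OF this] that show thesis by (simp only: length_map) blast
  qed
  let ?Ds = "map (\<lambda>T. Arr A T B) Ts"
  have t: "arrow_test A B ?Ds" by (rule arrow_test_raw[OF Ts(1)])
  have "lin (?Ds ! j) {i. i < length Cs \<and> f i = j} (\<lambda>_. 1) (\<lambda>i. Cs ! i)" if j: "j < m" for j
  proof -
    have h: "hom (?Ds ! j) A B" using arrow_test_hom[OF t, of "?Ds ! j"] j Ts(2) by auto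
    have C: "hom (Cs ! i) A B" if "i < length Cs" for i using arrow_test_hom[OF assms(1)] that by auto
    have "lincomb \<Theta> A B (raw (?Ds ! j)) {i. i < length Cs \<and> f i = j} (\<lambda>_. 1) (\<lambda>i. raw (Cs ! i))"
      using Ts(3)[OF j] j Ts(2) unfolding is_sum_def lincomb_def by (auto intro!: sum.cong)
    then show ?thesis using h C by (subst lin_lincomb) auto
  qed
  then show thesis using that[OF t] Ts(2) by simp
qed

lemma arrow_test_cond:
  assumes "arrow_test A B Fs" "length Dss = length Fs" "\<And>Ds. Ds \<in> set Dss \<Longrightarrow> arrow_test B C Ds"
  shows "arrow_test A C (concat (map (\<lambda>(F, Ds). map (\<lambda>D. D \<odot> F) Ds) (zip Fs Dss)))"
proof -
  have "concat (map (\<lambda>(F, Ds). map (\<lambda>D. D \<cdot> F) Ds) (zip (map raw Fs) (map (map raw) Dss))) \<in> tests \<Theta> A C"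
  proof (rule conditional_test)
    show "map raw Fs \<in> tests \<Theta> A B" using assms(1) by (simp add: arrow_test_def)
    show "set (map (map raw) Dss) \<subseteq> tests \<Theta> B C" using assms(3) by (auto simp: arrow_test_def)
  qed (use assms(2) in simp)
  moreover have "map raw (concat (map (\<lambda>(F, Ds). map (\<lambda>D. D \<odot> F) Ds) (zip Fs Dss)))
    = concat (map (\<lambda>(F, Ds). map (\<lambda>D. D \<cdot> F) Ds) (zip (map raw Fs) (map (map raw) Dss)))"
    by (simp add: map_concat zip_map_map o_def split_def)
  moreover have "src F = A \<and> tgt F = C"
    if "F \<in> set (concat (map (\<lambda>(F, Ds). map (\<lambda>D. D \<odot> F) Ds) (zip Fs Dss)))" for F
    using that assms by (fastforce simp: arrow_test_def dest: set_zip_leftD set_zip_rightD)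
  ultimately show ?thesis by (simp add: arrow_test_def)
qed

lemma concat_singletons: "concat (map (\<lambda>(F, Ds). map (\<lambda>D. k D F) Ds) (zip Fs (replicate (length Fs) [g]))) = map (\<lambda>F. k g F) Fs"
  by (induction Fs) auto

lemma arrow_test_cmpL:
  assumes "arrow_test A B Fs" "chan g" "src g = B" shows "arrow_test A (tgt g) (map (\<lambda>F. g \<odot> F) Fs)"
  using arrow_test_cond[OF assms(1), of "replicate (length Fs) [g]" "tgt g"] assms
  by (auto simp: arrow_test_chan concat_singletons)

lemma arrow_test_cmpR:
  assumes "arrow_test A B Fs" "chan g" "tgt g = A" shows "arrow_test (src g) B (map (\<lambda>F. F \<odot> g) Fs)"
  using arrow_test_cond[of "src g" A "[g]" "[Fs]" B] assms by (auto simp: arrow_test_chan)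

lemma arrow_test_tensL:
  assumes "arrow_test A B Fs" "chan g" shows "arrow_test (src g \<boxdot> A) (tgt g \<boxdot> B) (map (\<lambda>F. g \<otimes> F) Fs)"
  using par_test[of "[raw g]" "src g" "tgt g" "map raw Fs" A B] assms
  by (auto simp: arrow_test_def chan_def channel_def o_def)

lemma arrow_test_tensR:
  assumes "arrow_test A B Fs" "chan g" shows "arrow_test (A \<boxdot> src g) (B \<boxdot> tgt g) (map (\<lambda>F. F \<otimes> g) Fs)"
  using par_test[of "map raw Fs" A B "[raw g]" "src g" "tgt g"] assms
  by (auto simp: arrow_test_def chan_def channel_def o_def)

lemma arrow_test_scalars:
  assumes "\<forall>r\<in>set rs. 0 \<le> r" "sum_list rs = 1"
  obtains ss where "arrow_test I0 I0 ss" "map pr ss = rs"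
proof -
  obtain ps where "ps \<in> tests \<Theta> I0 I0" "map (val \<Theta>) ps = rs"
    using triv_test_exists[OF assms] by auto
  then show thesis using that[of "map (\<lambda>p. Arr I0 p I0) ps"] by (auto simp: arrow_test_raw pr_def[abs_def] o_def)
qed

lemma scalar_cmpR: "hom s I0 I0 \<Longrightarrow> ok f \<Longrightarrow> src f = A \<Longrightarrow> f \<odot> (s \<otimes> idn A) = s \<otimes> f"
  by (simp add: cmp_effL)

text \<open>Coarse-graining requires every block of the partition to be non-empty. Choosing the test
  with probability 1 and three further copies of it with probability 0 supplies outcomes that can
  fill empty blocks without changing any sum.\<close>

lemma arrow_test_pad:
  assumes "arrow_test A B Ts"
  obtains L where "arrow_test A B (Ts @ L)" "length L = 3 * length Ts"
    "\<forall>Z\<in>set L. \<forall>S E x. hom x I0 (A \<boxdot> S) \<longrightarrow> hom E (B \<boxdot> S) I0 \<longrightarrow> ap S E Z x = 0"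
proof -
  obtain ss where ss: "arrow_test I0 I0 ss" "map pr ss = [1, 0, 0, 0]"
    by (rule arrow_test_scalars[of "[1, 0, 0, 0]"]) auto
  then obtain s a b c where s: "ss = [s, a, b, c]" "pr s = 1" "pr a = 0" "pr b = 0" "pr c = 0"
    by (auto simp: map_eq_Cons_conv)
  have hs: "hom s I0 I0" "hom a I0 I0" "hom b I0 I0" "hom c I0 I0"
    using arrow_test_hom[OF ss(1)] s(1) by auto
  then have "s = idn I0" using s by (intro scalar_ext) auto
  have hT: "hom F A B" if "F \<in> set Ts" for F using arrow_test_hom[OF assms that] .
  have m: "map (\<lambda>D. D \<odot> (t \<otimes> idn A)) Ts = map (\<lambda>D. t \<otimes> D) Ts" if "hom t I0 I0" for t
    using hT that by (auto simp: scalar_cmpR)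
  have "arrow_test A A [s \<otimes> idn A, a \<otimes> idn A, b \<otimes> idn A, c \<otimes> idn A]"
    using arrow_test_tensR[OF ss(1), of "idn A"] s(1) by simp
  from arrow_test_cond[OF this, of "[Ts, Ts, Ts, Ts]" B]
  have "arrow_test A B (map (\<lambda>D. s \<otimes> D) Ts @ map (\<lambda>D. a \<otimes> D) Ts @ map (\<lambda>D. b \<otimes> D) Ts @ map (\<lambda>D. c \<otimes> D) Ts)"
    using assms hs by (auto simp: m)
  also have "map (\<lambda>D. s \<otimes> D) Ts = Ts"
    using hT \<open>s = idn I0\<close> by (intro map_idI) auto
  finally show thesis
    by (rule that) (use hs s hT in \<open>auto simp: ap_scalar\<close>)
qed

lemma arrow_test_split3:
  assumes T: "arrow_test A B Ts" "Ts \<noteq> []" and X: "X \<subseteq> {..<length Ts}" "Y \<subseteq> {..<length Ts}" "X \<inter> Y = {}"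
  obtains g h k where "arrow_test A B [g, h, k]" "lin g X (\<lambda>_. 1) (\<lambda>i. Ts ! i)" "lin h Y (\<lambda>_. 1) (\<lambda>i. Ts ! i)"
proof -
  obtain L where L: "arrow_test A B (Ts @ L)" "length L = 3 * length Ts"
    "\<forall>Z\<in>set L. \<forall>S E x. hom x I0 (A \<boxdot> S) \<longrightarrow> hom E (B \<boxdot> S) I0 \<longrightarrow> ap S E Z x = 0"
    using arrow_test_pad[OF T(1)] by blast
  define n where "n = length Ts"
  have n: "n \<ge> 1" using T(2) by (cases Ts) (auto simp: n_def)
  \<comment> \<open>The padding outcomes at positions \<open>n\<close>, \<open>n + 1\<close> and
    \<open>n + 2\<close> go to the blocks 0, 1 and 2, so each block is inhabited even if
    \<open>X\<close> or \<open>Y\<close> is empty or nothing is left over.\<close>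
  define f :: "nat \<Rightarrow> nat" where
    "f i = (if i \<in> X then 0 else if i \<in> Y then 1 else if i < n then 2 else if i = n then 0 else if i = n + 1 then 1 else 2)" for i
  have len: "length (Ts @ L) = 4 * n" using L by (simp add: n_def)
  have fn: "f n = 0" "f (n + 1) = 1" "f (n + 2) = 2" using X by (auto simp: f_def n_def)
  have "f ` {..<4 * n} = {..<3}"
  proof (intro equalityI subsetI)
    fix j assume "j \<in> f ` {..<4 * n}"
    then show "j \<in> {..<3}" by (auto simp: f_def)
  next
    fix j :: nat assume "j \<in> {..<3}"
    then consider "j = 0" | "j = 1" | "j = 2" by (auto simp: less_Suc_eq numeral_3_eq_3)
    then have "f (n + j) = j" using fn by cases simp_all
    then show "j \<in> f ` {..<4 * n}" using n \<open>j \<in> {..<3}\<close> by (intro image_eqI[of _ _ "n + j"]) simp_all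
  qed
  then have im: "f ` {..<length (Ts @ L)} = {..<3}" by (simp only: len)
  obtain Ds where Ds: "arrow_test A B Ds" "length Ds = 3"
    "\<forall>j<3. lin (Ds ! j) {i. i < length (Ts @ L) \<and> f i = j} (\<lambda>_. 1) (\<lambda>i. (Ts @ L) ! i)"
    using arrow_test_coarse[OF L(1) im] by blast
  obtain g h k where D: "Ds = [g, h, k]"
    using Ds(2) by (auto simp: length_Suc_conv numeral_3_eq_3)
  have hT: "hom (Ts ! i) A B" if "i < n" for i using arrow_test_hom[OF T(1)] that by (auto simp: n_def)
  have hgh: "hom g A B" "hom h A B" using arrow_test_hom[OF Ds(1)] D by auto
  have red: "lin q Z (\<lambda>_. 1) (\<lambda>i. Ts ! i)"
    if q: "hom q A B" "lin q (Z \<union> {m}) (\<lambda>_. 1) (\<lambda>i. (Ts @ L) ! i)" and Z: "Z \<subseteq> {..<n}" and m: "n \<le> m" "m < 4 * n" for q Z m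
    unfolding lin_def
  proof (intro conjI allI impI ballI)
    fix S x E assume x: "hom x I0 (src q \<boxdot> S)" "hom E (tgt q \<boxdot> S) I0"
    have "L ! (m - n) \<in> set L" using m L(2) by (intro nth_mem) (auto simp: n_def)
    then have z: "ap S E ((Ts @ L) ! m) x = 0" using L(3) \<open>L ! (m - n) \<in> set L\<close> x q m by (simp add: nth_append n_def)
    have "finite Z" using Z finite_subset by blast
    have "ap S E q x = (\<Sum>i\<in>Z \<union> {m}. 1 * ap S E ((Ts @ L) ! i) x)"
      using q(2) x by (simp add: lin_def)
    also have "\<dots> = (\<Sum>i\<in>Z. 1 * ap S E ((Ts @ L) ! i) x)"
      using \<open>finite Z\<close> Z m z by (subst sum.union_disjoint) auto
    also have "\<dots> = (\<Sum>i\<in>Z. 1 * ap S E (Ts ! i) x)"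
      by (rule sum.cong) (use Z in \<open>auto simp: nth_append n_def\<close>)
    finally show "ap S E q x = (\<Sum>i\<in>Z. 1 * ap S E (Ts ! i) x)" .
  qed (use q hT Z in auto)
  have "{i. i < length (Ts @ L) \<and> f i = 0} = X \<union> {n}" "{i. i < length (Ts @ L) \<and> f i = 1} = Y \<union> {n + 1}"
  proof -
    have fi: "f i = 0 \<longleftrightarrow> i \<in> X \<union> {n}" "f i = 1 \<longleftrightarrow> i \<in> Y \<union> {n + 1}" for i
      using X by (auto simp: f_def n_def)
    have "X \<union> {n} \<subseteq> {..<4 * n}" "Y \<union> {n + 1} \<subseteq> {..<4 * n}" using X n by (auto simp: n_def)
    then show "{i. i < length (Ts @ L) \<and> f i = 0} = X \<union> {n}" "{i. i < length (Ts @ L) \<and> f i = 1} = Y \<union> {n + 1}"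
      unfolding len fi by blast+
  qed
  then have "lin g (X \<union> {n}) (\<lambda>_. 1) (\<lambda>i. (Ts @ L) ! i)" "lin h (Y \<union> {n + 1}) (\<lambda>_. 1) (\<lambda>i. (Ts @ L) ! i)"
    using Ds(3)[rule_format, of 0] Ds(3)[rule_format, of 1] D by auto
  then have "lin g X (\<lambda>_. 1) (\<lambda>i. Ts ! i)" "lin h Y (\<lambda>_. 1) (\<lambda>i. Ts ! i)"
    using red[of g X n] red[of h Y "n + 1"] hgh X n T(2) by (auto simp: n_def)
  then show thesis using that Ds(1) D by blast
qed

lemma lin_single: "ok f \<Longrightarrow> lin f {i} (\<lambda>_. 1) (\<lambda>_. f)"
  by (auto simp: lin_def)

lemma arrow_test_merge:
  assumes "arrow_test A B [a, b, c]" obtains d where "arrow_test A B [a, d]" "add d b c"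
proof -
  define f :: "nat \<Rightarrow> nat" where "f i = (if i = 0 then 0 else 1)" for i
  have len: "length [a, b, c] = 3" by simp
  have im: "f ` {..<length [a, b, c]} = {..<2}"
  proof (intro equalityI subsetI)
    fix j :: nat assume "j \<in> {..<2}"
    then have "f j = j" "j < 3" by (auto simp: f_def)
    then show "j \<in> f ` {..<length [a, b, c]}" unfolding len by (intro image_eqI[of _ _ j]) simp_all
  qed (auto simp: f_def)
  obtain Ds where Ds: "arrow_test A B Ds" "length Ds = 2"
    "\<forall>j<2. lin (Ds ! j) {i. i < length [a, b, c] \<and> f i = j} (\<lambda>_. 1) (\<lambda>i. [a, b, c] ! i)"
    using arrow_test_coarse[OF assms im] by blast
  obtain a' d where D: "Ds = [a', d]" using Ds(2) by (auto simp: length_Suc_conv numeral_2_eq_2)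
  have h: "hom a A B" "hom b A B" "hom c A B" "hom a' A B" "hom d A B"
    using arrow_test_hom[OF assms] arrow_test_hom[OF Ds(1)] D by auto
  have s: "{i. i < length [a, b, c] \<and> f i = 0} = {0}" "{i. i < length [a, b, c] \<and> f i = 1} = {1, 2}"
    unfolding len by (auto simp: f_def)
  have "lin a' {0} (\<lambda>_. 1) (\<lambda>i. [a, b, c] ! i)" "lin d {1, 2} (\<lambda>_. 1) (\<lambda>i. [a, b, c] ! i)"
    using Ds(3)[rule_format, of 0, unfolded s] Ds(3)[rule_format, of 1, unfolded s] D by simp_all
  then have 1: "lin a' {0} (\<lambda>_. 1) (\<lambda>_. a)" and 2: "add d b c"
    using h by (simp_all add: lin_def add_iff)
  have "a' = a"
    by (rule lin_unique[OF 1 lin_single]) (use h in auto)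
  then show thesis using that Ds(1) D 2 by blast
qed

lemma arrow_test_sum:
  assumes "arrow_test A B Ts" "Ts \<noteq> []"
  obtains c where "chan c" "src c = A" "tgt c = B" "lin c {..<length Ts} (\<lambda>_. 1) (\<lambda>i. Ts ! i)"
proof -
  have "(\<lambda>_. 0::nat) ` {..<length Ts} = {..<1}" using assms(2) by (auto simp: image_constant_conv)
  from arrow_test_coarse[OF assms(1) this] obtain Ds where Ds: "arrow_test A B Ds" "length Ds = 1"
    "\<forall>j<1. lin (Ds ! j) {i. i < length Ts \<and> 0 = j} (\<lambda>_. 1) (\<lambda>i. Ts ! i)" by blast
  then obtain c where c: "Ds = [c]" by (metis One_nat_def length_0_conv length_Suc_conv)
  have "{i. i < length Ts \<and> (0::nat) = 0} = {..<length Ts}" by auto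
  then show thesis using that[of c] Ds(1) Ds(3)[rule_format, of 0] c by (auto simp: arrow_test_chan)
qed

lemma arrow_test_sum2:
  assumes "arrow_test A B [a, b]" obtains c where "chan c" "src c = A" "tgt c = B" "add c a b"
proof -
  obtain c where c: "chan c" "src c = A" "tgt c = B" "lin c {..<length [a,b]} (\<lambda>_. 1) (\<lambda>i. [a, b] ! i)"
    using arrow_test_sum[OF assms] by auto
  have "{..<length [a, b]} = {0, 1}" by auto
  then have "add c a b" using c(4) by (auto simp: lin_def add_iff)
  then show thesis using that c by blast
qed

lemma complement:
  assumes "hom f A B"
  obtains f' c where "arrow_test A B [f, f']" "chan c" "src c = A" "tgt c = B" "add c f f'"
proof -
  obtain Fs where Fs: "arrow_test A B Fs" "f \<in> set Fs" using ok_arrow_test[OF assms] by blast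
  then obtain k where k: "k < length Fs" "Fs ! k = f" by (auto simp: in_set_conv_nth)
  obtain g h j where ghj: "arrow_test A B [g, h, j]" "lin g {k} (\<lambda>_. 1) (\<lambda>i. Fs ! i)"
    using arrow_test_split3[OF Fs(1), of "{k}" "{}"] Fs(2) k by (metis empty_iff empty_set empty_subsetI inf_bot_right insert_subset lessThan_iff)
  have gh: "hom g A B" using arrow_test_hom[OF ghj(1)] by simp
  have "lin g {k} (\<lambda>_. 1) (\<lambda>_. f)" by (rule lin_cong[OF ghj(2)]) (use k in auto)
  then have "g = f" by (rule lin_unique[OF _ lin_single]) (use gh assms in auto)
  with ghj(1) obtain d where "arrow_test A B [f, d]" using arrow_test_merge by blast
  then show thesis using that arrow_test_sum2 by metis
qed

text \<open>Purity speaks of a part of a test, so \<open>g\<close> and \<open>h\<close> need not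
  exhaust it; all remaining outcomes are lumped into the single \<open>k\<close>.\<close>

definition coexist :: "('s, 't) arrow \<Rightarrow> ('s, 't) arrow \<Rightarrow> bool"
  where "coexist g h \<longleftrightarrow> (\<exists>k. arrow_test (src g) (tgt g) [g, h, k])"

lemma coexist_cmpL: "coexist g h \<Longrightarrow> chan f \<Longrightarrow> src f = tgt g \<Longrightarrow> coexist (f \<odot> g) (f \<odot> h)"
  by (force simp: coexist_def dest: arrow_test_cmpL)
lemma coexist_cmpR: "coexist g h \<Longrightarrow> chan f \<Longrightarrow> tgt f = src g \<Longrightarrow> coexist (g \<odot> f) (h \<odot> f)"
  by (force simp: coexist_def dest: arrow_test_cmpR)
lemma coexist_tensL: "coexist g h \<Longrightarrow> chan f \<Longrightarrow> coexist (f \<otimes> g) (f \<otimes> h)"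
  by (force simp: coexist_def dest: arrow_test_tensL)
lemma coexist_tensR: "coexist g h \<Longrightarrow> chan f \<Longrightarrow> coexist (g \<otimes> f) (h \<otimes> f)"
  by (force simp: coexist_def dest: arrow_test_tensR)

lemma arrow_test_coex: assumes "arrow_test A B [g, h]" shows "coexist g h"
proof -
  have hh: "hom g A B" "hom h A B" using arrow_test_hom[OF assms] by auto
  obtain g' h' k where 3: "arrow_test A B [g', h', k]" "lin g' {0} (\<lambda>_. 1) (\<lambda>i. [g, h] ! i)" "lin h' {1} (\<lambda>_. 1) (\<lambda>i. [g, h] ! i)"
    using arrow_test_split3[OF assms, of "{0}" "{1}"] by auto
  have "lin g' {0::nat} (\<lambda>_. 1) (\<lambda>_. g)" by (rule lin_cong[OF 3(2)]) simp_all
  moreover have "lin h' {1::nat} (\<lambda>_. 1) (\<lambda>_. h)" by (rule lin_cong[OF 3(3)]) simp_all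
  ultimately have "g' = g" "h' = h"
    using lin_unique[OF _ lin_single[of g "0::nat"], of g'] lin_unique[OF _ lin_single[of h "1::nat"], of h'] hh arrow_test_hom[OF 3(1)] by auto
  then show ?thesis using 3(1) hh by (auto simp: coexist_def)
qed

text \<open>The factor in the definition of purity is a ratio of probabilities, hence itself a scalar of the theory;
  lemma \<open>Pure_pure\<close> identifies this notion with the given one.\<close>

definition Pure :: "('s, 't) arrow \<Rightarrow> bool"
  where "Pure f \<longleftrightarrow> ok f \<and> (\<forall>g h. coexist g h \<longrightarrow> add f g h \<longrightarrow> (\<exists>s. hom s I0 I0 \<and> g = s \<otimes> f))"

lemma Pure_ok: "Pure f \<Longrightarrow> ok f" by (simp add: Pure_def)

lemma PureD: "Pure f \<Longrightarrow> coexist g h \<Longrightarrow> add f g h \<Longrightarrow> \<exists>s. hom s I0 I0 \<and> g = s \<otimes> f"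
  by (auto simp: Pure_def)

lemma is_multiple_lin:
  assumes "ok f" "hom g (src f) (tgt f)"
  shows "is_multiple \<Theta> (src f) (tgt f) (raw g) (raw f) \<longleftrightarrow>
    (\<exists>c. \<forall>S x E. hom x I0 (src f \<boxdot> S) \<longrightarrow> hom E (tgt f \<boxdot> S) I0 \<longrightarrow> ap S E g x = c * ap S E f x)"
proof -
  have "is_multiple \<Theta> (src f) (tgt f) (raw g) (raw f) \<longleftrightarrow> (\<exists>c. lin g {()} (\<lambda>_. c) (\<lambda>_. f))"
    using lin_lincomb[of g "{()}" "\<lambda>_. f"] assms by (simp add: is_multiple_def)
  then show ?thesis using assms by (simp add: lin_def)
qed

lemma Pure_pure: "Pure f \<longleftrightarrow> pure \<Theta> (src f) (tgt f) (raw f)"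
proof
  assume P: "Pure f"
  show "pure \<Theta> (src f) (tgt f) (raw f)"
    unfolding pure_def
  proof (intro conjI ballI allI impI)
    show "raw f \<in> transf \<Theta> (src f) (tgt f)" using Pure_ok[OF P] by (simp add: ok_def)
    fix Ds X i assume Ds: "Ds \<in> tests \<Theta> (src f) (tgt f)" and X: "X \<subseteq> {..<length Ds}"
      and s: "is_sum \<Theta> (src f) (tgt f) (raw f) X (\<lambda>i. Ds ! i)" and i: "i \<in> X"
    let ?D = "map (\<lambda>T. Arr (src f) T (tgt f)) Ds"
    have t: "arrow_test (src f) (tgt f) ?D" by (rule arrow_test_raw[OF Ds])
    have ne: "?D \<noteq> []" using X i by auto
    have h: "hom (?D ! j) (src f) (tgt f)" if "j \<in> X" for j using arrow_test_hom[OF t, of "?D ! j"] that X by auto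
    have lf: "lin f X (\<lambda>_. 1) (\<lambda>j. ?D ! j)"
      using Pure_ok[OF P] h s X unfolding is_sum_def
      by (subst lin_lincomb) (auto simp: lincomb_def intro!: sum.cong)
    have "{i} \<subseteq> {..<length ?D}" "X - {i} \<subseteq> {..<length ?D}" "{i} \<inter> (X - {i}) = {}" using X i by auto
    from arrow_test_split3[OF t ne this] obtain g h' k where
      3: "arrow_test (src f) (tgt f) [g, h', k]" "lin g {i} (\<lambda>_. 1) (\<lambda>i. ?D ! i)" "lin h' (X - {i}) (\<lambda>_. 1) (\<lambda>i. ?D ! i)" by blast
    have hh: "hom g (src f) (tgt f)" "hom h' (src f) (tgt f)" using arrow_test_hom[OF 3(1)] by auto
    have "lin g {i} (\<lambda>_. 1) (\<lambda>_. ?D ! i)" by (rule lin_cong[OF 3(2)]) auto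
    then have g: "g = ?D ! i" by (rule lin_unique[OF _ lin_single]) (use hh h[OF i] in auto)
    have "finite X" using X finite_subset by blast
    then have "add f g h'"
      using lf 3(2,3) hh i Pure_ok[OF P] by (auto simp: add_iff lin_def sum.remove)
    moreover have "coexist g h'" using 3(1) hh by (auto simp: coexist_def)
    ultimately obtain s where "hom s I0 I0" "g = s \<otimes> f" using PureD[OF P] by blast
    then have "is_multiple \<Theta> (src f) (tgt f) (raw g) (raw f)"
      using is_multiple_lin[of f g] hh Pure_ok[OF P] by (auto simp: ap_scalar)
    then show "is_multiple \<Theta> (src f) (tgt f) (Ds ! i) (raw f)" using g X i by (simp add: subset_iff)
  qed
next
  assume P: "pure \<Theta> (src f) (tgt f) (raw f)"
  then have okf: "ok f" by (simp add: pure_def ok_def)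
  show "Pure f"
    unfolding Pure_def
  proof (intro conjI allI impI okf)
    fix g h assume gh: "coexist g h" "add f g h"
    have ty: "hom g (src f) (tgt f)" "hom h (src f) (tgt f)" using add_type[OF gh(2)] by auto
    obtain k where k: "arrow_test (src f) (tgt f) [g, h, k]" using gh(1) ty by (auto simp: coexist_def)
    have "is_sum \<Theta> (src f) (tgt f) (raw f) {0, 1} (\<lambda>i. [raw g, raw h, raw k] ! i)"
    proof -
      have D: "hom ([g, h, k] ! j) (src f) (tgt f)" if "j \<in> {0, 1}" for j using that ty by auto
      have "lin f {0, 1} (\<lambda>_. 1) (\<lambda>i. [g, h, k] ! i)"
        using gh(2) D okf by (auto simp: lin_def add_iff)
      then have "lincomb \<Theta> (src f) (tgt f) (raw f) {0, 1} (\<lambda>_. 1) (\<lambda>i. raw ([g, h, k] ! i))"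
        using lin_lincomb[of f "{0, 1}" "\<lambda>i. [g, h, k] ! i" "\<lambda>_. 1"] D okf by blast
      then show ?thesis by (simp add: is_sum_def lincomb_def)
    qed
    then have "is_multiple \<Theta> (src f) (tgt f) ([raw g, raw h, raw k] ! 0) (raw f)"
      using P[unfolded pure_def, THEN conjunct2, rule_format, of "[raw g, raw h, raw k]" "{0, 1}" 0] k
      by (auto simp: arrow_test_def)
    then obtain c where c: "\<And>S x E. hom x I0 (src f \<boxdot> S) \<Longrightarrow> hom E (tgt f \<boxdot> S) I0 \<Longrightarrow> ap S E g x = c * ap S E f x"
      using is_multiple_lin[of f g] okf ty by auto
    show "\<exists>s. hom s I0 I0 \<and> g = s \<otimes> f"
    \<comment> \<open>At a point where \<open>f\<close> does not vanish the factor is a ratio of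
      probabilities and lies between 0 and 1. If \<open>f\<close> vanishes everywhere, so does
      \<open>g\<close>, and the factor 1 serves.\<close>
    proof (cases "\<exists>S x E. hom x I0 (src f \<boxdot> S) \<and> hom E (tgt f \<boxdot> S) I0 \<and> ap S E f x \<noteq> 0")
      case True
      then obtain S x E where x: "hom x I0 (src f \<boxdot> S)" "hom E (tgt f \<boxdot> S) I0" "ap S E f x \<noteq> 0" by blast
      have p: "0 \<le> ap S E g x" "0 \<le> ap S E h x" "0 \<le> ap S E f x" using x ty okf by (auto intro!: ap_nonneg)
      have e: "ap S E f x = ap S E g x + ap S E h x" using gh(2) x by (simp add: add_iff)
      have g: "ap S E g x = c * ap S E f x" using c x by simp
      have "0 \<le> c" using p g x by (metis less_eq_real_def linorder_not_less mult_neg_pos)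
      moreover have "c \<le> 1"
      proof (rule ccontr)
        assume "\<not> c \<le> 1"
        then have "1 * ap S E f x < c * ap S E f x" using p x by (intro mult_strict_right_mono) auto
        then show False using e g p by linarith
      qed
      ultimately have s: "hom (scal c) I0 I0" "pr (scal c) = c" using scal by auto
      have "g = scal c \<otimes> f" using s c ty okf by (intro ap_ext) (auto simp: ap_scalar)
      then show ?thesis using s by blast
    next
      case False
      have "g = f"
      proof (rule ap_ext)
        fix S x E assume "hom x I0 (src g \<boxdot> S)" "hom E (tgt g \<boxdot> S) I0"
        then show "ap S E g x = ap S E f x" using False c[of x S E] ty by auto
      qed (use ty okf in auto)
      then have "g = idn I0 \<otimes> f" using okf by simp
      then show ?thesis by (intro exI[of _ "idn I0"]) auto
    qed
  qed
qed

end

section \<open>Causality and compactness of state spaces\<close>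

context causal_opt_theory
begin

definition Dis :: "'a \<Rightarrow> ('a, 'b) arrow" where "Dis A = Arr A (\<u> A) I0"

lemma st_Dis [simp]: "src (Dis A) = A" "tgt (Dis A) = I0" "raw (Dis A) = \<u> A"
  by (simp_all add: Dis_def)

lemma chan_Dis [simp]: "chan (Dis A)"
  using theI'[OF causality[of A]] by (simp add: chan_def discard_def)
lemma ok_Dis [simp]: "ok (Dis A)" by (rule chan_ok) simp

lemma Dis_unique: "chan f \<Longrightarrow> tgt f = I0 \<Longrightarrow> src f = A \<Longrightarrow> f = Dis A"
  using the1_equality[OF causality[of A], of "raw f"]
  by (intro arrow_eqI) (simp_all add: chan_def discard_def)

lemma Dis_cmp [simp]: "chan f \<Longrightarrow> tgt f = A \<Longrightarrow> Dis A \<odot> f = Dis (src f)"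
  by (rule Dis_unique) auto
lemma Dis_tens: "Dis A \<otimes> Dis B = Dis (A \<boxdot> B)"
  by (rule Dis_unique) auto
lemma Dis_triv [simp]: "Dis I0 = idn I0"
  by (rule Dis_unique[symmetric]) auto

lemma complement_effect:
  assumes "hom a A I0"
  obtains a' where "hom a' A I0" "arrow_test A I0 [a, a']" "coexist a a'" "add (Dis A) a a'"
proof -
  obtain a' c where c: "arrow_test A I0 [a, a']" "chan c" "src c = A" "tgt c = I0" "add c a a'"
    using complement[OF assms] by blast
  then have "c = Dis A" by (intro Dis_unique) auto
  then show thesis using that c arrow_test_coex[OF c(1)] arrow_test_hom[OF c(1), of a'] by auto
qed

lemma pr_effect_le:
  assumes "hom a A I0" "hom x I0 A" shows "pr (a \<odot> x) \<le> pr (Dis A \<odot> x)"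
proof -
  obtain a' where a': "hom a' A I0" "add (Dis A) a a'" using complement_effect[OF assms(1)] by blast
  have "pr (Dis A \<odot> x) = pr (a \<odot> x) + pr (a' \<odot> x)" using add_eff[OF a'(2)] assms by simp
  moreover have "0 \<le> pr (a' \<odot> x)" using a' assms by (intro pr_bounds) auto
  ultimately show ?thesis by simp
qed

text \<open>Let \<open>f'\<close> complete \<open>f\<close> to a test. The probabilities of
  \<open>f'\<close> are at most those of \<open>f'\<close> followed by discarding, and these vanish
  because \<open>f\<close> alone already accounts for the whole deterministic effect. Hence
  \<open>f\<close> equals the sum of the test.\<close>

lemma chanI:
  assumes "ok f" "Dis (tgt f) \<odot> f = Dis (src f)" shows "chan f"
proof -
  let ?A = "src f" and ?B = "tgt f"
  obtain f' c where c: "arrow_test ?A ?B [f, f']" "chan c" "src c = ?A" "tgt c = ?B" "add c f f'"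
    using complement[of f ?A ?B] assms by blast
  have f': "hom f' ?A ?B" using arrow_test_hom[OF c(1), of f'] by simp
  have "c = f"
  proof (rule ap_ext)
    fix S x E assume x: "hom x I0 (src c \<boxdot> S)" "hom E (tgt c \<boxdot> S) I0"
    have e: "Dis (?B \<boxdot> S) \<odot> (f' \<otimes> idn S) = Dis S \<odot> ((Dis ?B \<odot> f') \<otimes> idn S)"
    proof -
      have "Dis (?B \<boxdot> S) \<odot> (f' \<otimes> idn S) = (Dis ?B \<otimes> Dis S) \<odot> (f' \<otimes> idn S)" by (simp only: Dis_tens)
      also have "\<dots> = (Dis ?B \<odot> f') \<otimes> Dis S" using f' by (subst exch) simp_all
      also have "\<dots> = Dis S \<odot> ((Dis ?B \<odot> f') \<otimes> idn S)" using f' by (subst cmp_effL) simp_all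
      finally show ?thesis .
    qed
    have "ap S E f' x \<le> pr (Dis (?B \<boxdot> S) \<odot> ((f' \<otimes> idn S) \<odot> x))"
      unfolding ap_def by (rule pr_effect_le) (use x f' c in simp_all)
    also have "Dis (?B \<boxdot> S) \<odot> ((f' \<otimes> idn S) \<odot> x) = (Dis (?B \<boxdot> S) \<odot> (f' \<otimes> idn S)) \<odot> x"
      using x f' c by (subst cmp_assoc) simp_all
    also have "pr \<dots> = ap S (Dis S) (Dis ?B \<odot> f') x"
      unfolding e ap_def using x f' c by (subst cmp_assoc) simp_all
    also have "\<dots> = 0"
    proof -
      have "add (Dis ?B \<odot> c) (Dis ?B \<odot> f) (Dis ?B \<odot> f')" using c by (intro add_cmpL) auto
      then have "add (Dis ?A) (Dis ?A) (Dis ?B \<odot> f')" using c assms by simp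
      from add_ap[OF this, of x S "Dis S"] show ?thesis using x c(3,4) by simp
    qed
    finally have "ap S E f' x \<le> 0" .
    moreover have "0 \<le> ap S E f' x" using x f' c by (intro ap_nonneg) auto
    ultimately show "ap S E c x = ap S E f x" using add_ap[OF c(5), of x S E] x by simp
  qed (use c(2-4) chan_ok[OF c(2)] assms in simp_all)
  then show ?thesis using c by simp
qed

text \<open>By \<open>chanI\<close> a state of total probability 1 is a channel from the trivial
  system. Normalised states thereby inherit all closure properties of channels.\<close>

lemma normalised_iff: "normalised \<Theta> A x \<longleftrightarrow> nst (Arr I0 x A) A"
proof
  assume n: "normalised \<Theta> A x"
  then have ok: "ok (Arr I0 x A)" by (simp add: normalised_def ok_def states_def)
  have "Dis A \<odot> Arr I0 x A = idn I0"
    by (rule scalar_ext) (use n ok in \<open>auto simp: normalised_def pr_def[of "_ \<odot> _"]\<close>)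
  then show "nst (Arr I0 x A) A" using chanI[of "Arr I0 x A"] ok by simp
next
  assume n: "nst (Arr I0 x A) A"
  then have "raw (Dis A \<odot> Arr I0 x A) = raw (idn I0)" by simp
  then have "\<u> A \<cdot> x = \<I> I0" by simp
  then show "normalised \<Theta> A x" using chan_ok[of "Arr I0 x A"] n pr_Id
    by (simp add: normalised_def pr_def ok_def states_def)
qed

lemma pr_scal: "hom s I0 I0 \<Longrightarrow> hom x I0 A \<Longrightarrow> hom a A I0 \<Longrightarrow> pr (a \<odot> (s \<otimes> x)) = pr s * pr (a \<odot> x)"
  by (simp add: cmp_effL)

section \<open>Convex mixtures of states\<close>

lemma binary_mixture:
  assumes "nst x A" "nst y A" "0 \<le> p" "p \<le> 1"
  obtains s t z where "hom s I0 I0" "hom t I0 I0" "pr s = p" "pr t = 1 - p"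
    "arrow_test I0 A [s \<otimes> x, t \<otimes> y]" "nst z A" "add z (s \<otimes> x) (t \<otimes> y)"
    "\<forall>a. hom a A I0 \<longrightarrow> pr (a \<odot> z) = p * pr (a \<odot> x) + (1 - p) * pr (a \<odot> y)"
proof -
  obtain s t where st: "hom s I0 I0" "hom t I0 I0" "pr s = p" "pr t = 1 - p" "[raw s, raw t] \<in> tests \<Theta> I0 I0"
    using scalar_test_ex[OF assms(3,4)] by blast
  have ok: "ok x" "ok y" using assms chan_ok by auto
  have "arrow_test I0 I0 [s, t]" using st by (simp add: arrow_test_def)
  moreover have "arrow_test I0 A Ds" if "Ds \<in> set [[x], [y]]" for Ds using that assms by (auto simp: arrow_test_chan)
  ultimately have "arrow_test I0 A [x \<odot> s, y \<odot> t]" using arrow_test_cond[of I0 I0 "[s, t]" "[[x], [y]]" A] by simp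
  also have "x \<odot> s = s \<otimes> x" using cmp_effL[of "idn I0" x s] ok assms st by simp
  also have "y \<odot> t = t \<otimes> y" using cmp_effL[of "idn I0" y t] ok assms st by simp
  finally have T: "arrow_test I0 A [s \<otimes> x, t \<otimes> y]" .
  obtain z where "chan z" "src z = I0" "tgt z = A" and z2: "add z (s \<otimes> x) (t \<otimes> y)" by (rule arrow_test_sum2[OF T])
  then have z: "nst z A" "add z (s \<otimes> x) (t \<otimes> y)" by simp_all
  have E: "\<forall>a. hom a A I0 \<longrightarrow> pr (a \<odot> z) = p * pr (a \<odot> x) + (1 - p) * pr (a \<odot> y)"
    using add_st[OF z(2)] z(1) st ok assms by (auto simp: pr_scal)
  show thesis
    by (rule that[OF _ _ st(3,4) T z E]) (use st in simp_all)
qed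

lemma binary_mixture_exists:
  assumes "nst x A" "nst y A" "0 \<le> p" "p \<le> 1"
  shows "\<exists>z. nst z A \<and> (\<forall>a. hom a A I0 \<longrightarrow> pr (a \<odot> z) = p * pr (a \<odot> x) + (1 - p) * pr (a \<odot> y))"
proof (rule binary_mixture[OF assms])
  fix s t z
  assume "nst z A" "\<forall>a. hom a A I0 \<longrightarrow> pr (a \<odot> z) = p * pr (a \<odot> x) + (1 - p) * pr (a \<odot> y)"
  then show ?thesis by blast
qed

lemma mix_finite:
  assumes "finite J" "\<And>j. j \<in> J \<Longrightarrow> nst (F j) A" "\<And>j. j \<in> J \<Longrightarrow> 0 \<le> q j" "sum q J = 1"
  shows "\<exists>z. nst z A \<and> (\<forall>a. hom a A I0 \<longrightarrow> pr (a \<odot> z) = (\<Sum>j\<in>J. q j * pr (a \<odot> F j)))"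
  using assms
proof (induction J arbitrary: q rule: finite_induct)
  case (insert i J)
  have q: "q i + sum q J = 1" using insert by simp
  have nn: "0 \<le> sum q J" using insert.prems by (auto intro!: sum_nonneg)
  show ?case
  proof (cases "sum q J = 0")
    case True
    then have z: "q j = 0" if "j \<in> J" for j
      using that insert.hyps(1) insert.prems(2) by (simp add: sum_nonneg_eq_0_iff)
    have "(\<Sum>j\<in>insert i J. q j * pr (a \<odot> F j)) = pr (a \<odot> F i)" for a
      using insert.hyps q True z by simp
    then show ?thesis using insert.prems(1)[of i] by (intro exI[of _ "F i"]) simp
  next
    case False
    let ?S = "sum q J"
    have pos: "?S > 0" using False nn by simp
    have "\<exists>y. nst y A \<and> (\<forall>a. hom a A I0 \<longrightarrow> pr (a \<odot> y) = (\<Sum>j\<in>J. q j / ?S * pr (a \<odot> F j)))"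
    proof (rule insert.IH)
      show "(\<Sum>j\<in>J. q j / ?S) = 1" using pos by (simp add: sum_divide_distrib[symmetric])
      show "nst (F j) A" if "j \<in> J" for j using insert.prems(1)[of j] that by simp
      show "0 \<le> q j / ?S" if "j \<in> J" for j using insert.prems(2)[of j] that pos by simp
    qed
    then obtain y where y: "nst y A" "\<forall>a. hom a A I0 \<longrightarrow> pr (a \<odot> y) = (\<Sum>j\<in>J. q j / ?S * pr (a \<odot> F j))" by blast
    have Fi: "nst (F i) A" "0 \<le> q i" "q i \<le> 1"
      using insert.prems(1)[of i] insert.prems(2)[of i] q nn by simp_all
    obtain z where z: "nst z A" "\<forall>a. hom a A I0 \<longrightarrow> pr (a \<odot> z) = q i * pr (a \<odot> F i) + (1 - q i) * pr (a \<odot> y)"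
      using binary_mixture_exists[OF Fi(1) y(1) Fi(2,3)] by blast
    have "1 - q i = ?S" using q by simp
    then have "(1 - q i) * (\<Sum>j\<in>J. q j / ?S * pr (a \<odot> F j)) = (\<Sum>j\<in>J. q j * pr (a \<odot> F j))" for a
      using pos by (simp add: sum_distrib_left)
    then have "\<forall>a. hom a A I0 \<longrightarrow> pr (a \<odot> z) = (\<Sum>j\<in>insert i J. q j * pr (a \<odot> F j))"
      using z(2) y(2) insert.hyps by simp
    then show ?thesis using z(1) by blast
  qed
qed simp

section \<open>Finite coordinates and compactness of the set of normalised states\<close>

definition Eff :: "'a \<Rightarrow> ('a, 'b) arrow set" where "Eff A = {a. hom a A I0}"

text \<open>Interpolation is applied to finitely many spanning states, viewed as functions of the
  effect. The coordinates of a state become its probabilities on the effects in \<open>K\<close>,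
  which lie in the unit interval and give compactness. The single constant \<open>C\<close> bounds
  all coefficients uniformly; the later quantitative estimates rest on it.\<close>

lemma finite_frame:
  obtains K b F m C where "finite K" "K \<subseteq> Eff A" "finite F" "\<forall>f\<in>F. hom f I0 A" "0 \<le> C"
    "\<forall>x a. hom x I0 A \<longrightarrow> hom a A I0 \<longrightarrow> pr (a \<odot> x) = (\<Sum>k\<in>K. pr (k \<odot> x) * b k a)"
    "\<forall>k\<in>K. \<forall>a\<in>Eff A. b k a = (\<Sum>f\<in>F. m k f * pr (a \<odot> f))"
    "\<forall>k\<in>K. \<forall>a\<in>Eff A. \<bar>b k a\<bar> \<le> C" "(\<Sum>k\<in>K. \<Sum>f\<in>F. \<bar>m k f\<bar>) \<le> C"
proof -
  obtain G where G: "finite G" "G \<subseteq> transf \<Theta> I0 A"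
    "\<forall>T \<in> transf \<Theta> I0 A. \<exists>c. lincomb \<Theta> I0 A T G c (\<lambda>F. F)"
    using finite_dim[of I0 A] by (elim exE conjE) (rule that)
  define F where "F = (\<lambda>T. Arr I0 T A) ` G"
  have F: "finite F" "\<forall>f\<in>F. hom f I0 A" using G by (auto simp: F_def ok_def)
  have inj: "inj_on (\<lambda>T. Arr I0 T A) G" by (auto simp: inj_on_def)
  have span: "\<exists>c. \<forall>a. hom a A I0 \<longrightarrow> pr (a \<odot> x) = (\<Sum>f\<in>F. c f * pr (a \<odot> f))" if x: "hom x I0 A" for x
  proof -
    have "raw x \<in> transf \<Theta> I0 A" using x by (auto simp: ok_def)
    from bspec[OF G(3) this] obtain c where c: "lincomb \<Theta> I0 A (raw x) G c (\<lambda>F. F)" by (elim exE) (rule that)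
    have l: "lin x G c (\<lambda>T. Arr I0 T A)"
      using x G(2) c by (subst lin_lincomb) (auto simp: ok_def)
    have cr: "\<forall>a. hom a A I0 \<longrightarrow> pr (a \<odot> x) = (\<Sum>f\<in>F. (c \<circ> raw) f * pr (a \<odot> f))"
    proof (intro allI impI)
      fix a assume a: "hom a A I0"
      have "pr (a \<odot> x) = (\<Sum>T\<in>G. c T * pr (a \<odot> Arr I0 T A))"
        using lin_pr[OF lin_cmpL[OF l, of a]] a x by simp
      then show "pr (a \<odot> x) = (\<Sum>f\<in>F. (c \<circ> raw) f * pr (a \<odot> f))"
        unfolding F_def by (subst sum.reindex[OF inj]) simp
    qed
    show ?thesis by (rule exI[where x = "c \<circ> raw"]) (rule cr)
  qed
  obtain K b m where K: "finite K" "K \<subseteq> Eff A"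
    and v: "\<forall>f\<in>F. \<forall>a\<in>Eff A. pr (a \<odot> f) = (\<Sum>k\<in>K. pr (k \<odot> f) * b k a)"
    and m: "\<forall>k\<in>K. \<forall>a\<in>Eff A. b k a = (\<Sum>f\<in>F. m k f * pr (a \<odot> f))"
    using interpolation[OF F(1), of "Eff A" "\<lambda>f a. pr (a \<odot> f)"] by (elim exE conjE) (rule that)
  define C where "C = (\<Sum>k\<in>K. \<Sum>f\<in>F. \<bar>m k f\<bar>)"
  have C0: "0 \<le> C" by (auto simp: C_def intro!: sum_nonneg)
  have x: "pr (a \<odot> x) = (\<Sum>k\<in>K. pr (k \<odot> x) * b k a)" if xh: "hom x I0 A" and a: "hom a A I0" for x a
  proof -
    obtain c where c: "\<And>a. hom a A I0 \<Longrightarrow> pr (a \<odot> x) = (\<Sum>f\<in>F. c f * pr (a \<odot> f))" using span[OF xh] by blast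
    have "pr (a \<odot> x) = (\<Sum>f\<in>F. \<Sum>k\<in>K. c f * pr (k \<odot> f) * b k a)"
      using c[OF a] v a by (simp add: Eff_def sum_distrib_left mult.assoc)
    also have "\<dots> = (\<Sum>k\<in>K. (\<Sum>f\<in>F. c f * pr (k \<odot> f)) * b k a)"
      by (subst sum.swap) (simp add: sum_distrib_right)
    also have "\<dots> = (\<Sum>k\<in>K. pr (k \<odot> x) * b k a)"
      by (intro sum.cong) (use K c in \<open>auto simp: Eff_def\<close>)
    finally show ?thesis .
  qed
  have B: "\<bar>b k a\<bar> \<le> C" if k: "k \<in> K" and a: "a \<in> Eff A" for k a
  proof -
    have "\<bar>b k a\<bar> \<le> (\<Sum>f\<in>F. \<bar>m k f * pr (a \<odot> f)\<bar>)" using m k a by auto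
    also have "\<dots> \<le> (\<Sum>f\<in>F. \<bar>m k f\<bar>)"
    proof (rule sum_mono)
      fix f assume "f \<in> F"
      then have "hom (a \<odot> f) I0 I0" using F a by (auto simp: Eff_def)
      then have "0 \<le> pr (a \<odot> f)" "pr (a \<odot> f) \<le> 1" using pr_bounds by blast+
      then show "\<bar>m k f * pr (a \<odot> f)\<bar> \<le> \<bar>m k f\<bar>" by (simp add: abs_mult mult_left_le)
    qed
    also have "\<dots> \<le> C" unfolding C_def by (rule member_le_sum[OF k]) (use K in \<open>auto intro!: sum_nonneg\<close>)
    finally show ?thesis .
  qed
  show thesis
    by (rule that[OF K F C0 _ m])
      (use x B in \<open>simp_all add: C_def\<close>)
qed

text \<open>Convergence on the finitely many effects in \<open>K\<close> forces convergence on all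
  effects, so closedness yields a limit. Normalisation survives because it is the value on the
  deterministic effect.\<close>

lemma state_compact:
  assumes X: "\<And>n. nst (X n) A"
  obtains x r where "nst x A" "strict_mono (r :: nat \<Rightarrow> nat)"
    "\<forall>a. hom a A I0 \<longrightarrow> (\<lambda>n. pr (a \<odot> X (r n))) \<longlonglongrightarrow> pr (a \<odot> x)"
proof -
  obtain K b where K: "finite K" "K \<subseteq> Eff A"
    "\<forall>x a. hom x I0 A \<longrightarrow> hom a A I0 \<longrightarrow> pr (a \<odot> x) = (\<Sum>k\<in>K. pr (k \<odot> x) * b k a)"
    by (rule finite_frame[of A]) (rule that)
  have hX: "hom (X n) I0 A" for n using X chan_ok by auto
  have "\<exists>r::nat\<Rightarrow>nat. strict_mono r \<and> (\<forall>k\<in>K. convergent (\<lambda>n. pr (k \<odot> X (r n))))"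
  proof (rule convergent_subseq_finite[OF K(1), of "\<lambda>k n. pr (k \<odot> X n)"])
    fix k n assume "k \<in> K"
    then have "hom (k \<odot> X n) I0 I0" using K(2) hX[of n] by (auto simp: Eff_def)
    then show "0 \<le> pr (k \<odot> X n) \<and> pr (k \<odot> X n) \<le> 1" using pr_bounds by blast
  qed
  then obtain r :: "nat \<Rightarrow> nat" where r: "strict_mono r" "\<forall>k\<in>K. convergent (\<lambda>n. pr (k \<odot> X (r n)))" by blast
  have conv: "convergent (\<lambda>n. pr (a \<odot> X (r n)))" if a: "hom a A I0" for a
  proof -
    have "convergent (\<lambda>n. \<Sum>k\<in>K. pr (k \<odot> X (r n)) * b k a)"
      using r(2) by (intro convergent_sum convergent_mult convergent_const) auto
    then show ?thesis using K(3) a hX by simp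
  qed
  have "\<exists>T \<in> transf \<Theta> I0 A. tends_to \<Theta> I0 A (\<lambda>n. raw (X (r n))) T"
  proof (rule closed_transf)
    show "raw (X (r n)) \<in> transf \<Theta> I0 A" for n using hX[of "r n"] by (auto simp: ok_def)
    fix S y E assume "y \<in> states \<Theta> (I0 \<boxdot> S)" "E \<in> effects \<Theta> (A \<boxdot> S)"
    then have y: "hom (Arr I0 y S) I0 S" "hom (Arr (A \<boxdot> S) E I0) (A \<boxdot> S) I0"
      by (auto simp: ok_def states_def effects_def)
    have "prob \<Theta> S E (raw (X (r n))) y = pr ((Arr (A \<boxdot> S) E I0 \<odot> (idn A \<otimes> Arr I0 y S)) \<odot> X (r n))" for n
      using ap_prob[of S "Arr (A \<boxdot> S) E I0" "X (r n)" "Arr I0 y S"] state_hom_ap[OF hX y] by simp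
    moreover have "hom (Arr (A \<boxdot> S) E I0 \<odot> (idn A \<otimes> Arr I0 y S)) A I0" using y by simp
    ultimately show "convergent (\<lambda>n. prob \<Theta> S E (raw (X (r n))) y)" using conv by simp
  qed
  then obtain T where T: "T \<in> transf \<Theta> I0 A" "tends_to \<Theta> I0 A (\<lambda>n. raw (X (r n))) T" by blast
  define x where "x = Arr I0 T A"
  have x: "hom x I0 A" using T by (simp add: x_def ok_def)
  have lim: "(\<lambda>n. pr (a \<odot> X (r n))) \<longlonglongrightarrow> pr (a \<odot> x)" if a: "hom a A I0" for a
  proof -
    have "raw (idn I0) \<in> states \<Theta> (I0 \<boxdot> I0)" "raw a \<in> effects \<Theta> (A \<boxdot> I0)"
      using a ok_idn[of I0] by (auto simp: states_def effects_def ok_def)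
    then have "(\<lambda>n. prob \<Theta> I0 (raw a) (raw (X (r n))) (raw (idn I0))) \<longlonglongrightarrow> prob \<Theta> I0 (raw a) (raw x) (raw (idn I0))"
      using T(2) by (simp add: tends_to_def x_def)
    moreover have "prob \<Theta> I0 (raw a) (raw z) (raw (idn I0)) = pr (a \<odot> z)" if "hom z I0 A" for z
      unfolding ap_prob[symmetric] ap_def using a that by simp
    ultimately show ?thesis using x hX by (simp del: st_idn)
  qed
  have "(\<lambda>n. pr (Dis A \<odot> X (r n))) \<longlonglongrightarrow> pr (Dis A \<odot> x)" by (rule lim) simp
  moreover have "Dis A \<odot> X n = idn I0" for n using X[of n] by simp
  ultimately have "pr (Dis A \<odot> x) = 1" by (simp add: LIMSEQ_const_iff)
  then have "Dis A \<odot> x = idn I0" using x by (intro scalar_ext) auto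
  then have "nst x A" using chanI[of x] x by simp
  then show thesis
    by (rule that[OF _ r(1)]) (use lim in simp)
qed

end

section \<open>Invariant states\<close>

context sharp_theory_with_purification
begin

abbreviation pst :: "('a, 'b) arrow \<Rightarrow> 'a \<Rightarrow> bool" where "pst x A \<equiv> nst x A \<and> Pure x"

section \<open>Reversible channels as typed arrows\<close>

definition invertible :: "('a, 'b) arrow \<Rightarrow> 'a \<Rightarrow> 'a \<Rightarrow> bool"
  where "invertible U A B \<longleftrightarrow> chan U \<and> src U = A \<and> tgt U = B \<and>
    (\<exists>V. chan V \<and> src V = B \<and> tgt V = A \<and> V \<odot> U = idn A \<and> U \<odot> V = idn B)"

lemma invertible_reversible: "invertible U A B \<longleftrightarrow> src U = A \<and> tgt U = B \<and> reversible \<Theta> A B (raw U)"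
proof
  assume "invertible U A B"
  then obtain V where V: "chan U" "src U = A" "tgt U = B" "chan V" "src V = B" "tgt V = A"
    "V \<odot> U = idn A" "U \<odot> V = idn B" by (auto simp: invertible_def)
  have "raw (V \<odot> U) = raw (idn A)" "raw (U \<odot> V) = raw (idn B)" using V by simp_all
  then show "src U = A \<and> tgt U = B \<and> reversible \<Theta> A B (raw U)"
    using V(1-6) unfolding reversible_def chan_def by (intro conjI exI[of _ "raw V"]) simp_all
next
  assume r: "src U = A \<and> tgt U = B \<and> reversible \<Theta> A B (raw U)"
  then obtain V where V: "channel \<Theta> A B (raw U)" "channel \<Theta> B A V" "V \<cdot> raw U = \<I> A" "raw U \<cdot> V = \<I> B"
    by (auto simp: reversible_def)
  have "Arr B V A \<odot> U = idn A" "U \<odot> Arr B V A = idn B" using V r by (auto intro: arrow_eqI)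
  then show "invertible U A B" using V r unfolding invertible_def by (auto simp: chan_def intro!: exI[of _ "Arr B V A"])
qed

lemma invertible_chan: "invertible U A B \<Longrightarrow> chan U \<and> ok U \<and> src U = A \<and> tgt U = B"
  by (auto simp: invertible_def chan_ok)

lemma invertibleE:
  assumes "invertible U A B"
  obtains V where "invertible V B A" "chan V" "ok V" "src V = B" "tgt V = A" "V \<odot> U = idn A" "U \<odot> V = idn B"
  using assms that chan_ok unfolding invertible_def by blast

lemma invertible_idn: "invertible (idn A) A A"
  unfolding invertible_def by (auto intro!: exI[of _ "idn A"])

lemma invertible_Sw: "invertible (Sw A B) (A \<boxdot> B) (B \<boxdot> A)"
  unfolding invertible_def by (auto intro!: exI[of _ "Sw B A"])

lemma cmp_reassoc:
  assumes "g \<odot> f = k" "ok x" "ok f" "ok g" "tgt x = src f" "tgt f = src g"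
  shows "g \<odot> (f \<odot> x) = k \<odot> x"
  using cmp_assoc[of x f g] assms by simp

lemma invertible_cmp:
  assumes "invertible U A B" "invertible V B C" shows "invertible (V \<odot> U) A C"
proof -
  obtain U' where U': "chan U'" "ok U'" "src U' = B" "tgt U' = A" "U' \<odot> U = idn A" "U \<odot> U' = idn B" using invertibleE[OF assms(1)] by blast
  obtain V' where V': "chan V'" "ok V'" "src V' = C" "tgt V' = B" "V' \<odot> V = idn B" "V \<odot> V' = idn C" using invertibleE[OF assms(2)] by blast
  note r = invertible_chan[OF assms(1)] invertible_chan[OF assms(2)]
  have "V' \<odot> (V \<odot> U) = U" using r V' cmp_reassoc[OF V'(5), of U] by simp
  then have 1: "(U' \<odot> V') \<odot> (V \<odot> U) = idn A" using r U' V' by simp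
  have "U \<odot> (U' \<odot> V') = V'" using r U' V' cmp_reassoc[OF U'(6), of V'] by simp
  then have 2: "(V \<odot> U) \<odot> (U' \<odot> V') = idn C" using r U' V' by simp
  show ?thesis unfolding invertible_def using 1 2 r U' V' by (auto intro!: exI[of _ "U' \<odot> V'"])
qed

lemma invertible_tens:
  assumes "invertible U A B" "invertible V C D" shows "invertible (U \<otimes> V) (A \<boxdot> C) (B \<boxdot> D)"
proof -
  obtain U' where U': "chan U'" "ok U'" "src U' = B" "tgt U' = A" "U' \<odot> U = idn A" "U \<odot> U' = idn B" using invertibleE[OF assms(1)] by blast
  obtain V' where V': "chan V'" "ok V'" "src V' = D" "tgt V' = C" "V' \<odot> V = idn C" "V \<odot> V' = idn D" using invertibleE[OF assms(2)] by blast
  note r = invertible_chan[OF assms(1)] invertible_chan[OF assms(2)]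
  have "(U' \<otimes> V') \<odot> (U \<otimes> V) = idn (A \<boxdot> C)" "(U \<otimes> V) \<odot> (U' \<otimes> V') = idn (B \<boxdot> D)"
    using r U' V' by (simp_all add: exch)
  then show ?thesis unfolding invertible_def using r U' V' by (auto intro!: exI[of _ "U' \<otimes> V'"])
qed

section \<open>Normalisation and existence of pure states\<close>

lemma nst_exists: obtains x where "nst x A"
proof -
  obtain a r where ar: "pure \<Theta> A I0 a" "r \<in> states \<Theta> A" "val \<Theta> (a \<cdot> r) = 1"
    using pure_sharpness by blast
  then have "a \<in> effects \<Theta> A" by (simp add: pure_def effects_def)
  then have "\<exists>a\<in>effects \<Theta> A. val \<Theta> (a \<cdot> r) \<noteq> 0" using ar by (intro bexI[of _ a]) auto
  then obtain s where "normalised \<Theta> A s" using state_normalisable[OF ar(2)] by blast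
  then show thesis using that normalised_iff by blast
qed

lemma normalise:
  assumes x: "hom x I0 A"
  obtains y where "nst y A" "x = (Dis A \<odot> x) \<otimes> y"
proof (cases "\<exists>a. hom a A I0 \<and> pr (a \<odot> x) \<noteq> 0")
  case True
  then obtain a where a: "hom a A I0" "pr (a \<odot> x) \<noteq> 0" by blast
  have "raw x \<in> states \<Theta> A" "raw a \<in> effects \<Theta> A" "val \<Theta> (raw a \<cdot> raw x) \<noteq> 0"
    using a x by (auto simp: states_def effects_def ok_def pr_def)
  then obtain s where s: "normalised \<Theta> A s" "is_multiple \<Theta> I0 A (raw x) s"
    using state_normalisable[of "raw x" A] by blast
  define y where "y = Arr I0 s A"
  have y: "nst y A" using s normalised_iff by (simp add: y_def)
  have oky: "ok y" using y chan_ok by blast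
  obtain c where c: "\<And>S r E. hom r I0 S \<Longrightarrow> hom E (A \<boxdot> S) I0 \<Longrightarrow> ap S E x r = c * ap S E y r"
    using is_multiple_lin[of y x] s(2) x y oky by (auto simp: y_def)
  have c': "pr (b \<odot> x) = c * pr (b \<odot> y)" if "hom b A I0" for b
    using c[of "idn I0" I0 b] that x y oky by (simp add: ap_def)
  have "Dis A \<odot> y = idn I0" using y by simp
  then have d: "pr (Dis A \<odot> x) = c" using c'[of "Dis A"] by simp
  have "x = (Dis A \<odot> x) \<otimes> y"
    by (rule state_ext[of _ A]) (use x y oky c' d in \<open>auto simp: pr_scal\<close>)
  then show thesis using that y by blast
next
  case False
  \<comment> \<open>The zero state is a multiple of any normalised state.\<close>
  obtain y where y: "nst y A" using nst_exists by blast
  have oky: "ok y" using y chan_ok by blast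
  have "pr (Dis A \<odot> x) = 0" using False by auto
  then have "x = (Dis A \<odot> x) \<otimes> y"
    by (intro state_ext[of _ A]) (use x y oky False in \<open>auto simp: pr_scal\<close>)
  then show thesis using that y by blast
qed

lemma pr_Dis_nst [simp]: "chan x \<Longrightarrow> src x = I0 \<Longrightarrow> tgt x = A \<Longrightarrow> pr (Dis A \<odot> x) = 1"
  by simp

text \<open>Among the maximisers of \<open>a\<close>, one that maximises the strictly convex sum of the squared coordinates is extreme.\<close>

lemma pure_attains:
  assumes a: "hom a A I0" and y: "nst y A"
  obtains x where "pst x A" "pr (a \<odot> y) \<le> pr (a \<odot> x)"
proof -
  obtain K b where K: "finite K" "K \<subseteq> Eff A"
    "\<forall>x a. hom x I0 A \<longrightarrow> hom a A I0 \<longrightarrow> pr (a \<odot> x) = (\<Sum>k\<in>K. pr (k \<odot> x) * b k a)"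
    by (rule finite_frame[of A]) (rule that)
  have kA: "hom k A I0" if "k \<in> K" for k using K(2) that by (auto simp: Eff_def)
  have nh: "hom x I0 A" if "nst x A" for x using that chan_ok by auto
  have b01: "0 \<le> pr (c \<odot> x) \<and> pr (c \<odot> x) \<le> 1" if "hom c A I0" "nst x A" for c x
  proof -
    have "hom (c \<odot> x) I0 I0" using that(1) nh[OF that(2)] by simp
    then show ?thesis using pr_bounds[of "c \<odot> x"] by blast
  qed
  define X where "X = {x. nst x A}"
  have "\<exists>x\<in>X. \<forall>z\<in>X. pr (a \<odot> z) \<le> pr (a \<odot> x)"
  proof (rule attains_max[where B = 1])
    show "X \<noteq> {}" using y by (auto simp: X_def)
    show "pr (a \<odot> x) \<le> 1" if "x \<in> X" for x using b01 a that by (auto simp: X_def)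
    fix s :: "nat \<Rightarrow> _" assume s: "\<And>n. s n \<in> X"
    obtain x r where x: "nst x A" "strict_mono (r :: nat \<Rightarrow> nat)"
      "\<forall>a. hom a A I0 \<longrightarrow> (\<lambda>n. pr (a \<odot> s (r n))) \<longlonglongrightarrow> pr (a \<odot> x)"
      using state_compact[of s A] s by (auto simp: X_def)
    have "\<forall>\<^sub>F n in sequentially. pr (a \<odot> s (r n)) \<le> pr (a \<odot> x) + e" if "e > 0" for e
      using order_tendstoD(2)[OF x(3)[rule_format, OF a], of "pr (a \<odot> x) + e"] that
      by (auto elim: eventually_mono)
    then show "\<exists>x\<in>X. \<exists>r. strict_mono r \<and> (\<forall>e>0. \<forall>\<^sub>F n in sequentially. pr (a \<odot> s (r n)) \<le> pr (a \<odot> x) + e)"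
      using x by (intro bexI[of _ x] exI[of _ r]) (auto simp: X_def)
  qed
  then obtain m where m: "m \<in> X" "\<And>z. z \<in> X \<Longrightarrow> pr (a \<odot> z) \<le> pr (a \<odot> m)" by blast
  define M where "M = pr (a \<odot> m)"
  define Y where "Y = {x. nst x A \<and> pr (a \<odot> x) = M}"
  define h where "h x = (\<Sum>k\<in>K. (pr (k \<odot> x))\<^sup>2)" for x
  have "\<exists>x\<in>Y. \<forall>z\<in>Y. h z \<le> h x"
  proof (rule attains_max[where B = "real (card K)"])
    show "Y \<noteq> {}" using m by (auto simp: X_def Y_def M_def)
    show "h x \<le> real (card K)" if "x \<in> Y" for x
    proof -
      have "h x \<le> (\<Sum>k\<in>K. 1)" unfolding h_def
        using b01 kA that by (intro sum_mono) (auto simp: Y_def power_le_one)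
      then show ?thesis by simp
    qed
    fix s :: "nat \<Rightarrow> _" assume s: "\<And>n. s n \<in> Y"
    obtain x r where x: "nst x A" "strict_mono (r :: nat \<Rightarrow> nat)"
      "\<forall>a. hom a A I0 \<longrightarrow> (\<lambda>n. pr (a \<odot> s (r n))) \<longlonglongrightarrow> pr (a \<odot> x)"
      using state_compact[of s A] s by (auto simp: Y_def)
    have "(\<lambda>n. pr (a \<odot> s (r n))) \<longlonglongrightarrow> pr (a \<odot> x)" using x(3) a by blast
    then have "pr (a \<odot> x) = M" using s by (simp add: Y_def LIMSEQ_const_iff)
    moreover have "(\<lambda>n. h (s (r n))) \<longlonglongrightarrow> h x"
      unfolding h_def using x(3) kA by (intro tendsto_intros) auto
    then have "\<forall>\<^sub>F n in sequentially. h (s (r n)) \<le> h x + e" if "e > 0" for e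
      using order_tendstoD(2)[of _ "h x" _ "h x + e"] that by (fastforce elim: eventually_mono)
    ultimately show "\<exists>x\<in>Y. \<exists>r. strict_mono r \<and> (\<forall>e>0. \<forall>\<^sub>F n in sequentially. h (s (r n)) \<le> h x + e)"
      using x by (intro bexI[of _ x] exI[of _ r]) (auto simp: Y_def)
  qed
  then obtain x where x: "x \<in> Y" "\<And>z. z \<in> Y \<Longrightarrow> h z \<le> h x" by blast
  have xn: "nst x A" "pr (a \<odot> x) = M" using x(1) by (simp_all add: Y_def)
  have xh: "hom x I0 A" by (rule nh[OF xn(1)])
  have "Pure x"
    unfolding Pure_def
  proof (intro conjI allI impI)
    show "ok x" using xh by simp
    fix g h' assume gh: "add x g h'"
    have ty: "hom g I0 A" "hom h' I0 A" using add_type[OF gh] xh by auto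
    obtain g1 where g1: "nst g1 A" "g = (Dis A \<odot> g) \<otimes> g1" using normalise[OF ty(1)] by blast
    obtain h1 where h1: "nst h1 A" "h' = (Dis A \<odot> h') \<otimes> h1" using normalise[OF ty(2)] by blast
    define s t where "s = Dis A \<odot> g" and "t = Dis A \<odot> h'"
    have st: "hom s I0 I0" "hom t I0 I0" using ty by (auto simp: s_def t_def)
    have g: "g = s \<otimes> g1" and h: "h' = t \<otimes> h1" using g1 h1 by (auto simp: s_def t_def)
    define p where "p = pr s"
    have "pr (Dis A \<odot> x) = p + pr t" using add_st[OF gh, of "Dis A"] xh by (simp add: s_def t_def p_def)
    then have q: "pr t = 1 - p" using xn by simp
    have p: "0 \<le> p" "p \<le> 1" using pr_bounds[OF st(1)] by (auto simp: p_def)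
    have ev: "pr (c \<odot> x) = p * pr (c \<odot> g1) + (1 - p) * pr (c \<odot> h1)" if "hom c A I0" for c
      using add_st[OF gh, of c] that xh g h nh[OF g1(1)] nh[OF h1(1)] st q by (simp add: pr_scal p_def)
    show "\<exists>s. hom s I0 I0 \<and> g = s \<otimes> x"
    proof (cases "p = 0 \<or> p = 1")
      case True
      then have "g = s \<otimes> x"
        using g ev nh[OF g1(1)] st xh by (intro state_ext[of _ A]) (auto simp: pr_scal p_def)
      then show ?thesis using st by blast
    next
      case False
      then have p': "0 < p" "p < 1" using p by auto
      have le: "pr (a \<odot> g1) \<le> M" "pr (a \<odot> h1) \<le> M" using m(2) g1 h1 by (auto simp: X_def M_def)
      have "p * (M - pr (a \<odot> g1)) + (1 - p) * (M - pr (a \<odot> h1)) = 0"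
        using ev[OF a] xn(2) by (simp add: algebra_simps)
      moreover have "0 \<le> p * (M - pr (a \<odot> g1))" "0 \<le> (1 - p) * (M - pr (a \<odot> h1))" using p le by auto
      ultimately have "p * (M - pr (a \<odot> g1)) = 0" "(1 - p) * (M - pr (a \<odot> h1)) = 0" by linarith+
      then have "g1 \<in> Y" "h1 \<in> Y" using p' g1 h1 by (auto simp: Y_def)
      then have hle: "h g1 \<le> h x" "h h1 \<le> h x" using x by auto
      \<comment> \<open>The defect in the convexity of the square. Maximality of \<open>h\<close> at
        \<open>x\<close> forces it to vanish, so \<open>g1\<close> and \<open>h1\<close> have the
        same coordinates and coincide.\<close>
      define D where "D = (\<Sum>k\<in>K. (pr (k \<odot> g1) - pr (k \<odot> h1))\<^sup>2)"
      have "h x = (\<Sum>k\<in>K. p * (pr (k \<odot> g1))\<^sup>2 + (1 - p) * (pr (k \<odot> h1))\<^sup>2 - p * (1 - p) * (pr (k \<odot> g1) - pr (k \<odot> h1))\<^sup>2)"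
        unfolding h_def
      proof (intro sum.cong refl)
        fix k assume "k \<in> K"
        then have e: "pr (k \<odot> x) = p * pr (k \<odot> g1) + (1 - p) * pr (k \<odot> h1)" using ev[of k] kA by blast
        show "(pr (k \<odot> x))\<^sup>2 = p * (pr (k \<odot> g1))\<^sup>2 + (1 - p) * (pr (k \<odot> h1))\<^sup>2
            - p * (1 - p) * (pr (k \<odot> g1) - pr (k \<odot> h1))\<^sup>2"
          unfolding e by (simp add: power2_eq_square algebra_simps)
      qed
      also have "\<dots> = p * h g1 + (1 - p) * h h1 - p * (1 - p) * D"
        by (simp add: h_def D_def sum.distrib sum_subtractf sum_distrib_left)
      finally have hx: "h x = p * h g1 + (1 - p) * h h1 - p * (1 - p) * D" .
      have "p * h g1 \<le> p * h x" "(1 - p) * h h1 \<le> (1 - p) * h x" using hle p by (auto intro!: mult_left_mono)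
      then have "p * (1 - p) * D \<le> 0" using hx by (simp add: algebra_simps)
      moreover have "0 \<le> D" by (auto simp: D_def intro!: sum_nonneg)
      ultimately have "D = 0" using p' by (simp add: mult_le_0_iff)
      then have k: "pr (k \<odot> g1) = pr (k \<odot> h1)" if "k \<in> K" for k
        using that K(1) by (simp add: D_def sum_nonneg_eq_0_iff)
      have gx: "pr (c \<odot> g1) = pr (c \<odot> h1)" if "hom c A I0" for c
        using K(3) that nh[OF g1(1)] nh[OF h1(1)] k by simp
      have "pr (c \<odot> x) = pr (c \<odot> g1)" if "hom c A I0" for c
        using ev[OF that] gx[OF that] by (simp add: algebra_simps)
      then have "x = g1" using xh nh[OF g1(1)] by (intro state_ext[of _ A]) auto
      then show ?thesis using g st by blast
    qed
  qed
  then show thesis using that[of x] xn m(2)[of y] y by (auto simp: X_def M_def)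
qed

lemma pst_exists: obtains x where "pst x A"
  using nst_exists pure_attains[of "Dis A" A] by (metis ok_Dis st_Dis(1,2))

section \<open>States that contain every state with a uniform weight\<close>

definition weight :: "real \<Rightarrow> ('a, 'b) arrow \<Rightarrow> ('a, 'b) arrow \<Rightarrow> 'a \<Rightarrow> bool"
  where "weight p r x A \<longleftrightarrow> (\<exists>t. nst t A \<and> (\<forall>a. hom a A I0 \<longrightarrow> pr (a \<odot> x) = p * pr (a \<odot> r) + (1 - p) * pr (a \<odot> t)))"

text \<open>The lower bound \<open>p\<close> on the weights is uniform in the state, so that it survives limits and the action of the group.\<close>

definition internal :: "real \<Rightarrow> ('a, 'b) arrow \<Rightarrow> 'a \<Rightarrow> bool"
  where "internal p x A \<longleftrightarrow> nst x A \<and> 0 < p \<and> p < 1 \<and> (\<forall>r. nst r A \<longrightarrow> weight p r x A)"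

lemma nst_hom: "nst x A \<Longrightarrow> hom x I0 A" using chan_ok by simp

lemma weightI: "nst t A \<Longrightarrow> (\<And>a. hom a A I0 \<Longrightarrow> pr (a \<odot> x) = p * pr (a \<odot> r) + (1 - p) * pr (a \<odot> t)) \<Longrightarrow> weight p r x A"
  unfolding weight_def by blast

lemma weightE:
  assumes "weight p r x A"
  obtains t where "nst t A" "\<forall>a. hom a A I0 \<longrightarrow> pr (a \<odot> x) = p * pr (a \<odot> r) + (1 - p) * pr (a \<odot> t)"
proof -
  obtain t where t: "nst t A \<and> (\<forall>a. hom a A I0 \<longrightarrow> pr (a \<odot> x) = p * pr (a \<odot> r) + (1 - p) * pr (a \<odot> t))"
    using assms unfolding weight_def by (rule exE)
  show thesis by (rule that[of t]) (use t in simp_all)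
qed

lemma prob_bounds:
  assumes "hom a A I0" "nst x A" shows "0 \<le> pr (a \<odot> x)" "pr (a \<odot> x) \<le> 1"
proof -
  have "hom (a \<odot> x) I0 I0" using assms(1) nst_hom[OF assms(2)] by simp
  then show "0 \<le> pr (a \<odot> x)" "pr (a \<odot> x) \<le> 1" using pr_bounds[of "a \<odot> x"] by blast+
qed

text \<open>Take the mixture \<open>z\<close> of normalised spanning states in which each one
  appears. Every state expands in them with coefficients bounded by \<open>C\<close>, so a
  sufficiently small multiple of it can be subtracted from \<open>z\<close> while all coefficients
  stay nonnegative.\<close>

lemma internal_exists: obtains x p where "internal p x A"
proof -
  obtain K b F m C where fr: "finite K" "K \<subseteq> Eff A" "finite F" "\<forall>f\<in>F. hom f I0 A" "0 \<le> C"
    "\<forall>x a. hom x I0 A \<longrightarrow> hom a A I0 \<longrightarrow> pr (a \<odot> x) = (\<Sum>k\<in>K. pr (k \<odot> x) * b k a)"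
    "\<forall>k\<in>K. \<forall>a\<in>Eff A. b k a = (\<Sum>f\<in>F. m k f * pr (a \<odot> f))"
    "\<forall>k\<in>K. \<forall>a\<in>Eff A. \<bar>b k a\<bar> \<le> C" "(\<Sum>k\<in>K. \<Sum>f\<in>F. \<bar>m k f\<bar>) \<le> C"
    by (rule finite_frame[of A]) (rule that)
  have "\<exists>y. nst y A \<and> f = (Dis A \<odot> f) \<otimes> y" if "f \<in> F" for f
    using normalise[of f A] fr(4) that by metis
  then obtain y where y: "\<And>f. f \<in> F \<Longrightarrow> nst (y f) A" "\<And>f. f \<in> F \<Longrightarrow> f = (Dis A \<odot> f) \<otimes> y f" by metis
  define u where "u f = pr (Dis A \<odot> f)" for f
  have u0: "0 \<le> u f" if "f \<in> F" for f
  proof -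
    have "hom (Dis A \<odot> f) I0 I0" using fr(4) that by simp
    then show ?thesis unfolding u_def using pr_bounds(1)[of "Dis A \<odot> f"] by blast
  qed
  have evf: "pr (a \<odot> f) = u f * pr (a \<odot> y f)" if f: "f \<in> F" and a: "hom a A I0" for f a
  proof -
    have "hom (Dis A \<odot> f) I0 I0" using fr(4) f by simp
    then have "pr (a \<odot> ((Dis A \<odot> f) \<otimes> y f)) = u f * pr (a \<odot> y f)"
      unfolding u_def using nst_hom[OF y(1)[OF f]] a by (rule pr_scal)
    then show ?thesis using y(2)[OF f] by simp
  qed
  define c where "c x f = (\<Sum>k\<in>K. m k f * pr (k \<odot> x))" for x f
  have evx: "pr (a \<odot> x) = (\<Sum>f\<in>F. c x f * u f * pr (a \<odot> y f))" if x: "nst x A" and a: "hom a A I0" for x a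
  proof -
    have "pr (a \<odot> x) = (\<Sum>k\<in>K. pr (k \<odot> x) * b k a)" using fr(6) nst_hom[OF x] a by blast
    also have "\<dots> = (\<Sum>k\<in>K. \<Sum>f\<in>F. m k f * pr (k \<odot> x) * pr (a \<odot> f))"
      by (intro sum.cong refl) (use fr(7) a in \<open>simp add: Eff_def sum_distrib_left mult_ac\<close>)
    also have "\<dots> = (\<Sum>f\<in>F. c x f * pr (a \<odot> f))"
      by (subst sum.swap) (simp add: c_def sum_distrib_right)
    also have "\<dots> = (\<Sum>f\<in>F. c x f * u f * pr (a \<odot> y f))"
      by (intro sum.cong refl) (use evf a in \<open>simp add: mult.assoc\<close>)
    finally show ?thesis .
  qed
  have cC: "c x f \<le> C" if x: "nst x A" and f: "f \<in> F" for x f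
  proof -
    have "c x f \<le> (\<Sum>k\<in>K. \<bar>m k f\<bar>)" unfolding c_def
    proof (rule sum_mono)
      fix k assume "k \<in> K"
      then have "hom k A I0" using fr(2) by (auto simp: Eff_def)
      then have "0 \<le> pr (k \<odot> x)" "pr (k \<odot> x) \<le> 1" using prob_bounds[OF _ x, of k] by blast+
      then have "\<bar>m k f * pr (k \<odot> x)\<bar> \<le> \<bar>m k f\<bar>" by (simp add: abs_mult mult_left_le)
      then show "m k f * pr (k \<odot> x) \<le> \<bar>m k f\<bar>" by linarith
    qed
    also have "\<dots> \<le> (\<Sum>k\<in>K. \<Sum>f\<in>F. \<bar>m k f\<bar>)"
      by (intro sum_mono member_le_sum[OF f]) (use fr(3) in auto)
    finally show ?thesis using fr(9) by linarith
  qed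
  define W where "W = sum u F"
  have W0: "0 \<le> W" using u0 by (auto simp: W_def intro!: sum_nonneg)
  have sum1: "(\<Sum>f\<in>F. c x f * u f) = 1" if x: "nst x A" for x
  proof -
    have "pr (Dis A \<odot> x) = (\<Sum>f\<in>F. c x f * u f * pr (Dis A \<odot> y f))" using evx[OF x, of "Dis A"] by simp
    also have "\<dots> = (\<Sum>f\<in>F. c x f * u f)" by (intro sum.cong refl) (use y(1) in simp)
    finally show ?thesis using x by simp
  qed
  obtain x0 where x0: "nst x0 A" using nst_exists by blast
  have "1 \<le> (\<Sum>f\<in>F. C * u f)" unfolding sum1[OF x0, symmetric]
    by (intro sum_mono mult_right_mono cC x0 u0)
  then have CW: "1 \<le> C * W" by (simp add: W_def sum_distrib_left)
  then have Wpos: "0 < W" using W0 by (cases "W = 0") auto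
  \<comment> \<open>This makes \<open>p * C\<close> at most \<open>1 / W\<close>, as needed for
    nonnegative remainders; the summand 1 keeps \<open>p\<close> strictly below 1.\<close>
  define p where "p = 1 / (C * W + 1)"
  have p: "0 < p" "p < 1" using CW by (auto simp: p_def)
  have pc: "p * c x f \<le> 1 / W" if "nst x A" "f \<in> F" for x f
  proof -
    have "p * c x f \<le> p * C" using cC[OF that] p by (intro mult_left_mono) auto
    also have "\<dots> \<le> 1 / W" using Wpos CW by (simp add: p_def field_simps)
    finally show ?thesis .
  qed
  have "\<exists>z. nst z A \<and> (\<forall>a. hom a A I0 \<longrightarrow> pr (a \<odot> z) = (\<Sum>f\<in>F. u f / W * pr (a \<odot> y f)))"
    using y(1) u0 Wpos by (intro mix_finite fr(3)) (simp_all add: sum_divide_distrib[symmetric] W_def)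
  then obtain z where z: "nst z A" "\<And>a. hom a A I0 \<Longrightarrow> pr (a \<odot> z) = (\<Sum>f\<in>F. u f / W * pr (a \<odot> y f))" by blast
  have "weight p r z A" if r: "nst r A" for r
  proof -
    \<comment> \<open>The coefficients of \<open>z\<close> minus \<open>p\<close> times
      \<open>r\<close>, renormalised by \<open>1 - p\<close>.\<close>
    define q where "q f = (1 / W - p * c r f) * u f / (1 - p)" for f
    have "sum q F = (\<Sum>f\<in>F. u f / W - p * (c r f * u f)) / (1 - p)"
      by (simp add: q_def sum_divide_distrib[symmetric] algebra_simps)
    also have "\<dots> = (W / W - p * 1) / (1 - p)"
      by (simp add: sum_subtractf sum_distrib_left[symmetric] sum1[OF r] W_def sum_divide_distrib[symmetric])
    finally have "sum q F = 1" using Wpos p by simp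
    moreover have "0 \<le> q f" if "f \<in> F" for f using pc[OF r that] u0[OF that] p by (simp add: q_def)
    ultimately have "\<exists>t. nst t A \<and> (\<forall>a. hom a A I0 \<longrightarrow> pr (a \<odot> t) = (\<Sum>f\<in>F. q f * pr (a \<odot> y f)))"
      using y(1) by (intro mix_finite fr(3)) simp_all
    then obtain t where t: "nst t A" "\<And>a. hom a A I0 \<Longrightarrow> pr (a \<odot> t) = (\<Sum>f\<in>F. q f * pr (a \<odot> y f))" by blast
    show ?thesis
    proof (rule weightI[OF t(1)])
      fix a assume a: "hom a A I0"
      have "p * pr (a \<odot> r) + (1 - p) * pr (a \<odot> t)
          = (\<Sum>f\<in>F. p * (c r f * u f * pr (a \<odot> y f)) + (1 - p) * (q f * pr (a \<odot> y f)))"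
        unfolding evx[OF r a] t(2)[OF a] by (simp add: sum_distrib_left sum.distrib)
      also have "\<dots> = (\<Sum>f\<in>F. u f / W * pr (a \<odot> y f))"
      proof (intro sum.cong refl)
        fix f
        have "(1 - p) * q f = (1 / W - p * c r f) * u f" using p by (simp add: q_def)
        then have "(1 - p) * (q f * pr (a \<odot> y f)) = (1 / W - p * c r f) * u f * pr (a \<odot> y f)"
          by (metis mult.assoc)
        then show "p * (c r f * u f * pr (a \<odot> y f)) + (1 - p) * (q f * pr (a \<odot> y f)) = u f / W * pr (a \<odot> y f)"
          by (simp add: algebra_simps)
      qed
      finally show "pr (a \<odot> z) = p * pr (a \<odot> r) + (1 - p) * pr (a \<odot> t)" using z(2)[OF a] by simp
    qed
  qed
  then have "internal p z A" using z(1) p by (simp add: internal_def)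
  then show thesis by (rule that)
qed

text \<open>Internality is carried along with invariance because faithfulness of the purification
  depends on it. That invariance alone already singles out this state is shown in
  \<open>uniform_unique\<close>.\<close>

definition uniform :: "('a, 'b) arrow \<Rightarrow> 'a \<Rightarrow> bool"
  where "uniform x A \<longleftrightarrow> (\<exists>p. internal p x A) \<and> (\<forall>U. invertible U A A \<longrightarrow> U \<odot> x = x)"

lemma internal_limit:
  assumes s: "\<And>n. internal p (s n) A"
  obtains x r where "internal p x A" "strict_mono (r :: nat \<Rightarrow> nat)"
    "\<forall>a. hom a A I0 \<longrightarrow> (\<lambda>n. pr (a \<odot> s (r n))) \<longlonglongrightarrow> pr (a \<odot> x)"
proof -
  have sn: "nst (s n) A" for n using s[of n] by (simp add: internal_def)
  obtain x r where x: "nst x A" "strict_mono (r :: nat \<Rightarrow> nat)"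
    "\<forall>a. hom a A I0 \<longrightarrow> (\<lambda>n. pr (a \<odot> s (r n))) \<longlonglongrightarrow> pr (a \<odot> x)"
    by (rule state_compact[of s A]) (rule sn, rule that)
  have "weight p w x A" if w: "nst w A" for w
  proof -
    have "\<forall>n. \<exists>t. nst t A \<and> (\<forall>a. hom a A I0 \<longrightarrow> pr (a \<odot> s (r n)) = p * pr (a \<odot> w) + (1 - p) * pr (a \<odot> t))"
      using s w by (simp add: internal_def weight_def)
    then obtain t where t: "\<And>n. nst (t n) A"
      "\<And>n a. hom a A I0 \<Longrightarrow> pr (a \<odot> s (r n)) = p * pr (a \<odot> w) + (1 - p) * pr (a \<odot> t n)" by metis
    obtain t0 q where t0: "nst t0 A" "strict_mono (q :: nat \<Rightarrow> nat)"
      "\<forall>a. hom a A I0 \<longrightarrow> (\<lambda>n. pr (a \<odot> t (q n))) \<longlonglongrightarrow> pr (a \<odot> t0)"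
      by (rule state_compact[of t A]) (rule t(1), rule that)
    show ?thesis
    proof (rule weightI[OF t0(1)])
      fix a assume a: "hom a A I0"
      have "(\<lambda>n. pr (a \<odot> s (r (q n)))) \<longlonglongrightarrow> pr (a \<odot> x)"
        using LIMSEQ_subseq_LIMSEQ[OF x(3)[rule_format, OF a] t0(2)] by (simp add: o_def)
      moreover have "(\<lambda>n. p * pr (a \<odot> w) + (1 - p) * pr (a \<odot> t (q n))) \<longlonglongrightarrow> p * pr (a \<odot> w) + (1 - p) * pr (a \<odot> t0)"
        using t0(3)[rule_format, OF a] by (intro tendsto_intros)
      ultimately show "pr (a \<odot> x) = p * pr (a \<odot> w) + (1 - p) * pr (a \<odot> t0)"
        unfolding t(2)[OF a] by (rule LIMSEQ_unique)
    qed
  qed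
  then have "internal p x A" using x(1) s[of 0] by (simp add: internal_def)
  then show thesis using x(2,3) by (rule that)
qed

lemma internal_mix:
  assumes "internal p x A" "internal p y A" "nst z A"
    "\<And>a. hom a A I0 \<Longrightarrow> pr (a \<odot> z) = 1/2 * pr (a \<odot> x) + (1 - 1/2) * pr (a \<odot> y)"
  shows "internal p z A"
proof -
  have "weight p w z A" if w: "nst w A" for w
  proof -
    have wx: "weight p w x A" "weight p w y A" using assms(1,2) w by (simp_all add: internal_def)
    obtain t where t: "nst t A" "\<forall>a. hom a A I0 \<longrightarrow> pr (a \<odot> x) = p * pr (a \<odot> w) + (1 - p) * pr (a \<odot> t)"
      using wx(1) by (rule weightE)
    obtain t' where t': "nst t' A" "\<forall>a. hom a A I0 \<longrightarrow> pr (a \<odot> y) = p * pr (a \<odot> w) + (1 - p) * pr (a \<odot> t')"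
      using wx(2) by (rule weightE)
    obtain v where v: "nst v A" "\<forall>a. hom a A I0 \<longrightarrow> pr (a \<odot> v) = 1/2 * pr (a \<odot> t) + (1 - 1/2) * pr (a \<odot> t')"
      using binary_mixture_exists[OF t(1) t'(1), of "1/2"] by auto
    show ?thesis
    proof (rule weightI[OF v(1)])
      fix a assume a: "hom a A I0"
      show "pr (a \<odot> z) = p * pr (a \<odot> w) + (1 - p) * pr (a \<odot> v)"
        unfolding assms(4)[OF a] t(2)[rule_format, OF a] t'(2)[rule_format, OF a] v(2)[rule_format, OF a]
        by (simp add: field_simps)
    qed
  qed
  then show ?thesis using assms(1,3) by (simp add: internal_def)
qed

lemma internal_invertible:
  assumes x: "internal p x A" and U: "invertible U A A" shows "internal p (U \<odot> x) A"
proof -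
  obtain V where V: "chan V" "ok V" "src V = A" "tgt V = A" "V \<odot> U = idn A" "U \<odot> V = idn A" using invertibleE[OF U] by blast
  note u = invertible_chan[OF U]
  have xn: "nst x A" using x by (simp add: internal_def)
  have "weight p w (U \<odot> x) A" if w: "nst w A" for w
  proof -
    have "nst (V \<odot> w) A" using w V by simp
    then have "weight p (V \<odot> w) x A" using x by (simp add: internal_def)
    then obtain t where t: "nst t A" "\<forall>a. hom a A I0 \<longrightarrow> pr (a \<odot> x) = p * pr (a \<odot> (V \<odot> w)) + (1 - p) * pr (a \<odot> t)"
      by (rule weightE)
    show ?thesis
    proof (rule weightI)
      show "nst (U \<odot> t) A" using t(1) u by simp
      fix a assume a: "hom a A I0"
      have "pr ((a \<odot> U) \<odot> x) = p * pr ((a \<odot> U) \<odot> (V \<odot> w)) + (1 - p) * pr ((a \<odot> U) \<odot> t)"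
        by (rule t(2)[rule_format]) (use a u in simp)
      moreover have "U \<odot> (V \<odot> w) = w" using cmp_reassoc[OF V(6), of w] nst_hom[OF w] u V by simp
      ultimately show "pr (a \<odot> (U \<odot> x)) = p * pr (a \<odot> w) + (1 - p) * pr (a \<odot> (U \<odot> t))"
        using a u V nst_hom[OF w] nst_hom[OF t(1)] nst_hom[OF xn] by simp
    qed
  qed
  then show ?thesis using x u xn by (simp add: internal_def)
qed

text \<open>Fixed point argument without Haar measure: the supremum over the group of a strictly convex
  function is invariant and has a unique minimiser among the internal states.\<close>

lemma uniform_exists: obtains x where "uniform x A"
proof -
  obtain K b F m C where fr: "finite K" "K \<subseteq> Eff A" "finite F" "\<forall>f\<in>F. hom f I0 A" "0 \<le> C"
    "\<forall>x a. hom x I0 A \<longrightarrow> hom a A I0 \<longrightarrow> pr (a \<odot> x) = (\<Sum>k\<in>K. pr (k \<odot> x) * b k a)"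
    "\<forall>k\<in>K. \<forall>a\<in>Eff A. b k a = (\<Sum>f\<in>F. m k f * pr (a \<odot> f))"
    "\<forall>k\<in>K. \<forall>a\<in>Eff A. \<bar>b k a\<bar> \<le> C" "(\<Sum>k\<in>K. \<Sum>f\<in>F. \<bar>m k f\<bar>) \<le> C"
    by (rule finite_frame[of A]) (rule that)
  have kA: "hom k A I0" if "k \<in> K" for k using fr(2) that by (auto simp: Eff_def)
  obtain x0 p where x0: "internal p x0 A" using internal_exists by blast
  define X where "X = {x. internal p x A}"
  define G where "G = {U. invertible U A A}"
  have idG: "idn A \<in> G" using invertible_idn by (simp add: G_def)
  define h where "h U x = (\<Sum>k\<in>K. (pr (k \<odot> (U \<odot> x)))\<^sup>2)" for U x
  have Ux: "nst (U \<odot> x) A" if "U \<in> G" "x \<in> X" for U x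
    using that invertible_chan[of U A A] by (simp add: G_def X_def internal_def)
  have hb: "0 \<le> h U x" "h U x \<le> real (card K)" if "U \<in> G" "x \<in> X" for U x
  proof -
    show "0 \<le> h U x" by (auto simp: h_def intro!: sum_nonneg)
    have "h U x \<le> (\<Sum>k\<in>K. 1)" unfolding h_def
    proof (rule sum_mono)
      fix k assume "k \<in> K"
      then show "(pr (k \<odot> (U \<odot> x)))\<^sup>2 \<le> 1"
        using prob_bounds[OF kA Ux[OF that], of k] by (simp add: power_le_one)
    qed
    then show "h U x \<le> real (card K)" by simp
  qed
  define H where "H x = (SUP U\<in>G. h U x)" for x
  have bdd: "bdd_above ((\<lambda>U. h U x) ` G)" if "x \<in> X" for x
    using hb(2) that by (intro bdd_aboveI2) auto
  have hH: "h U x \<le> H x" if "U \<in> G" "x \<in> X" for U x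
    unfolding H_def by (rule cSUP_upper[OF that(1) bdd[OF that(2)]])
  have "\<exists>x\<in>X. \<forall>z\<in>X. - H z \<le> - H x"
  proof (rule attains_max[where B = 0])
    show "X \<noteq> {}" using x0 by (auto simp: X_def)
    show "- H x \<le> 0" if "x \<in> X" for x using hb(1)[OF idG that] hH[OF idG that] by linarith
    fix s :: "nat \<Rightarrow> _" assume s: "\<And>n. s n \<in> X"
    have s': "internal p (s n) A" for n using s[of n] by (simp add: X_def)
    obtain x r where x: "internal p x A" "strict_mono (r :: nat \<Rightarrow> nat)"
      "\<forall>a. hom a A I0 \<longrightarrow> (\<lambda>n. pr (a \<odot> s (r n))) \<longlonglongrightarrow> pr (a \<odot> x)"
      by (rule internal_limit[of p s A]) (rule s', rule that)
    have xX: "x \<in> X" using x by (simp add: X_def)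
    have "\<forall>\<^sub>F n in sequentially. - H (s (r n)) \<le> - H x + e" if e: "e > 0" for e
    proof -
      \<comment> \<open>Upper semicontinuity of \<open>- H\<close>: one \<open>U\<close> that almost
        attains the supremum at the limit bounds \<open>H\<close> from below along the
        sequence.\<close>
      have "H x - e / 2 < (SUP U\<in>G. h U x)" using e by (simp add: H_def)
      then obtain U where U: "U \<in> G" "H x - e / 2 < h U x"
        using less_cSUP_iff[of G "\<lambda>U. h U x" "H x - e / 2"] bdd[OF xX] idG by blast
      have rU: "invertible U A A" using U by (simp add: G_def)
      note u = invertible_chan[OF rU]
      have "(\<lambda>n. h U (s (r n))) \<longlonglongrightarrow> h U x"
        unfolding h_def
      proof (intro tendsto_sum tendsto_power)
        fix k assume k: "k \<in> K"
        have "hom (k \<odot> U) A I0" using kA[OF k] u by simp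
        then have "(\<lambda>n. pr ((k \<odot> U) \<odot> s (r n))) \<longlonglongrightarrow> pr ((k \<odot> U) \<odot> x)" using x(3) by blast
        moreover have "(k \<odot> U) \<odot> z = k \<odot> (U \<odot> z)" if "internal p z A" for z
          using kA[OF k] u nst_hom[of z A] that by (simp add: internal_def)
        ultimately show "(\<lambda>n. pr (k \<odot> (U \<odot> s (r n)))) \<longlonglongrightarrow> pr (k \<odot> (U \<odot> x))" using s' x(1) by simp
      qed
      then have "\<forall>\<^sub>F n in sequentially. h U x - e / 2 < h U (s (r n))"
        using e by (intro order_tendstoD(1)[of _ "h U x"]) auto
      then show ?thesis
      proof eventually_elim
        case (elim n)
        then show ?case using U hH[OF U(1) s[of "r n"]] by linarith
      qed
    qed
    then show "\<exists>x\<in>X. \<exists>r. strict_mono r \<and> (\<forall>e>0. \<forall>\<^sub>F n in sequentially. - H (s (r n)) \<le> - H x + e)"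
      using xX x(2) by blast
  qed
  then obtain x where x: "x \<in> X" "\<And>z. z \<in> X \<Longrightarrow> H x \<le> H z" by auto
  have xi: "internal p x A" and xn: "nst x A" using x(1) by (simp_all add: X_def internal_def)
  have "U \<odot> x = x" if U: "invertible U A A" for U
  proof (rule ccontr)
    assume ne: "U \<odot> x \<noteq> x"
    define y where "y = U \<odot> x"
    have yi: "internal p y A" unfolding y_def by (rule internal_invertible[OF xi U])
    then have yn: "nst y A" by (simp add: internal_def)
    have "\<exists>a. hom a A I0 \<and> pr (a \<odot> x) \<noteq> pr (a \<odot> y)"
      using state_ext[OF nst_hom[OF xn] nst_hom[OF yn]] ne by (auto simp: y_def)
    then obtain a where a: "hom a A I0" "pr (a \<odot> x) \<noteq> pr (a \<odot> y)" by blast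
    define e where "e = \<bar>pr (a \<odot> x) - pr (a \<odot> y)\<bar>"
    have e: "e > 0" using a by (simp add: e_def)
    obtain z where z: "nst z A" "\<And>a. hom a A I0 \<Longrightarrow> pr (a \<odot> z) = 1/2 * pr (a \<odot> x) + (1 - 1/2) * pr (a \<odot> y)"
      using binary_mixture_exists[OF xn yn, of "1/2"] by auto
    have zX: "z \<in> X" using internal_mix[OF xi yi z] by (simp add: X_def)
    \<comment> \<open>A bound that does not depend on the group element, so that strict convexity
      survives the supremum. The difference \<open>e\<close> on \<open>a\<close> is a combination,
      with coefficients of size at most \<open>C\<close>, of the coordinate differences after any
      \<open>U'\<close>; hence one of them is at least the square root of \<open>d\<close>. The
      added ones avoid vanishing denominators.\<close>
    define d where "d = (e / ((C + 1) * (real (card K) + 1)))\<^sup>2"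
    have d: "d > 0" using e fr(5) by (simp add: d_def)
    have "h U' z \<le> H x - d / 4" if U': "U' \<in> G" for U'
    proof -
      have rU': "invertible U' A A" using U' by (simp add: G_def)
      note u' = invertible_chan[OF rU']
      obtain V where V: "chan V" "ok V" "src V = A" "tgt V = A" "V \<odot> U' = idn A" "U' \<odot> V = idn A" using invertibleE[OF rU'] by blast
      define D where "D k = pr (k \<odot> (U' \<odot> x)) - pr (k \<odot> (U' \<odot> y))" for k
      have exp: "pr (a \<odot> w) = (\<Sum>k\<in>K. pr (k \<odot> (U' \<odot> w)) * b k (a \<odot> V))" if w: "nst w A" for w
      proof -
        have "V \<odot> (U' \<odot> w) = w" using cmp_reassoc[OF V(5), of w] nst_hom[OF w] u' V by simp
        then have "pr (a \<odot> w) = pr ((a \<odot> V) \<odot> (U' \<odot> w))" using a V u' nst_hom[OF w] by simp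
        also have "\<dots> = (\<Sum>k\<in>K. pr (k \<odot> (U' \<odot> w)) * b k (a \<odot> V))"
          using fr(6)[rule_format, of "U' \<odot> w" "a \<odot> V"] a V u' nst_hom[OF w] by simp
        finally show ?thesis .
      qed
      have aV: "a \<odot> V \<in> Eff A" using a V by (simp add: Eff_def)
      have "\<exists>k\<in>K. e / ((C + 1) * (real (card K) + 1)) \<le> \<bar>D k\<bar>"
      proof (rule ccontr)
        let ?t = "e / ((C + 1) * (real (card K) + 1))"
        assume "\<not> ?thesis"
        then have lt: "\<bar>D k\<bar> \<le> ?t" if "k \<in> K" for k using that by force
        have "e = \<bar>\<Sum>k\<in>K. D k * b k (a \<odot> V)\<bar>"
          unfolding e_def exp[OF xn] exp[OF yn] by (simp add: D_def sum_subtractf[symmetric] left_diff_distrib)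
        also have "\<dots> \<le> (\<Sum>k\<in>K. \<bar>D k * b k (a \<odot> V)\<bar>)" by (rule sum_abs)
        also have "\<dots> \<le> (\<Sum>k\<in>K. ?t * C)"
          unfolding abs_mult using lt fr(8) aV e fr(5) by (intro sum_mono mult_mono) auto
        also have "\<dots> = real (card K) * C * ?t" by simp
        also have "\<dots> < (real (card K) + 1) * (C + 1) * ?t"
        proof (rule mult_strict_right_mono)
          show "real (card K) * C < (real (card K) + 1) * (C + 1)" using fr(5) by (simp add: algebra_simps)
          show "0 < ?t" using e fr(5) by (intro divide_pos_pos mult_pos_pos) auto
        qed
        also have "\<dots> = e" using fr(5) by (simp add: field_simps add_nonneg_eq_0_iff)
        finally show False by simp
      qed
      then obtain k where k: "k \<in> K" "e / ((C + 1) * (real (card K) + 1)) \<le> \<bar>D k\<bar>" by blast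
      have "d \<le> (D k)\<^sup>2" unfolding d_def using k(2) e fr(5) by (subst power2_abs[of "D k", symmetric], intro power_mono) auto
      also have "\<dots> \<le> (\<Sum>k\<in>K. (D k)\<^sup>2)" by (rule member_le_sum[OF k(1)]) (use fr(1) in auto)
      finally have dD: "d \<le> (\<Sum>k\<in>K. (D k)\<^sup>2)" .
      have "h U' z = (\<Sum>k\<in>K. 1/2 * (pr (k \<odot> (U' \<odot> x)))\<^sup>2 + 1/2 * (pr (k \<odot> (U' \<odot> y)))\<^sup>2 - 1/4 * (D k)\<^sup>2)"
        unfolding h_def
      proof (intro sum.cong refl)
        fix k assume "k \<in> K"
        then have kh: "hom k A I0" by (rule kA)
        have "pr ((k \<odot> U') \<odot> z) = 1/2 * pr ((k \<odot> U') \<odot> x) + (1 - 1/2) * pr ((k \<odot> U') \<odot> y)"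
          using kh u' by (intro z(2)) simp
        then have q: "pr (k \<odot> (U' \<odot> z)) = 1/2 * pr (k \<odot> (U' \<odot> x)) + 1/2 * pr (k \<odot> (U' \<odot> y))"
          using kh u' nst_hom[OF xn] nst_hom[OF yn] nst_hom[OF z(1)] by simp
        show "(pr (k \<odot> (U' \<odot> z)))\<^sup>2 = 1/2 * (pr (k \<odot> (U' \<odot> x)))\<^sup>2 + 1/2 * (pr (k \<odot> (U' \<odot> y)))\<^sup>2 - 1/4 * (D k)\<^sup>2"
          unfolding q D_def by (simp add: power2_eq_square algebra_simps)
      qed
      also have "\<dots> = 1/2 * h U' x + 1/2 * h U' y - 1/4 * (\<Sum>k\<in>K. (D k)\<^sup>2)"
        by (simp add: h_def sum.distrib sum_subtractf sum_distrib_left)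
      also have "\<dots> \<le> 1/2 * H x + 1/2 * H x - 1/4 * d"
      proof -
        \<comment> \<open>Translation by \<open>U\<close> maps the group to itself, so the supremum
          \<open>H x\<close> also bounds the values at \<open>y\<close>.\<close>
        have "h U' y = h (U' \<odot> U) x" unfolding h_def y_def
          by (intro sum.cong refl) (use u' invertible_chan[OF U] nst_hom[OF xn] in simp)
        moreover have "U' \<odot> U \<in> G" using invertible_cmp[OF U rU'] by (simp add: G_def)
        ultimately have "h U' y \<le> H x" using hH[OF _ x(1), of "U' \<odot> U"] by simp
        then show ?thesis using dD hH[OF U' x(1)] by linarith
      qed
      finally show ?thesis by simp
    qed
    then have "H z \<le> H x - d / 4" unfolding H_def[of z] using idG by (intro cSUP_least) auto
    then show False using x(2)[OF zX] d by linarith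
  qed
  then have "uniform x A" using xi unfolding uniform_def by blast
  then show thesis by (rule that)
qed

section \<open>Steering and faithful states\<close>

lemma Pure_cmp: "Pure f \<Longrightarrow> Pure g \<Longrightarrow> tgt f = src g \<Longrightarrow> Pure (g \<odot> f)"
  unfolding Pure_pure using purity_preservation_seq[of "src f" "src g" "raw f" "tgt g" "raw g"] by simp

lemma Pure_tens: "Pure f \<Longrightarrow> Pure g \<Longrightarrow> Pure (f \<otimes> g)"
  unfolding Pure_pure using purity_preservation_par[of "src f" "tgt f" "raw f" "src g" "tgt g" "raw g"] by simp

lemma nst_raw: "src x = I0 \<Longrightarrow> tgt x = A \<Longrightarrow> nst x A \<longleftrightarrow> normalised \<Theta> A (raw x)"
proof -
  assume "src x = I0" "tgt x = A"
  then have "Arr I0 (raw x) A = x" by (intro arrow_eqI) simp_all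
  then show "nst x A \<longleftrightarrow> normalised \<Theta> A (raw x)" using normalised_iff[of A "raw x"] by simp
qed

lemma pst_raw: "src x = I0 \<Longrightarrow> tgt x = A \<Longrightarrow> pst x A \<longleftrightarrow> pure_state \<Theta> A (raw x)"
  using nst_raw[of x A] by (simp add: pure_state_def Pure_pure)

lemma purify:
  assumes "nst x A"
  obtains B P where "pst P (A \<boxdot> B)" "(idn A \<otimes> Dis B) \<odot> P = x"
proof -
  have "normalised \<Theta> A (raw x)" using assms nst_raw[of x A] by blast
  from purification_exists[OF this] obtain B F where
    F: "pure_state \<Theta> (A \<boxdot> B) F \<and> marginal \<Theta> A B F = raw x" by (elim exE) (rule that)
  let ?P = "Arr I0 F (A \<boxdot> B)"
  have "pst ?P (A \<boxdot> B)" using pst_raw[of ?P "A \<boxdot> B"] F by simp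
  moreover have "(idn A \<otimes> Dis B) \<odot> ?P = x"
    by (rule arrow_eqI) (use F assms in \<open>simp_all add: marginal_def\<close>)
  ultimately show thesis by (rule that)
qed

lemma purify_unique:
  assumes "pst P (A \<boxdot> B)" "pst P' (A \<boxdot> B)" "(idn A \<otimes> Dis B) \<odot> P = (idn A \<otimes> Dis B) \<odot> P'"
  obtains U where "invertible U B B" "P' = (idn A \<otimes> U) \<odot> P"
proof -
  have ps: "pure_state \<Theta> (A \<boxdot> B) (raw P)" "pure_state \<Theta> (A \<boxdot> B) (raw P')"
    using assms pst_raw[of P "A \<boxdot> B"] pst_raw[of P' "A \<boxdot> B"] by simp_all
  have "raw ((idn A \<otimes> Dis B) \<odot> P) = raw ((idn A \<otimes> Dis B) \<odot> P')" using assms(3) by simp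
  then have m: "marginal \<Theta> A B (raw P) = marginal \<Theta> A B (raw P')" by (simp add: marginal_def)
  obtain V where V: "reversible \<Theta> B B V \<and> raw P' = (\<I> A \<boxtimes> V) \<cdot> raw P"
    using purification_unique[OF ps m] by (elim exE) (rule that)
  have "invertible (Arr B V B) B B" using V by (simp add: invertible_reversible)
  moreover have "P' = (idn A \<otimes> Arr B V B) \<odot> P"
    by (rule arrow_eqI) (use V assms in simp_all)
  ultimately show thesis by (rule that)
qed

text \<open>Any two pure states of \<open>A\<close> purify the unique normalised state of the
  trivial system, so essential uniqueness of purification connects them.\<close>

lemma pure_transitive:
  assumes "pst x A" "pst y A" obtains U where "invertible U A A" "y = U \<odot> x"
proof -
  have "(idn I0 \<otimes> Dis A) \<odot> x = (idn I0 \<otimes> Dis A) \<odot> y" using assms by simp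
  with assms obtain U where U: "invertible U A A" "y = (idn I0 \<otimes> U) \<odot> x"
    using purify_unique[of x I0 A y] by simp blast
  then show thesis using that[of U] invertible_chan[OF U(1)] by simp
qed

text \<open>Purity Preservation would need \<open>U\<close> to be pure, which is derived only later
  and with the help of this lemma. A decomposition is pulled back along the inverse of
  \<open>U\<close> instead.\<close>

lemma Pure_invertible_left:
  assumes f: "Pure f" and U: "invertible U B C" and B: "tgt f = B" shows "Pure (U \<odot> f)"
  unfolding Pure_def
proof (intro conjI allI impI)
  obtain V where V: "chan V" "ok V" "src V = C" "tgt V = B" "V \<odot> U = idn B" "U \<odot> V = idn C" using invertibleE[OF U] by blast
  note u = invertible_chan[OF U] note okf = Pure_ok[OF f]
  show "ok (U \<odot> f)" using u okf B by simp
  fix g h assume g: "coexist g h" "add (U \<odot> f) g h"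
  have ty: "hom g (src f) C" using add_type[OF g(2)] u by simp
  have "add (V \<odot> (U \<odot> f)) (V \<odot> g) (V \<odot> h)" using g(2) V u by (intro add_cmpL) simp_all
  moreover have "V \<odot> (U \<odot> f) = f" using cmp_reassoc[OF V(5), of f] okf u V B by simp
  ultimately have 1: "add f (V \<odot> g) (V \<odot> h)" by simp
  have "coexist (V \<odot> g) (V \<odot> h)" using g(1) V ty by (intro coexist_cmpL) simp_all
  from PureD[OF f this 1] obtain s where s: "hom s I0 I0" "V \<odot> g = s \<otimes> f" by blast
  have "U \<odot> (V \<odot> g) = g" using cmp_reassoc[OF V(6), of g] ty u V by simp
  then have "g = s \<otimes> (U \<odot> f)" using s u okf B by (simp add: cmp_effL)
  then show "\<exists>s. hom s I0 I0 \<and> g = s \<otimes> (U \<odot> f)" using s(1) by blast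
qed

lemma Pure_invertible_right:
  assumes f: "Pure f" and U: "invertible U B C" and C: "src f = C" shows "Pure (f \<odot> U)"
  unfolding Pure_def
proof (intro conjI allI impI)
  obtain V where V: "chan V" "ok V" "src V = C" "tgt V = B" "V \<odot> U = idn B" "U \<odot> V = idn C" using invertibleE[OF U] by blast
  note u = invertible_chan[OF U] note okf = Pure_ok[OF f]
  show "ok (f \<odot> U)" using u okf C by simp
  fix g h assume g: "coexist g h" "add (f \<odot> U) g h"
  have ty: "hom g B (tgt f)" using add_type[OF g(2)] u by simp
  have "add ((f \<odot> U) \<odot> V) (g \<odot> V) (h \<odot> V)" using g(2) V u by (intro add_cmpR) simp_all
  moreover have "(f \<odot> U) \<odot> V = f" using okf u V C by simp
  ultimately have 1: "add f (g \<odot> V) (h \<odot> V)" by simp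
  have "coexist (g \<odot> V) (h \<odot> V)" using g(1) V ty by (intro coexist_cmpR) simp_all
  from PureD[OF f this 1] obtain s where s: "hom s I0 I0" "g \<odot> V = s \<otimes> f" by blast
  have "g = (g \<odot> V) \<odot> U" using ty u V by simp
  then have "g = s \<otimes> (f \<odot> U)" using s u okf C cmp_stL[of U f s] by simp
  then show "\<exists>s. hom s I0 I0 \<and> g = s \<otimes> (f \<odot> U)" using s(1) by blast
qed

definition sharp :: "('a, 'b) arrow \<Rightarrow> ('a, 'b) arrow \<Rightarrow> 'a \<Rightarrow> bool"
  where "sharp f x A \<longleftrightarrow> hom f A I0 \<and> Pure f \<and> pst x A \<and> pr (f \<odot> x) = 1"

text \<open>Pure Sharpness gives one effect that is certain on some state. A pure maximiser of this
  effect is again certain, and transitivity on pure states moves the pair to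
  \<open>x\<close>.\<close>

lemma sharp_exists:
  assumes x: "pst x A" obtains f where "sharp f x A"
proof -
  obtain a r where ar: "pure \<Theta> A I0 a" "r \<in> states \<Theta> A" "val \<Theta> (a \<cdot> r) = 1"
    using pure_sharpness[of A] by (elim exE conjE) (rule that)
  define a' r' where "a' = Arr A a I0" and "r' = Arr I0 r A"
  have a': "hom a' A I0" "Pure a'" using ar Pure_pure[of a'] Pure_ok[of a'] by (simp_all add: a'_def)
  have r': "hom r' I0 A" using ar by (simp add: r'_def ok_def states_def)
  have 1: "pr (a' \<odot> r') = 1" using ar by (simp add: a'_def r'_def pr_def)
  obtain y where y: "nst y A" "r' = (Dis A \<odot> r') \<otimes> y" using normalise[OF r'] by blast
  have s: "hom (Dis A \<odot> r') I0 I0" using r' by simp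
  have "pr (a' \<odot> r') = pr (Dis A \<odot> r') * pr (a' \<odot> y)"
    using pr_scal[OF s nst_hom[OF y(1)] a'(1)] y(2) by simp
  moreover have "pr (Dis A \<odot> r') * pr (a' \<odot> y) \<le> 1 * pr (a' \<odot> y)"
    using pr_bounds[OF s] prob_bounds[OF a'(1) y(1)] by (intro mult_right_mono) simp_all
  ultimately have y1: "1 \<le> pr (a' \<odot> y)" using 1 by simp
  obtain z where z: "pst z A" "pr (a' \<odot> y) \<le> pr (a' \<odot> z)" using pure_attains[OF a'(1) y(1)] by blast
  obtain U where U: "invertible U A A" "z = U \<odot> x" using pure_transitive[OF x z(1)] by blast
  note u = invertible_chan[OF U(1)]
  have "pr (a' \<odot> z) = 1" using y1 z prob_bounds(2)[OF a'(1), of z] by simp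
  then have "pr ((a' \<odot> U) \<odot> x) = 1" using U u a' x chan_ok[of x] by simp
  then have "sharp (a' \<odot> U) x A"
    unfolding sharp_def using a' u x Pure_invertible_right[OF a'(2) U(1)] by simp
  then show thesis by (rule that)
qed

section \<open>Rearranging local operations on bipartite states\<close>

lemma exch_idn:
  assumes "ok x" "ok y" "ok f" "ok g" "tgt x = Q \<boxdot> src f" "tgt y = src g"
  shows "(idn Q \<otimes> (f \<otimes> g)) \<odot> (x \<otimes> y) = ((idn Q \<otimes> f) \<odot> x) \<otimes> (g \<odot> y)"
  using exch[of x "idn Q \<otimes> f" y g] assms by simp

lemma idn_act:
  assumes "ok x" "ok f" "ok g" "tgt x = Q \<boxdot> src f" "tgt f = src g"
  shows "(idn Q \<otimes> (g \<odot> f)) \<odot> x = (idn Q \<otimes> g) \<odot> ((idn Q \<otimes> f) \<odot> x)"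
  using exch3[of "idn Q" "idn Q" f g x] assms by simp

lemma act_idn:
  assumes "ok x" "ok f" "ok g" "tgt x = src f \<boxdot> Q" "tgt f = src g"
  shows "((g \<odot> f) \<otimes> idn Q) \<odot> x = (g \<otimes> idn Q) \<odot> ((f \<otimes> idn Q) \<odot> x)"
  using exch3[of f g "idn Q" "idn Q" x] assms by simp

lemma slide:
  assumes "ok x" "ok f" "ok g" "tgt x = src f \<boxdot> src g"
  shows "(f \<otimes> idn (tgt g)) \<odot> ((idn (src f) \<otimes> g) \<odot> x) = (idn (tgt f) \<otimes> g) \<odot> ((f \<otimes> idn (src g)) \<odot> x)"
  using exch3[of "idn (src f)" f g "idn (tgt g)" x] exch3[of f "idn (tgt f)" "idn (src g)" g x] assms by simp

lemma eff_act:
  assumes "hom a Q I0" "hom b B I0" "hom x I0 (Q \<boxdot> B)"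
  shows "(a \<otimes> b) \<odot> x = a \<odot> ((idn Q \<otimes> b) \<odot> x)"
  using cmp_effR[of "idn Q" a b] cmp_assoc[of x "idn Q \<otimes> b" a] assms by simp

lemma eff_act':
  assumes "hom a Q I0" "hom b B I0" "hom x I0 (Q \<boxdot> B)"
  shows "(a \<otimes> b) \<odot> x = b \<odot> ((a \<otimes> idn B) \<odot> x)"
  using cmp_effL[of "idn B" b a] cmp_assoc[of x "a \<otimes> idn B" b] assms by simp

lemma Sw_act:
  assumes "ok f" "ok g" "ok x" "tgt x = src f \<boxdot> src g"
  shows "Sw (tgt f) (tgt g) \<odot> ((f \<otimes> g) \<odot> x) = (g \<otimes> f) \<odot> (Sw (src f) (src g) \<odot> x)"
  using Sw_nat[of f g] cmp_assoc[of x "f \<otimes> g" "Sw (tgt f) (tgt g)"]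
    cmp_assoc[of x "Sw (src f) (src g)" "g \<otimes> f"] assms by simp

section \<open>Comparison of purifications and steering\<close>

lemma pst_invertible: "pst x A \<Longrightarrow> invertible U A B \<Longrightarrow> pst (U \<odot> x) B"
  using invertible_chan[of U A B] Pure_invertible_left[of x U A B] by simp

lemma pst_tens: "pst x A \<Longrightarrow> pst y B \<Longrightarrow> pst (x \<otimes> y) (A \<boxdot> B)"
  by (simp add: Pure_tens)

text \<open>Uniqueness of purification presupposes equal purifying systems. Padding each
  purification with a pure state of the other purifying system makes them comparable, up to a swap
  that is absorbed into \<open>U\<close>.\<close>

lemma purify_iso:
  assumes P: "pst P (Q \<boxdot> A)" and R: "pst R (Q \<boxdot> B)"
    and m: "(idn Q \<otimes> Dis A) \<odot> P = (idn Q \<otimes> Dis B) \<odot> R" and x: "pst x B" and y: "pst y A"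
  obtains U where "invertible U (A \<boxdot> B) (B \<boxdot> A)" "R \<otimes> y = (idn Q \<otimes> U) \<odot> (P \<otimes> x)"
proof -
  note hs = nst_hom[of P "Q \<boxdot> A"] nst_hom[of R "Q \<boxdot> B"] nst_hom[of x B] nst_hom[of y A]
  have h: "hom P I0 (Q \<boxdot> A)" "hom R I0 (Q \<boxdot> B)" "hom x I0 B" "hom y I0 A" using assms hs by blast+
  let ?R = "(idn Q \<otimes> Sw B A) \<odot> (R \<otimes> y)"
  have Px: "pst (P \<otimes> x) (Q \<boxdot> (A \<boxdot> B))" using pst_tens[OF P x] by simp
  have Ry: "pst (R \<otimes> y) (Q \<boxdot> (B \<boxdot> A))" using pst_tens[OF R y] by simp
  have R': "pst ?R (Q \<boxdot> (A \<boxdot> B))" by (rule pst_invertible[OF Ry invertible_tens[OF invertible_idn invertible_Sw]])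
  have "(idn Q \<otimes> Dis (A \<boxdot> B)) \<odot> (P \<otimes> x) = (idn Q \<otimes> Dis A) \<odot> P"
    unfolding Dis_tens[symmetric] using h x by (simp add: exch_idn)
  moreover have "(idn Q \<otimes> Dis (A \<boxdot> B)) \<odot> ?R = (idn Q \<otimes> Dis (B \<boxdot> A)) \<odot> (R \<otimes> y)"
    using h by (subst idn_act[symmetric]) simp_all
  moreover have "(idn Q \<otimes> Dis (B \<boxdot> A)) \<odot> (R \<otimes> y) = (idn Q \<otimes> Dis B) \<odot> R"
    unfolding Dis_tens[symmetric] using h y by (simp add: exch_idn)
  ultimately have "(idn Q \<otimes> Dis (A \<boxdot> B)) \<odot> (P \<otimes> x) = (idn Q \<otimes> Dis (A \<boxdot> B)) \<odot> ?R" using m by simp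
  from purify_unique[OF Px R' this] obtain U where U: "invertible U (A \<boxdot> B) (A \<boxdot> B)" "?R = (idn Q \<otimes> U) \<odot> (P \<otimes> x)" by blast
  note u = invertible_chan[OF U(1)]
  have "R \<otimes> y = (idn Q \<otimes> Sw A B) \<odot> ?R"
    using h by (subst idn_act[symmetric]) simp_all
  also have "\<dots> = (idn Q \<otimes> (Sw A B \<odot> U)) \<odot> (P \<otimes> x)"
    unfolding U(2) using h u by (subst idn_act) simp_all
  finally show thesis using that[OF invertible_cmp[OF U(1) invertible_Sw]] by blast
qed

text \<open>The purity of identities is only available below, as a consequence of this lemma.\<close>

lemma steer_dilation:
  assumes P: "pst P (Q \<boxdot> A)" and r: "nst r (Q \<boxdot> C)" and m: "(idn Q \<otimes> Dis A) \<odot> P = (idn Q \<otimes> Dis C) \<odot> r"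
  obtains Z D where "chan D" "src D = A" "tgt D = C \<boxdot> Z" "(idn Q \<otimes> ((idn C \<otimes> Dis Z) \<odot> D)) \<odot> P = r"
    "Pure (idn A) \<Longrightarrow> Pure D"
proof -
  obtain Y R where R: "pst R ((Q \<boxdot> C) \<boxdot> Y)" "(idn (Q \<boxdot> C) \<otimes> Dis Y) \<odot> R = r" using purify[OF r] by blast
  have R': "pst R (Q \<boxdot> (C \<boxdot> Y))" using R(1) by simp
  obtain x where x: "pst x (C \<boxdot> Y)" using pst_exists by blast
  obtain y where y: "pst y A" using pst_exists by blast
  have hP: "hom P I0 (Q \<boxdot> A)" and hR: "hom R I0 (Q \<boxdot> (C \<boxdot> Y))" and hx: "hom x I0 (C \<boxdot> Y)" and hy: "hom y I0 A"
    using P R' x y nst_hom by blast+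
  have "(idn Q \<otimes> Dis C) \<odot> ((idn Q \<otimes> (idn C \<otimes> Dis Y)) \<odot> R) = (idn Q \<otimes> (Dis C \<odot> (idn C \<otimes> Dis Y))) \<odot> R"
    using hR by (subst idn_act) simp_all
  also have "Dis C \<odot> (idn C \<otimes> Dis Y) = Dis (C \<boxdot> Y)" by (subst Dis_cmp) simp_all
  finally have m2: "(idn Q \<otimes> Dis A) \<odot> P = (idn Q \<otimes> Dis (C \<boxdot> Y)) \<odot> R"
    using m R(2) tens_assoc[of "idn Q" "idn C" "Dis Y"] by simp
  obtain U where U: "invertible U (A \<boxdot> (C \<boxdot> Y)) ((C \<boxdot> Y) \<boxdot> A)" "R \<otimes> y = (idn Q \<otimes> U) \<odot> (P \<otimes> x)"
    using purify_iso[OF P R' m2 x y] by blast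
  note u = invertible_chan[OF U(1)]
  \<comment> \<open>Attach the pure padding state and apply the reversible channel. The environment
    then consists of the system purifying \<open>r\<close> and of the padding system
    \<open>A\<close>.\<close>
  let ?D = "U \<odot> (idn A \<otimes> x)" and ?Z = "Y \<boxdot> A"
  have D: "chan ?D" "src ?D = A" "tgt ?D = C \<boxdot> ?Z" "ok ?D" using u x hx by simp_all
  have "(idn Q \<otimes> ((idn C \<otimes> Dis ?Z) \<odot> ?D)) \<odot> P = (idn Q \<otimes> (idn C \<otimes> Dis ?Z)) \<odot> ((idn Q \<otimes> U) \<odot> ((idn Q \<otimes> (idn A \<otimes> x)) \<odot> P))"
    using hP hx u by (simp add: idn_act)
  also have "(idn Q \<otimes> (idn A \<otimes> x)) \<odot> P = P \<otimes> x"
    using hP hx cmp_stR[of P "idn (Q \<boxdot> A)" x] tens_assoc[of "idn Q" "idn A" x] by simp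
  also have "(idn Q \<otimes> U) \<odot> (P \<otimes> x) = R \<otimes> y" using U(2) by simp
  also have "idn Q \<otimes> (idn C \<otimes> Dis ?Z) = (idn (Q \<boxdot> C) \<otimes> Dis Y) \<otimes> Dis A"
    using tens_assoc[of "idn Q" "idn C" "Dis Y \<otimes> Dis A"] by (simp add: Dis_tens)
  also have "((idn (Q \<boxdot> C) \<otimes> Dis Y) \<otimes> Dis A) \<odot> (R \<otimes> y) = ((idn (Q \<boxdot> C) \<otimes> Dis Y) \<odot> R) \<otimes> (Dis A \<odot> y)"
    using hR hy by (intro exch) simp_all
  also have "\<dots> = r" using R(2) y nst_hom[OF r] by simp
  finally have e: "(idn Q \<otimes> ((idn C \<otimes> Dis ?Z) \<odot> ?D)) \<odot> P = r" .
  have "Pure ?D" if "Pure (idn A)"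
    by (rule Pure_invertible_left[OF _ U(1)]) (use that x Pure_tens in simp_all)
  then show thesis using that[OF D(1-3) e] by blast
qed

lemma arrow_test_dilation:
  assumes "arrow_test A B Cs"
  obtains X F es where "chan F" "src F = A" "tgt F = B \<boxdot> X" "arrow_test X I0 es" "Cs = map (\<lambda>e. (idn B \<otimes> e) \<odot> F) es"
proof -
  have "map raw Cs \<in> tests \<Theta> A B" using assms by (simp add: arrow_test_def)
  from test_dilation[OF this] obtain X F es where F: "channel \<Theta> A (B \<boxdot> X) F" "es \<in> tests \<Theta> X I0"
    "map raw Cs = map (\<lambda>e. (\<I> B \<boxtimes> e) \<cdot> F) es" by (elim exE conjE) (rule that)
  let ?F = "Arr A F (B \<boxdot> X)" and ?es = "map (\<lambda>e. Arr X e I0) es"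
  have "Cs = map (\<lambda>e. (idn B \<otimes> e) \<odot> ?F) ?es"
  proof (rule nth_equalityI)
    show l: "length Cs = length (map (\<lambda>e. (idn B \<otimes> e) \<odot> ?F) ?es)" using arg_cong[OF F(3), of length] by simp
    fix i assume i: "i < length Cs"
    have C: "hom (Cs ! i) A B" using arrow_test_hom[OF assms] i by simp
    have "raw (Cs ! i) = (\<I> B \<boxtimes> es ! i) \<cdot> F" using arg_cong[OF F(3), of "\<lambda>xs. xs ! i"] i l by simp
    then show "Cs ! i = map (\<lambda>e. (idn B \<otimes> e) \<odot> ?F) ?es ! i"
      using C i l by (intro arrow_eqI) simp_all
  qed
  moreover have "arrow_test X I0 ?es" by (rule arrow_test_raw[OF F(2)])
  ultimately show thesis using that[of ?F X ?es] F(1) by (simp add: chan_def)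
qed

text \<open>The random preparation of \<open>r\<close> or \<open>r'\<close> is dilated to a state
  \<open>F\<close> with the choice recorded in a system \<open>X\<close>. The marginals of
  \<open>F\<close> and \<open>P\<close> on \<open>Q\<close> agree, so a channel on \<open>A\<close>
  produces \<open>F\<close> from \<open>P\<close>; reading the record then leaves \<open>r\<close>
  with weight \<open>p\<close>.\<close>

lemma steer_ensemble:
  assumes P: "pst P (Q \<boxdot> A)" and r: "nst r (Q \<boxdot> S)" "nst r' (Q \<boxdot> S)" and p: "0 \<le> p" "p \<le> 1"
    and m: "\<And>a. hom a Q I0 \<Longrightarrow> pr (a \<odot> ((idn Q \<otimes> Dis A) \<odot> P)) =
      p * pr (a \<odot> ((idn Q \<otimes> Dis S) \<odot> r)) + (1 - p) * pr (a \<odot> ((idn Q \<otimes> Dis S) \<odot> r'))"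
  obtains s t where "hom s I0 I0" "pr s = p" "hom t A S" "(idn Q \<otimes> t) \<odot> P = s \<otimes> r"
proof -
  obtain s s' where s: "hom s I0 I0" "hom s' I0 I0" "pr s = p" "pr s' = 1 - p"
    and T: "arrow_test I0 (Q \<boxdot> S) [s \<otimes> r, s' \<otimes> r']"
    by (rule binary_mixture[OF r p])
  obtain X F es where F: "chan F" "src F = I0" "tgt F = (Q \<boxdot> S) \<boxdot> X" and es: "arrow_test X I0 es"
    "[s \<otimes> r, s' \<otimes> r'] = map (\<lambda>e. (idn (Q \<boxdot> S) \<otimes> e) \<odot> F) es" by (rule arrow_test_dilation[OF T])
  obtain e e' where e: "es = [e, e']" "s \<otimes> r = (idn (Q \<boxdot> S) \<otimes> e) \<odot> F" "s' \<otimes> r' = (idn (Q \<boxdot> S) \<otimes> e') \<odot> F"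
    using es(2) by (auto simp: Cons_eq_map_conv)
  have he: "hom e X I0" "hom e' X I0" using arrow_test_hom[OF es(1)] e(1) by simp_all
  obtain c where c: "chan c" "src c = X" "tgt c = I0" "add c e e'" by (rule arrow_test_sum2[of X I0 e e']) (use es(1) e(1) in simp)
  have "c = Dis X" using c by (intro Dis_unique) simp_all
  then have ad: "add (Dis X) e e'" using c by simp
  have hF: "hom F I0 (Q \<boxdot> (S \<boxdot> X))" using F chan_ok[OF F(1)] by simp
  have hP: "hom P I0 (Q \<boxdot> A)" using P nst_hom by blast
  note hr = nst_hom[OF r(1)] nst_hom[OF r(2)]
  have mF: "(idn Q \<otimes> Dis A) \<odot> P = (idn Q \<otimes> Dis (S \<boxdot> X)) \<odot> F"
  proof (rule state_ext[of _ Q])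
    fix a assume a: "hom a Q I0"
    let ?E = "a \<otimes> Dis S"
    have hE: "hom ?E (Q \<boxdot> S) I0" using a by simp
    have "pr (a \<odot> ((idn Q \<otimes> Dis (S \<boxdot> X)) \<odot> F)) = pr ((?E \<otimes> Dis X) \<odot> F)"
      using eff_act[of a Q "Dis (S \<boxdot> X)" "S \<boxdot> X" F] a hF by (simp add: Dis_tens)
    also have "(?E \<otimes> Dis X) \<odot> F = ?E \<odot> ((idn (Q \<boxdot> S) \<otimes> Dis X) \<odot> F)"
      using eff_act[of ?E "Q \<boxdot> S" "Dis X" X F] hE hF by simp
    also have "pr \<dots> = pr (?E \<odot> ((idn (Q \<boxdot> S) \<otimes> e) \<odot> F)) + pr (?E \<odot> ((idn (Q \<boxdot> S) \<otimes> e') \<odot> F))"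
      by (rule add_st[OF add_cmpR[OF add_tensL[OF ad]]]) (use hF hE in simp_all)
    also have "\<dots> = p * pr (?E \<odot> r) + (1 - p) * pr (?E \<odot> r')"
      unfolding e(2,3)[symmetric] using pr_scal[OF s(1) hr(1) hE] pr_scal[OF s(2) hr(2) hE] s(3,4) by simp
    also have "\<dots> = pr (a \<odot> ((idn Q \<otimes> Dis A) \<odot> P))"
      using m[OF a] eff_act[of a Q "Dis S" S r] eff_act[of a Q "Dis S" S r'] a hr by simp
    finally show "pr (a \<odot> ((idn Q \<otimes> Dis A) \<odot> P)) = pr (a \<odot> ((idn Q \<otimes> Dis (S \<boxdot> X)) \<odot> F))" by simp
  qed (use hP hF in simp_all)
  have nF: "nst F (Q \<boxdot> (S \<boxdot> X))" using F by simp
  obtain Z D where D: "chan D" "src D = A" "tgt D = (S \<boxdot> X) \<boxdot> Z" "(idn Q \<otimes> ((idn (S \<boxdot> X) \<otimes> Dis Z) \<odot> D)) \<odot> P = F"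
    by (rule steer_dilation[OF P nF mF])
  let ?d = "(idn (S \<boxdot> X) \<otimes> Dis Z) \<odot> D"
  have d: "hom ?d A (S \<boxdot> X)" using D chan_ok[OF D(1)] by simp
  have "(idn Q \<otimes> ((idn S \<otimes> e) \<odot> ?d)) \<odot> P = (idn Q \<otimes> (idn S \<otimes> e)) \<odot> F"
    unfolding D(4)[symmetric] using d hP he by (subst idn_act) simp_all
  also have "\<dots> = s \<otimes> r" unfolding e(2) using tens_assoc[of "idn Q" "idn S" e] he by simp
  finally show thesis using that[of s "(idn S \<otimes> e) \<odot> ?d"] s d he by simp
qed

definition purif :: "('a, 'b) arrow \<Rightarrow> ('a, 'b) arrow \<Rightarrow> 'a \<Rightarrow> 'a \<Rightarrow> bool"
  where "purif P x A Q \<longleftrightarrow> pst P (A \<boxdot> Q) \<and> (idn A \<otimes> Dis Q) \<odot> P = x"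

lemma uniform_nst: "uniform x A \<Longrightarrow> nst x A" by (auto simp: uniform_def internal_def)

lemma uniform_purif: assumes "uniform x A" obtains P Q where "purif P x A Q"
  using purify[OF uniform_nst[OF assms]] unfolding purif_def by blast

lemma purif_hom: "purif P x A Q \<Longrightarrow> hom P I0 (A \<boxdot> Q)"
  unfolding purif_def using nst_hom by blast

text \<open>Since \<open>c\<close> is internal, it contains the marginal of any state
  \<open>y\<close> of \<open>A\<close> with a reference system. So \<open>y\<close> is steered from
  \<open>P\<close>, up to a nonzero scalar, by a transformation \<open>d\<close> of the purifying
  system. As \<open>d\<close> commutes with \<open>T\<close> and \<open>T'\<close>, their agreement
  on \<open>P\<close> carries over to \<open>y\<close>.\<close>

lemma faithful:
  assumes c: "uniform c A" and P: "purif P c A Q" and T: "hom T A B" "hom T' A B"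
    and e: "(T \<otimes> idn Q) \<odot> P = (T' \<otimes> idn Q) \<odot> P"
  shows "T = T'"
proof (rule ap_ext)
  fix S x E assume x: "hom x I0 (src T \<boxdot> S)" and E: "hom E (tgt T \<boxdot> S) I0"
  have x': "hom x I0 (A \<boxdot> S)" and E': "hom E (B \<boxdot> S) I0" using x E T by simp_all
  obtain y where y: "nst y (A \<boxdot> S)" "x = (Dis (A \<boxdot> S) \<odot> x) \<otimes> y" using normalise[OF x'] by blast
  have hy: "hom y I0 (A \<boxdot> S)" by (rule nst_hom[OF y(1)])
  have hP: "hom P I0 (A \<boxdot> Q)" by (rule purif_hom[OF P])
  obtain p where p: "internal p c A" using c by (auto simp: uniform_def)
  then have p01: "0 < p" "p < 1" by (simp_all add: internal_def)
  have nm: "nst ((idn A \<otimes> Dis S) \<odot> y) A" using y by simp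
  then have "weight p ((idn A \<otimes> Dis S) \<odot> y) c A" using p by (simp add: internal_def)
  then obtain t where t: "nst t A"
    "\<forall>a. hom a A I0 \<longrightarrow> pr (a \<odot> c) = p * pr (a \<odot> ((idn A \<otimes> Dis S) \<odot> y)) + (1 - p) * pr (a \<odot> t)" by (rule weightE)
  obtain w where w: "nst w S" using nst_exists by blast
  have tw: "nst (t \<otimes> w) (A \<boxdot> S)" using t w by simp
  have mt: "(idn A \<otimes> Dis S) \<odot> (t \<otimes> w) = t"
    using exch[of t "idn A" w "Dis S"] nst_hom[OF t(1)] nst_hom[OF w] w by simp
  have P1: "pst P (A \<boxdot> Q)" and P2: "(idn A \<otimes> Dis Q) \<odot> P = c" using P by (simp_all add: purif_def)
  have "pr (a \<odot> ((idn A \<otimes> Dis Q) \<odot> P)) =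
      p * pr (a \<odot> ((idn A \<otimes> Dis S) \<odot> y)) + (1 - p) * pr (a \<odot> ((idn A \<otimes> Dis S) \<odot> (t \<otimes> w)))"
    if "hom a A I0" for a unfolding P2 mt using t(2) that by blast
  with P1 y(1) tw obtain s d where s: "hom s I0 I0" "pr s = p" "hom d Q S" "(idn A \<otimes> d) \<odot> P = s \<otimes> y"
    using steer_ensemble[of P A Q y S "t \<otimes> w" p] p01 by (metis less_imp_le)
  have sl: "(G \<otimes> idn S) \<odot> (s \<otimes> y) = (idn B \<otimes> d) \<odot> ((G \<otimes> idn Q) \<odot> P)" if "hom G A B" for G
    unfolding s(4)[symmetric] using slide[of P G d] that hP s(3) by simp
  have "(T \<otimes> idn S) \<odot> (s \<otimes> y) = (T' \<otimes> idn S) \<odot> (s \<otimes> y)" using sl[OF T(1)] sl[OF T(2)] e by simp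
  then have "s \<otimes> ((T \<otimes> idn S) \<odot> y) = s \<otimes> ((T' \<otimes> idn S) \<odot> y)"
    using cmp_effL[of y "T \<otimes> idn S" s] cmp_effL[of y "T' \<otimes> idn S" s] s hy T by simp
  then have eq: "(T \<otimes> idn S) \<odot> y = (T' \<otimes> idn S) \<odot> y"
    by (rule scalar_cancel[of s, rotated 4]) (use s p01 hy T in simp_all)
  have sx: "hom (Dis (A \<boxdot> S) \<odot> x) I0 I0" using x' by simp
  have "(G \<otimes> idn S) \<odot> x = (Dis (A \<boxdot> S) \<odot> x) \<otimes> ((G \<otimes> idn S) \<odot> y)" if "hom G A B" for G
    by (subst y(2), rule cmp_effL) (use sx hy that in simp_all)
  from this[OF T(1)] this[OF T(2)] have "(T \<otimes> idn S) \<odot> x = (T' \<otimes> idn S) \<odot> x" unfolding eq by simp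
  then show "ap S E T x = ap S E T' x" by (simp add: ap_def)
qed (use T in simp_all)

lemma faithfulL:
  assumes c: "uniform c A" and P: "purif P c A Q" and T: "hom T A B" "hom T' A B"
    and e: "(idn Q \<otimes> T) \<odot> (Sw A Q \<odot> P) = (idn Q \<otimes> T') \<odot> (Sw A Q \<odot> P)"
  shows "T = T'"
proof (rule faithful[OF c P T])
  have hP: "hom P I0 (A \<boxdot> Q)" by (rule purif_hom[OF P])
  have "Sw B Q \<odot> ((T \<otimes> idn Q) \<odot> P) = Sw B Q \<odot> ((T' \<otimes> idn Q) \<odot> P)"
    using e Sw_act[of T "idn Q" P] Sw_act[of T' "idn Q" P] hP T by simp
  then have "Sw Q B \<odot> (Sw B Q \<odot> ((T \<otimes> idn Q) \<odot> P)) = Sw Q B \<odot> (Sw B Q \<odot> ((T' \<otimes> idn Q) \<odot> P))" by simp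
  then show "(T \<otimes> idn Q) \<odot> P = (T' \<otimes> idn Q) \<odot> P" using hP T by simp
qed

lemma purif_flip:
  assumes P: "purif P c A Q"
  shows "pst (Sw A Q \<odot> P) (Q \<boxdot> A)" "(Dis Q \<otimes> idn A) \<odot> (Sw A Q \<odot> P) = c"
    "hom (Sw A Q \<odot> P) I0 (Q \<boxdot> A)" "(idn Q \<otimes> Dis A) \<odot> (Sw A Q \<odot> P) = (Dis A \<otimes> idn Q) \<odot> P"
proof -
  have hP: "hom P I0 (A \<boxdot> Q)" by (rule purif_hom[OF P])
  show "pst (Sw A Q \<odot> P) (Q \<boxdot> A)" using P invertible_Sw by (intro pst_invertible) (simp_all add: purif_def)
  show "(Dis Q \<otimes> idn A) \<odot> (Sw A Q \<odot> P) = c"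
    using Sw_act[of "idn A" "Dis Q" P] hP P by (simp add: purif_def)
  show "(idn Q \<otimes> Dis A) \<odot> (Sw A Q \<odot> P) = (Dis A \<otimes> idn Q) \<odot> P"
    using Sw_act[of "Dis A" "idn Q" P] hP by simp
qed (use purif_hom[OF P] in simp)

text \<open>A decomposition of the identity decomposes the pure state \<open>P\<close>, so its first
  term multiplies \<open>P\<close> by a scalar; by faithfulness it is that multiple of the
  identity.\<close>

lemma Pure_idn: "Pure (idn A)"
  unfolding Pure_def
proof (intro conjI allI impI)
  fix g h assume g: "coexist g h" "add (idn A) g h"
  obtain c where c: "uniform c A" using uniform_exists by blast
  obtain P Q where P: "purif P c A Q" using uniform_purif[OF c] by blast
  have hP: "hom P I0 (A \<boxdot> Q)" and cP: "chan P" "Pure P" using purif_hom[OF P] P by (simp_all add: purif_def)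
  have ty: "hom g A A" using add_type[OF g(2)] by simp
  have "add ((idn A \<otimes> idn Q) \<odot> P) ((g \<otimes> idn Q) \<odot> P) ((h \<otimes> idn Q) \<odot> P)"
    using hP by (intro add_cmpR add_tensR g(2)) simp_all
  then have 1: "add P ((g \<otimes> idn Q) \<odot> P) ((h \<otimes> idn Q) \<odot> P)" using hP by simp
  have 2: "coexist ((g \<otimes> idn Q) \<odot> P) ((h \<otimes> idn Q) \<odot> P)"
    using hP cP ty by (intro coexist_cmpR coexist_tensR g(1)) simp_all
  obtain s where s: "hom s I0 I0" "(g \<otimes> idn Q) \<odot> P = s \<otimes> P" using PureD[OF cP(2) 2 1] by blast
  have "g = s \<otimes> idn A"
    by (rule faithful[OF c P ty]) (use s hP cmp_stL[of P "idn (A \<boxdot> Q)" s] in simp_all)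
  then show "\<exists>s. hom s I0 I0 \<and> g = s \<otimes> idn A" using s(1) by blast
qed simp

lemma Pure_invertible: "invertible U A B \<Longrightarrow> Pure U"
  using Pure_invertible_left[OF Pure_idn, of U A B A] invertible_chan[of U A B] by simp

section \<open>Sharp pairs\<close>

lemma pure_channel_invertible:
  assumes C: "Pure C" "chan C" "src C = A" "tgt C = A" shows "invertible C A A"
proof -
  obtain c where c: "uniform c A" using uniform_exists by blast
  obtain P Q where P: "purif P c A Q" using uniform_purif[OF c] by blast
  let ?X = "Sw A Q \<odot> P"
  note X = purif_flip[OF P]
  note okC = chan_ok[OF C(2)]
  have 2: "pst ((idn Q \<otimes> C) \<odot> ?X) (Q \<boxdot> A)"
    using C X(1) Pure_cmp[of ?X "idn Q \<otimes> C"] Pure_tens[OF Pure_idn C(1), of Q] by simp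
  have "(idn Q \<otimes> Dis A) \<odot> ((idn Q \<otimes> C) \<odot> ?X) = (idn Q \<otimes> (Dis A \<odot> C)) \<odot> ?X"
    by (rule idn_act[symmetric]) (use C okC X(3) in simp_all)
  then have m: "(idn Q \<otimes> Dis A) \<odot> ?X = (idn Q \<otimes> Dis A) \<odot> ((idn Q \<otimes> C) \<odot> ?X)" using C by simp
  obtain U where U: "invertible U A A" "(idn Q \<otimes> C) \<odot> ?X = (idn Q \<otimes> U) \<odot> ?X" using purify_unique[OF X(1) 2 m] by blast
  have "C = U" by (rule faithfulL[OF c P _ _ U(2)]) (use C okC invertible_chan[OF U(1)] in simp_all)
  then show ?thesis using U(1) by simp
qed

text \<open>The product of the pure marginal with any pure state of \<open>B\<close> is another
  purification of the same marginal, so \<open>W\<close> arises from it by a reversible channel on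
  \<open>B\<close>.\<close>

lemma factor_pure:
  assumes W: "pst W (A \<boxdot> B)" and m: "Pure ((idn A \<otimes> Dis B) \<odot> W)"
  obtains y where "pst y B" "W = ((idn A \<otimes> Dis B) \<odot> W) \<otimes> y"
proof -
  let ?x = "(idn A \<otimes> Dis B) \<odot> W"
  obtain z where z: "pst z B" using pst_exists by blast
  have x: "pst ?x A" using W m by simp
  have xz: "pst (?x \<otimes> z) (A \<boxdot> B)" by (rule pst_tens[OF x z])
  have hx: "hom ?x I0 A" and hz: "hom z I0 B" using x z nst_hom by blast+
  have "(idn A \<otimes> Dis B) \<odot> (?x \<otimes> z) = (idn A \<odot> ?x) \<otimes> (Dis B \<odot> z)"
    using hx hz by (intro exch) simp_all
  then have "(idn A \<otimes> Dis B) \<odot> (?x \<otimes> z) = ?x" using z hx by simp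
  then have "(idn A \<otimes> Dis B) \<odot> (?x \<otimes> z) = (idn A \<otimes> Dis B) \<odot> W" by simp
  from purify_unique[OF xz W this] obtain U where U: "invertible U B B" "W = (idn A \<otimes> U) \<odot> (?x \<otimes> z)" by blast
  have "(idn A \<otimes> U) \<odot> (?x \<otimes> z) = (idn A \<odot> ?x) \<otimes> (U \<odot> z)"
    using hx hz invertible_chan[OF U(1)] by (intro exch) simp_all
  then have "W = ?x \<otimes> (U \<odot> z)" using U(2) hx by simp
  then show thesis using that[OF pst_invertible[OF z U(1)]] by blast
qed

text \<open>Purifying \<open>W\<close> does not change its marginal on \<open>A\<close>, so the pure
  case applies; then the purifying system is discarded again.\<close>

lemma factor:
  assumes W: "nst W (A \<boxdot> B)" and m: "Pure ((idn A \<otimes> Dis B) \<odot> W)"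
  obtains y where "nst y B" "W = ((idn A \<otimes> Dis B) \<odot> W) \<otimes> y"
proof -
  obtain X R where R: "pst R ((A \<boxdot> B) \<boxdot> X)" "(idn (A \<boxdot> B) \<otimes> Dis X) \<odot> R = W" using purify[OF W] by blast
  have R': "pst R (A \<boxdot> (B \<boxdot> X))" using R(1) by simp
  have hR: "hom R I0 (A \<boxdot> (B \<boxdot> X))" using R' nst_hom by blast
  have "(idn A \<otimes> Dis B) \<odot> W = (idn A \<otimes> Dis B) \<odot> ((idn A \<otimes> (idn B \<otimes> Dis X)) \<odot> R)"
    using R(2) tens_assoc[of "idn A" "idn B" "Dis X"] by simp
  also have "\<dots> = (idn A \<otimes> (Dis B \<odot> (idn B \<otimes> Dis X))) \<odot> R" using hR by (subst idn_act) simp_all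
  also have "Dis B \<odot> (idn B \<otimes> Dis X) = Dis (B \<boxdot> X)" by (subst Dis_cmp) simp_all
  finally have e: "(idn A \<otimes> Dis B) \<odot> W = (idn A \<otimes> Dis (B \<boxdot> X)) \<odot> R" .
  let ?x = "(idn A \<otimes> Dis B) \<odot> W"
  obtain y where y: "pst y (B \<boxdot> X)" "R = ((idn A \<otimes> Dis (B \<boxdot> X)) \<odot> R) \<otimes> y"
    using factor_pure[OF R'] m unfolding e by blast
  have hy: "hom y I0 (B \<boxdot> X)" using y nst_hom by blast
  have hx: "hom ?x I0 A" using nst_hom[OF W] by simp
  have "W = (idn A \<otimes> (idn B \<otimes> Dis X)) \<odot> R" using R(2) tens_assoc[of "idn A" "idn B" "Dis X"] by simp
  also have "\<dots> = (idn A \<otimes> (idn B \<otimes> Dis X)) \<odot> (?x \<otimes> y)" using y(2) e by simp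
  also have "\<dots> = (idn A \<odot> ?x) \<otimes> ((idn B \<otimes> Dis X) \<odot> y)" using hx hy by (intro exch) simp_all
  finally have "W = ?x \<otimes> ((idn B \<otimes> Dis X) \<odot> y)" using hx by simp
  moreover have "nst ((idn B \<otimes> Dis X) \<odot> y) B" using y by simp
  ultimately show thesis using that by blast
qed

text \<open>If \<open>f\<close> occurs with certainty on \<open>r\<close>, it acts on a purification of \<open>r\<close> like the deterministic effect, so the
  complementary marginal is pure and the purification factorises.\<close>

lemma ident_pure:
  assumes f: "Pure f" "hom f A I0" and r: "nst r A" "pr (f \<odot> r) = 1" shows "Pure r"
proof -
  obtain B G where G: "pst G (A \<boxdot> B)" "(idn A \<otimes> Dis B) \<odot> G = r" using purify[OF r(1)] by blast
  have hG: "hom G I0 (A \<boxdot> B)" using G nst_hom by blast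
  obtain f' where f': "hom f' A I0" "add (Dis A) f f'" using complement_effect[OF f(2)] by blast
  have hr: "hom r I0 A" by (rule nst_hom[OF r(1)])
  have "pr (Dis A \<odot> r) = pr (f \<odot> r) + pr (f' \<odot> r)" using add_eff[OF f'(2)] hr by simp
  then have f'r: "pr (f' \<odot> r) = 0" using r by simp
  have e: "(Dis A \<otimes> idn B) \<odot> G = (f \<otimes> idn B) \<odot> G"
  proof (rule state_ext[of _ B])
    fix b assume b: "hom b B I0"
    have 1: "pr (b \<odot> ((Dis A \<otimes> idn B) \<odot> G)) = pr (b \<odot> ((f \<otimes> idn B) \<odot> G)) + pr (b \<odot> ((f' \<otimes> idn B) \<odot> G))"
      by (rule add_st[OF add_cmpR[OF add_tensR[OF f'(2)]]]) (use hG b in simp_all)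
    have h: "hom ((f' \<otimes> idn B) \<odot> G) I0 B" using hG f' by simp
    have "pr (b \<odot> ((f' \<otimes> idn B) \<odot> G)) \<le> pr (Dis B \<odot> ((f' \<otimes> idn B) \<odot> G))" by (rule pr_effect_le[OF b h])
    also have "Dis B \<odot> ((f' \<otimes> idn B) \<odot> G) = f' \<odot> r"
      using eff_act'[of f' A "Dis B" B G] eff_act[of f' A "Dis B" B G] hG f' G(2) by simp
    finally have "pr (b \<odot> ((f' \<otimes> idn B) \<odot> G)) \<le> 0" using f'r by simp
    moreover have "0 \<le> pr (b \<odot> ((f' \<otimes> idn B) \<odot> G))" using h b by (intro pr_bounds) simp
    ultimately show "pr (b \<odot> ((Dis A \<otimes> idn B) \<odot> G)) = pr (b \<odot> ((f \<otimes> idn B) \<odot> G))" using 1 by simp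
  qed (use hG f in simp_all)
  have "Pure ((f \<otimes> idn B) \<odot> G)"
    using f G(1) by (intro Pure_cmp Pure_tens Pure_idn) simp_all
  then have Pb: "Pure ((Dis A \<otimes> idn B) \<odot> G)" using e by simp
  have S: "pst (Sw A B \<odot> G) (B \<boxdot> A)" by (rule pst_invertible[OF G(1) invertible_Sw])
  have mS: "(idn B \<otimes> Dis A) \<odot> (Sw A B \<odot> G) = (Dis A \<otimes> idn B) \<odot> G"
    using Sw_act[of "Dis A" "idn B" G] hG by simp
  obtain y where y: "pst y A" "Sw A B \<odot> G = ((Dis A \<otimes> idn B) \<odot> G) \<otimes> y"
    using factor_pure[OF S] Pb unfolding mS by blast
  let ?b = "(Dis A \<otimes> idn B) \<odot> G"
  have hb: "hom ?b I0 B" and cb: "nst ?b B" using hG G by simp_all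
  have hy: "hom y I0 A" using y nst_hom by blast
  have "G = Sw B A \<odot> (Sw A B \<odot> G)" using hG by simp
  also have "\<dots> = y \<otimes> ?b" unfolding y(2) using Sw_state[of ?b y] hb hy by simp
  finally have Gy: "G = y \<otimes> ?b" .
  have "r = (idn A \<otimes> Dis B) \<odot> (y \<otimes> ?b)" using G(2) Gy by simp
  also have "\<dots> = (idn A \<odot> y) \<otimes> (Dis B \<odot> ?b)" using hy hb by (intro exch) simp_all
  also have "\<dots> = y" using hy cb by simp
  finally show ?thesis using y by simp
qed

text \<open>The equal mixture of \<open>r\<close> and \<open>q\<close> is identified with certainty
  as well, hence pure by \<open>ident_pure\<close>, so its components cannot differ from it.\<close>

lemma ident_unique:
  assumes f: "Pure f" "hom f A I0" and r: "nst r A" "pr (f \<odot> r) = 1" and q: "nst q A" "pr (f \<odot> q) = 1"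
  shows "r = q"
proof -
  obtain s t z where s: "hom s I0 I0" "hom t I0 I0" "pr s = 1/2" "pr t = 1 - 1/2"
    "arrow_test I0 A [s \<otimes> r, t \<otimes> q]" "nst z A" "add z (s \<otimes> r) (t \<otimes> q)"
    "\<forall>a. hom a A I0 \<longrightarrow> pr (a \<odot> z) = 1/2 * pr (a \<odot> r) + (1 - 1/2) * pr (a \<odot> q)"
    by (rule binary_mixture[OF r(1) q(1), of "1/2"]) (simp, simp, rule that)
  have "pr (f \<odot> z) = 1" using s(8) f(2) r(2) q(2) by simp
  then have "Pure z" using ident_pure[OF f s(6)] by simp
  from PureD[OF this arrow_test_coex[OF s(5)] s(7)] obtain u where u: "hom u I0 I0" "s \<otimes> r = u \<otimes> z" by blast
  have "pr (Dis A \<odot> (s \<otimes> r)) = pr s" "pr (Dis A \<odot> (u \<otimes> z)) = pr u"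
    using pr_scal[OF s(1) nst_hom[OF r(1)], of "Dis A"] pr_scal[OF u(1) nst_hom[OF s(6)], of "Dis A"] r(1) s(6) by simp_all
  then have su: "s = u" using u s(1) by (intro scalar_ext) simp_all
  have "r = z"
    by (rule scalar_cancel[of s]) (use u(2) su nst_hom[OF r(1)] nst_hom[OF s(6)] s(1,3) in simp_all)
  show ?thesis
  proof (rule state_ext[OF nst_hom[OF r(1)] nst_hom[OF q(1)]])
    fix a assume "hom a A I0"
    then have "pr (a \<odot> z) = 1/2 * pr (a \<odot> r) + (1 - 1/2) * pr (a \<odot> q)" using s(8) by blast
    then show "pr (a \<odot> r) = pr (a \<odot> q)" using \<open>r = z\<close> by simp
  qed
qed

lemma coexist_scalar:
  assumes c: "coexist g h" "src h = src g" "tgt h = tgt g" and s: "hom s I0 I0" shows "coexist (s \<otimes> g) (s \<otimes> h)"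
proof -
  let ?A = "src g" and ?B = "tgt g"
  obtain k where k: "arrow_test ?A ?B [g, h, k]" using c(1) unfolding coexist_def by blast
  have hk: "ok g" "ok h" "ok k" "src k = ?A" "tgt k = ?B"
    using arrow_test_hom[OF k, of g] arrow_test_hom[OF k, of h] arrow_test_hom[OF k, of k] by simp_all
  obtain s' where s': "arrow_test I0 I0 [s, s']" by (rule complement[OF s])
  have hs: "hom s' I0 I0" using arrow_test_hom[OF s', of s'] by simp
  have "arrow_test ?A ?A [s \<otimes> idn ?A, s' \<otimes> idn ?A]" using arrow_test_tensR[OF s', of "idn ?A"] by simp
  moreover have "arrow_test ?A ?B Ds" if "Ds \<in> set [[g, h, k], [g, h, k]]" for Ds using that k by auto
  ultimately have "arrow_test ?A ?B (concat (map (\<lambda>(F, Ds). map (\<lambda>D. D \<odot> F) Ds) (zip [s \<otimes> idn ?A, s' \<otimes> idn ?A] [[g, h, k], [g, h, k]])))"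
    by (intro arrow_test_cond) simp_all
  then have T: "arrow_test ?A ?B [s \<otimes> g, s \<otimes> h, s \<otimes> k, s' \<otimes> g, s' \<otimes> h, s' \<otimes> k]"
    using hk s hs c(2,3) by (simp add: scalar_cmpR)
  obtain g' h' j where 3: "arrow_test ?A ?B [g', h', j]"
    "lin g' {0} (\<lambda>_. 1) (\<lambda>i. [s \<otimes> g, s \<otimes> h, s \<otimes> k, s' \<otimes> g, s' \<otimes> h, s' \<otimes> k] ! i)"
    "lin h' {1} (\<lambda>_. 1) (\<lambda>i. [s \<otimes> g, s \<otimes> h, s \<otimes> k, s' \<otimes> g, s' \<otimes> h, s' \<otimes> k] ! i)"
    by (rule arrow_test_split3[OF T, of "{0}" "{1}"]) simp_all
  have h3: "hom g' ?A ?B" "hom h' ?A ?B" using arrow_test_hom[OF 3(1), of g'] arrow_test_hom[OF 3(1), of h'] by simp_all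
  have "lin g' {0::nat} (\<lambda>_. 1) (\<lambda>_. s \<otimes> g)" by (rule lin_cong[OF 3(2)]) simp_all
  then have "g' = s \<otimes> g" by (rule lin_unique[OF _ lin_single]) (use h3 s hk in simp_all)
  moreover have "lin h' {1::nat} (\<lambda>_. 1) (\<lambda>_. s \<otimes> h)" by (rule lin_cong[OF 3(3)]) simp_all
  then have "h' = s \<otimes> h" by (rule lin_unique[OF _ lin_single]) (use h3 s hk c in simp_all)
  ultimately show ?thesis using 3(1) s unfolding coexist_def by auto
qed

lemma scalar_swap:
  assumes "hom s I0 I0" "ok f" "ok g" shows "f \<otimes> (s \<otimes> g) = s \<otimes> (f \<otimes> g)"
  using tens_assoc[of f s g] tens_assoc[of s f g] scalar_comm[of s f] assms by simp

lemma Pure_unscale: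
  assumes p: "Pure (s \<otimes> x)" and s: "hom s I0 I0" "pr s \<noteq> 0" and x: "ok x" shows "Pure x"
  unfolding Pure_def
proof (intro conjI allI impI)
  fix g h assume g: "coexist g h" "add x g h"
  note ty = add_type[OF g(2)]
  have 1: "add (s \<otimes> x) (s \<otimes> g) (s \<otimes> h)" using g(2) s by (intro add_tensL) simp_all
  have 2: "coexist (s \<otimes> g) (s \<otimes> h)" using g(1) ty s by (intro coexist_scalar) simp_all
  obtain r where r: "hom r I0 I0" "s \<otimes> g = r \<otimes> (s \<otimes> x)" using PureD[OF p 2 1] by blast
  have "s \<otimes> g = s \<otimes> (r \<otimes> x)" using r(2) scalar_swap[of s r x] s r(1) x by simp
  then have "g = r \<otimes> x" by (rule scalar_cancel[OF s, rotated 2]) (use r ty x in simp_all)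
  then show "\<exists>s. hom s I0 I0 \<and> g = s \<otimes> x" using r(1) by blast
qed (use x in simp)

lemma Pure_scalar:
  assumes s: "hom s I0 I0" "pr s \<noteq> 0" shows "Pure s"
  unfolding Pure_def
proof (intro conjI allI impI)
  fix g h assume g: "coexist g h" "add s g h"
  have ty: "hom g I0 I0" "hom h I0 I0" using add_type[OF g(2)] s by simp_all
  have "pr s = pr g + pr h" using add_pr0[OF g(2)] s by simp
  then have "0 \<le> pr g / pr s" "pr g / pr s \<le> 1"
    using pr_bounds(1)[OF ty(1)] pr_bounds(1)[OF ty(2)] pr_bounds(1)[OF s(1)] s(2) by (auto simp: divide_le_eq_1)
  note c = scal[OF this]
  have "g = scal (pr g / pr s) \<otimes> s" by (rule scalar_ext) (use c ty s in simp_all)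
  then show "\<exists>r. hom r I0 I0 \<and> g = r \<otimes> s" using c(1-3) by blast
qed (use s in simp)

text \<open>The normalised version of \<open>x\<close> occurs in \<open>c\<close> with positive
  weight because \<open>c\<close> is internal.\<close>

lemma uniform_pos:
  assumes c: "uniform c A" and a: "hom a A I0" and x: "hom x I0 A" "pr (a \<odot> x) \<noteq> 0" shows "0 < pr (a \<odot> c)"
proof -
  obtain y where y: "nst y A" "x = (Dis A \<odot> x) \<otimes> y" using normalise[OF x(1)] by blast
  have s: "hom (Dis A \<odot> x) I0 I0" using x by simp
  have "pr (a \<odot> x) = pr (Dis A \<odot> x) * pr (a \<odot> y)"
    using pr_scal[OF s nst_hom[OF y(1)] a] y(2) by simp
  then have ay: "0 < pr (a \<odot> y)" using x(2) prob_bounds(1)[OF a y(1)] by (cases "pr (a \<odot> y) = 0") auto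
  obtain p where p: "internal p c A" using c by (auto simp: uniform_def)
  then have w: "weight p y c A" "0 < p" "p < 1" using y(1) by (simp_all add: internal_def)
  obtain t where t: "nst t A" "\<forall>a. hom a A I0 \<longrightarrow> pr (a \<odot> c) = p * pr (a \<odot> y) + (1 - p) * pr (a \<odot> t)"
    using w(1) by (rule weightE)
  have "0 \<le> (1 - p) * pr (a \<odot> t)" using w prob_bounds(1)[OF a t(1)] by simp
  moreover have "0 < p * pr (a \<odot> y)" using w ay by simp
  ultimately show ?thesis using t(2) a by simp
qed

lemma uniform_zero:
  assumes "uniform c A" "hom a A I0" "pr (a \<odot> c) = 0" "hom x I0 A" shows "pr (a \<odot> x) = 0"
  using uniform_pos[OF assms(1,2,4)] assms(3) by linarith

section \<open>The common weight of all pure states in the invariant state\<close>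

lemma joint_le:
  assumes "hom a A I0" "hom b B I0" "hom P I0 (A \<boxdot> B)"
  shows "0 \<le> pr ((a \<otimes> b) \<odot> P)" "pr ((a \<otimes> b) \<odot> P) \<le> pr ((Dis A \<otimes> b) \<odot> P)" "pr ((a \<otimes> b) \<odot> P) \<le> pr ((a \<otimes> Dis B) \<odot> P)"
proof -
  show "0 \<le> pr ((a \<otimes> b) \<odot> P)" using assms by (intro pr_bounds) simp
  show "pr ((a \<otimes> b) \<odot> P) \<le> pr ((Dis A \<otimes> b) \<odot> P)"
    using eff_act[of a A b B P] eff_act[of "Dis A" A b B P] pr_effect_le[of a A "(idn A \<otimes> b) \<odot> P"] assms by simp
  show "pr ((a \<otimes> b) \<odot> P) \<le> pr ((a \<otimes> Dis B) \<odot> P)"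
    using eff_act'[of a A b B P] eff_act'[of a A "Dis B" B P] pr_effect_le[of b B "(a \<otimes> idn B) \<odot> P"] assms by simp
qed

lemma purif_joint:
  assumes P: "purif P c A Q" and a: "hom a A I0" shows "pr ((a \<otimes> Dis Q) \<odot> P) = pr (a \<odot> c)"
proof -
  have "(idn A \<otimes> Dis Q) \<odot> P = c" using P by (simp add: purif_def)
  then show ?thesis using eff_act[OF a _ purif_hom[OF P], of "Dis Q"] by simp
qed

lemma sharpD: "sharp f x A \<Longrightarrow> hom f A I0 \<and> Pure f \<and> pst x A \<and> hom x I0 A \<and> pr (f \<odot> x) = 1"
  unfolding sharp_def using nst_hom[of x A] by blast

text \<open>The pure effect \<open>f\<close> steers the purifying system to a pure state whose sharp effect steers back to
  a pure component of \<open>c\<close>; all pure states have the same weights in \<open>c\<close> because they form one orbit.\<close>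

lemma dual_weight_bounds:
  assumes c: "uniform c A" and P: "purif P c A Q" and f: "sharp f x A"
  obtains y s where "pst y Q" "hom s I0 I0" "pr s = pr (f \<odot> c)" "0 < pr s" "(f \<otimes> idn Q) \<odot> P = s \<otimes> y"
    "\<forall>b. sharp b y Q \<longrightarrow> (\<exists>r z. hom r I0 I0 \<and> pst z A \<and> (idn A \<otimes> b) \<odot> P = r \<otimes> z \<and> pr s \<le> pr r \<and>
      (\<forall>g w. sharp g w A \<longrightarrow> pr r \<le> pr (g \<odot> c)))"
proof -
  note F = sharpD[OF f]
  have hP: "hom P I0 (A \<boxdot> Q)" and pP: "Pure P" using purif_hom[OF P] P by (simp_all add: purif_def)
  let ?w = "(f \<otimes> idn Q) \<odot> P"
  have hw: "hom ?w I0 Q" using hP F by simp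
  obtain y where y: "nst y Q" "?w = (Dis Q \<odot> ?w) \<otimes> y" using normalise[OF hw] by blast
  let ?s = "Dis Q \<odot> ?w"
  have s: "hom ?s I0 I0" using hw by simp
  have "?s = (f \<otimes> Dis Q) \<odot> P" using eff_act'[of f A "Dis Q" Q P] F hP by simp
  then have sc: "pr ?s = pr (f \<odot> c)" using purif_joint[OF P, of f] F by simp
  have pos: "0 < pr ?s" unfolding sc by (rule uniform_pos[OF c, of f x]) (use F in simp_all)
  have "Pure ?w" using F pP hP by (intro Pure_cmp Pure_tens Pure_idn) simp_all
  then have Py: "Pure y" using y pos nst_hom[OF y(1)] by (intro Pure_unscale[of ?s y] s) simp_all
  have *: "\<exists>r z. hom r I0 I0 \<and> pst z A \<and> (idn A \<otimes> b) \<odot> P = r \<otimes> z \<and> pr ?s \<le> pr r \<and>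
      (\<forall>g w. sharp g w A \<longrightarrow> pr r \<le> pr (g \<odot> c))" if b: "sharp b y Q" for b
  proof -
    note B = sharpD[OF b]
    let ?v = "(idn A \<otimes> b) \<odot> P"
    have hv: "hom ?v I0 A" using hP B by simp
    obtain z where z: "nst z A" "?v = (Dis A \<odot> ?v) \<otimes> z" using normalise[OF hv] by blast
    let ?r = "Dis A \<odot> ?v"
    have r: "hom ?r I0 I0" using hv by simp
    have rb: "?r = (Dis A \<otimes> b) \<odot> P" using eff_act[of "Dis A" A b Q P] B hP by simp
    have "pr ((f \<otimes> b) \<odot> P) = pr (b \<odot> (?s \<otimes> y))" using eff_act'[of f A b Q P] F B hP y(2) by simp
    also have "\<dots> = pr ?s" using pr_scal[OF s nst_hom[OF y(1)], of b] B by simp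
    finally have sr: "pr ?s \<le> pr ?r" unfolding rb using joint_le(2)[of f A b Q P] F B hP by simp
    have "Pure ?v" using B pP hP by (intro Pure_cmp Pure_tens Pure_idn) simp_all
    then have Pz: "Pure z" using z pos sr nst_hom[OF z(1)] by (intro Pure_unscale[of ?r z] r) simp_all
    have "pr ?r \<le> pr (g \<odot> c)" if g: "sharp g w A" for g w
    proof -
      note G = sharpD[OF g]
      obtain U where U: "invertible U A A" "w = U \<odot> z" using pure_transitive[of z A w] z Pz G by blast
      note u = invertible_chan[OF U(1)]
      have gU: "hom (g \<odot> U) A I0" using G u by simp
      have "U \<odot> c = c" using c U(1) by (simp add: uniform_def)
      then have "pr (g \<odot> c) = pr ((g \<odot> U) \<odot> c)" using G u nst_hom[OF uniform_nst[OF c]] by simp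
      also have "\<dots> = pr (((g \<odot> U) \<otimes> Dis Q) \<odot> P)" using purif_joint[OF P gU] by simp
      also have "\<dots> \<ge> pr (((g \<odot> U) \<otimes> b) \<odot> P)" by (rule joint_le(3)) (use gU B hP in simp_all)
      also have "((g \<odot> U) \<otimes> b) \<odot> P = (g \<odot> U) \<odot> (?r \<otimes> z)" using eff_act[of "g \<odot> U" A b Q P] gU B hP z(2) by simp
      also have "pr \<dots> = pr ?r * pr ((g \<odot> U) \<odot> z)" by (rule pr_scal[OF r nst_hom[OF z(1)] gU])
      also have "(g \<odot> U) \<odot> z = g \<odot> w" using U(2) G u nst_hom[OF z(1)] by simp
      finally show ?thesis using G by simp
    qed
    then show ?thesis using r z Pz sr by blast
  qed
  show thesis
    by (rule that[of y ?s]) (use y Py s sc pos * in blast)+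
qed

text \<open>The weight of the state that is steered back separates the two values. Since
  \<open>f\<close> and \<open>g\<close> may be exchanged, all sharp effects have the same
  probability on \<open>c\<close>.\<close>

lemma sharp_value_le:
  assumes c: "uniform c A" and f: "sharp f x A" and g: "sharp g w A" shows "pr (f \<odot> c) \<le> pr (g \<odot> c)"
proof -
  obtain P Q where P: "purif P c A Q" using uniform_purif[OF c] by blast
  obtain y s where y: "pst y Q" "pr s = pr (f \<odot> c)"
    "\<forall>b. sharp b y Q \<longrightarrow> (\<exists>r z. hom r I0 I0 \<and> pst z A \<and> (idn A \<otimes> b) \<odot> P = r \<otimes> z \<and> pr s \<le> pr r \<and>
      (\<forall>g w. sharp g w A \<longrightarrow> pr r \<le> pr (g \<odot> c)))"
    by (rule dual_weight_bounds[OF c P f])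
  obtain b where b: "sharp b y Q" using sharp_exists[OF y(1)] by blast
  then show ?thesis using y(2,3) g by force
qed

text \<open>Well defined because all sharp effects agree on \<open>c\<close>. By
  \<open>frame_decomposition\<close> it is the reciprocal of the number of perfectly distinguishable
  states in a frame.\<close>

definition max_weight :: "('a, 'b) arrow \<Rightarrow> 'a \<Rightarrow> real"
  where "max_weight c A = (THE l. \<exists>f x. sharp f x A \<and> l = pr (f \<odot> c))"

lemma max_weight: assumes "uniform c A" "sharp f x A" shows "pr (f \<odot> c) = max_weight c A"
proof -
  have "max_weight c A = pr (f \<odot> c)" unfolding max_weight_def
  proof (rule the_equality)
    show "\<exists>g x. sharp g x A \<and> pr (f \<odot> c) = pr (g \<odot> c)" using assms by blast
    fix l assume "\<exists>g x. sharp g x A \<and> l = pr (g \<odot> c)"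
    then obtain g x' where "sharp g x' A" "l = pr (g \<odot> c)" by blast
    then show "l = pr (f \<odot> c)" using sharp_value_le[OF assms(1)] assms(2) by (meson antisym)
  qed
  then show ?thesis by simp
qed

lemma max_weight_bounds: assumes "uniform c A" shows "0 < max_weight c A" "max_weight c A \<le> 1"
proof -
  obtain x where x: "pst x A" using pst_exists by blast
  obtain f where f: "sharp f x A" using sharp_exists[OF x] by blast
  note F = sharpD[OF f]
  show "0 < max_weight c A" unfolding max_weight[OF assms f, symmetric] by (rule uniform_pos[OF assms, of f x]) (use F in simp_all)
  show "max_weight c A \<le> 1" unfolding max_weight[OF assms f, symmetric] using prob_bounds[of f A c] F uniform_nst[OF assms] by blast
qed

text \<open>As all sharp effects have the same value, the inequalities of
  \<open>dual_weight_bounds\<close> become equalities. Then \<open>f\<close> is certain on the state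
  \<open>z\<close> that is steered back, and \<open>ident_unique\<close> identifies \<open>z\<close>
  with \<open>x\<close>.\<close>

lemma dual:
  assumes c: "uniform c A" and P: "purif P c A Q" and f: "sharp f x A"
  obtains y where "pst y Q" "(f \<otimes> idn Q) \<odot> P = scal (max_weight c A) \<otimes> y"
    "\<forall>b. sharp b y Q \<longrightarrow> (idn A \<otimes> b) \<odot> P = scal (max_weight c A) \<otimes> x"
proof -
  note F = sharpD[OF f]
  have hP: "hom P I0 (A \<boxdot> Q)" by (rule purif_hom[OF P])
  obtain y s where y: "pst y Q" "hom s I0 I0" "pr s = pr (f \<odot> c)" "0 < pr s" "(f \<otimes> idn Q) \<odot> P = s \<otimes> y"
    "\<forall>b. sharp b y Q \<longrightarrow> (\<exists>r z. hom r I0 I0 \<and> pst z A \<and> (idn A \<otimes> b) \<odot> P = r \<otimes> z \<and> pr s \<le> pr r \<and>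
      (\<forall>g w. sharp g w A \<longrightarrow> pr r \<le> pr (g \<odot> c)))"
    by (rule dual_weight_bounds[OF c P f])
  have l: "hom (scal (max_weight c A)) I0 I0" "pr (scal (max_weight c A)) = max_weight c A"
    using scal[of "max_weight c A"] max_weight_bounds[OF c] by simp_all
  have s: "s = scal (max_weight c A)" by (rule scalar_ext) (use y(2,3) l max_weight[OF c f] in simp_all)
  have hy: "hom y I0 Q" using y nst_hom by blast
  have *: "(idn A \<otimes> b) \<odot> P = scal (max_weight c A) \<otimes> x" if b: "sharp b y Q" for b
  proof -
    note B = sharpD[OF b]
    from y(6) b have "\<exists>r z. hom r I0 I0 \<and> pst z A \<and> (idn A \<otimes> b) \<odot> P = r \<otimes> z \<and> pr s \<le> pr r \<and>
      (\<forall>g w. sharp g w A \<longrightarrow> pr r \<le> pr (g \<odot> c))" by blast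
    then obtain r z where r: "hom r I0 I0" "pst z A" "(idn A \<otimes> b) \<odot> P = r \<otimes> z" "pr s \<le> pr r"
      "\<forall>g w. sharp g w A \<longrightarrow> pr r \<le> pr (g \<odot> c)" by (elim exE) (rule that; blast)
    have "pr r \<le> pr (f \<odot> c)" using r(5) f by blast
    then have "pr r = pr s" using r(4) y(3) by simp
    then have rs: "r = s" using r(1) y(2) by (intro scalar_ext) simp_all
    have hz: "hom z I0 A" using r(2) nst_hom by blast
    have "pr ((f \<otimes> b) \<odot> P) = pr (b \<odot> (s \<otimes> y))" using eff_act'[of f A b Q P] F B hP y(5) by simp
    also have "\<dots> = pr s" using pr_scal[OF y(2) hy, of b] B by simp
    finally have "pr (f \<odot> (s \<otimes> z)) = pr s" using eff_act[of f A b Q P] F B hP r(3) rs by simp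
    then have "pr (f \<odot> z) = 1" using pr_scal[OF y(2) hz, of f] F y(4) by simp
    then have "z = x" using F r(2) by (intro ident_unique[of f A]) simp_all
    then show ?thesis using r(3) rs s by simp
  qed
  show thesis by (rule that[of y]) (use y(1,5) s * in blast)+
qed

lemma uniform_prob: "uniform c A \<Longrightarrow> hom a A I0 \<Longrightarrow> 0 \<le> pr (a \<odot> c) \<and> pr (a \<odot> c) \<le> 1"
  using prob_bounds[of a A c] uniform_nst[of c A] by blast

text \<open>Write \<open>a\<close> as the deterministic effect after a pure transformation \<open>t\<close> and test the pure state \<open>t \<odot> x\<close> sharply.\<close>

lemma sharp_split:
  assumes a: "hom a A I0" and x: "pst x A" and 1: "pr (a \<odot> x) = 1"
  obtains b r where "sharp b x A" "hom r A I0" "\<forall>y. hom y I0 A \<longrightarrow> pr (a \<odot> y) = pr (b \<odot> y) + pr (r \<odot> y)"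
proof -
  obtain c where c: "uniform c A" using uniform_exists by blast
  obtain P Q where P: "purif P c A Q" using uniform_purif[OF c] by blast
  define X where "X = Sw A Q \<odot> P"
  have X: "pst X (Q \<boxdot> A)" "(Dis Q \<otimes> idn A) \<odot> X = c" "hom X I0 (Q \<boxdot> A)"
    using purif_flip[OF P] by (simp_all add: X_def)
  have hx: "hom x I0 A" using x nst_hom by blast
  obtain a' where a': "hom a' A I0" "add (Dis A) a a'" using complement_effect[OF a] by blast
  let ?w = "(idn Q \<otimes> a) \<odot> X" and ?w' = "(idn Q \<otimes> a') \<odot> X"
  have hw: "hom ?w I0 Q" "hom ?w' I0 Q" using X a a' by simp_all
  obtain v where v: "nst v Q" "?w = (Dis Q \<odot> ?w) \<otimes> v" using normalise[OF hw(1)] by blast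
  obtain v' where v': "nst v' Q" "?w' = (Dis Q \<odot> ?w') \<otimes> v'" using normalise[OF hw(2)] by blast
  let ?s = "Dis Q \<odot> ?w" and ?s' = "Dis Q \<odot> ?w'"
  have s: "hom ?s I0 I0" "hom ?s' I0 I0" using hw by simp_all
  define p where "p = pr ?s"
  have "pr (Dis Q \<odot> ((idn Q \<otimes> Dis A) \<odot> X)) = pr ?s + pr ?s'"
    by (rule add_st[OF add_cmpR[OF add_tensL[OF a'(2)]]]) (use X in simp_all)
  moreover have "Dis Q \<odot> ((idn Q \<otimes> Dis A) \<odot> X) = idn I0" using X(1) by simp
  ultimately have p': "pr ?s' = 1 - p" by (simp add: p_def)
  have "?s = (Dis Q \<otimes> a) \<odot> X" using eff_act[of "Dis Q" Q a A X] X a by simp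
  also have "\<dots> = a \<odot> c" using eff_act'[of "Dis Q" Q a A X] X a by simp
  finally have "p = pr (a \<odot> c)" by (simp add: p_def)
  then have p: "0 < p" "p \<le> 1" using uniform_pos[OF c a hx] 1 uniform_prob[OF c a] by simp_all
  \<comment> \<open>The effect \<open>a\<close> steers \<open>Q\<close> to \<open>v\<close>. The
    transformation sought is the one that steers to a purification of \<open>v\<close> instead:
    discarding its output gives back \<open>a\<close>.\<close>
  obtain Y W where W: "pst W (Q \<boxdot> Y)" "(idn Q \<otimes> Dis Y) \<odot> W = v" using purify[OF v(1)] by blast
  have hW: "hom W I0 (Q \<boxdot> Y)" using W nst_hom by blast
  obtain y where y: "nst y Y" using nst_exists by blast
  have vy: "nst (v' \<otimes> y) (Q \<boxdot> Y)" using v'(1) y by simp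
  have mvy: "(idn Q \<otimes> Dis Y) \<odot> (v' \<otimes> y) = v'"
    using exch[of v' "idn Q" y "Dis Y"] nst_hom[OF v'(1)] nst_hom[OF y] y by simp
  have m: "pr (e \<odot> ((idn Q \<otimes> Dis A) \<odot> X)) =
      p * pr (e \<odot> ((idn Q \<otimes> Dis Y) \<odot> W)) + (1 - p) * pr (e \<odot> ((idn Q \<otimes> Dis Y) \<odot> (v' \<otimes> y)))"
    if e: "hom e Q I0" for e
  proof -
    have "pr (e \<odot> ((idn Q \<otimes> Dis A) \<odot> X)) = pr (e \<odot> ?w) + pr (e \<odot> ?w')"
      by (rule add_st[OF add_cmpR[OF add_tensL[OF a'(2)]]]) (use X e in simp_all)
    also have "pr (e \<odot> ?w) = p * pr (e \<odot> v)"
      using pr_scal[OF s(1) nst_hom[OF v(1)] e] v(2) by (simp add: p_def)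
    also have "pr (e \<odot> ?w') = (1 - p) * pr (e \<odot> v')"
      using pr_scal[OF s(2) nst_hom[OF v'(1)] e] v'(2) p' by simp
    finally show ?thesis unfolding W(2) mvy .
  qed
  have W1: "nst W (Q \<boxdot> Y)" using W by simp
  obtain u t where u: "hom u I0 I0" "pr u = p" and t: "hom t A Y" "(idn Q \<otimes> t) \<odot> X = u \<otimes> W"
    by (rule steer_ensemble[OF X(1) W1 vy _ p(2) m]) (use p in simp)
  have us: "u = ?s" by (rule scalar_ext) (use u s in \<open>simp_all add: p_def\<close>)
  have ta: "Dis Y \<odot> t = a"
  proof (rule faithfulL[OF c P])
    have "(idn Q \<otimes> (Dis Y \<odot> t)) \<odot> X = (idn Q \<otimes> Dis Y) \<odot> ((idn Q \<otimes> t) \<odot> X)"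
      by (rule idn_act) (use X t in simp_all)
    also have "\<dots> = u \<otimes> ((idn Q \<otimes> Dis Y) \<odot> W)"
      unfolding t(2) by (rule cmp_effL) (use u hW in simp_all)
    also have "\<dots> = (idn Q \<otimes> a) \<odot> X" unfolding W(2) us using v(2) by simp
    finally show "(idn Q \<otimes> (Dis Y \<odot> t)) \<odot> (Sw A Q \<odot> P) = (idn Q \<otimes> a) \<odot> (Sw A Q \<odot> P)" by (simp only: X_def)
  qed (use t a in simp_all)
  have Pu: "Pure (u \<otimes> W)" by (rule Pure_tens[OF Pure_scalar[OF u(1)]]) (use u p W in simp_all)
  \<comment> \<open>Purity is read off from the steered state: a decomposition of \<open>t\<close>
    decomposes a multiple of the pure state \<open>W\<close>, and faithfulness transfers the
    conclusion back.\<close>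
  have Pt: "Pure t"
    unfolding Pure_def
  proof (intro conjI allI impI)
    fix g h assume g: "coexist g h" "add t g h"
    have ty: "hom g A Y" "hom h A Y" using add_type[OF g(2)] t by simp_all
    have 1: "add ((idn Q \<otimes> t) \<odot> X) ((idn Q \<otimes> g) \<odot> X) ((idn Q \<otimes> h) \<odot> X)"
      by (rule add_cmpR[OF add_tensL[OF g(2)]]) (use X t in simp_all)
    have 2: "coexist ((idn Q \<otimes> g) \<odot> X) ((idn Q \<otimes> h) \<odot> X)"
      by (rule coexist_cmpR[OF coexist_tensL[OF g(1)]]) (use X ty in simp_all)
    obtain r where r: "hom r I0 I0" "(idn Q \<otimes> g) \<odot> X = r \<otimes> (u \<otimes> W)" using PureD[OF Pu 2] 1 t(2) by auto
    have "g = r \<otimes> t"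
    proof (rule faithfulL[OF c P])
      have "(idn Q \<otimes> (r \<otimes> t)) \<odot> X = (r \<otimes> (idn Q \<otimes> t)) \<odot> X" using scalar_swap[of r "idn Q" t] r t by simp
      also have "\<dots> = r \<otimes> ((idn Q \<otimes> t) \<odot> X)" by (rule cmp_stL) (use r t X in simp_all)
      also have "\<dots> = (idn Q \<otimes> g) \<odot> X" using t(2) r(2) by simp
      finally show "(idn Q \<otimes> g) \<odot> (Sw A Q \<odot> P) = (idn Q \<otimes> (r \<otimes> t)) \<odot> (Sw A Q \<odot> P)" by (simp only: X_def)
    qed (use r t ty in simp_all)
    then show "\<exists>s. hom s I0 I0 \<and> g = s \<otimes> t" using r(1) by blast
  qed (use t in simp)
  have htx: "hom (t \<odot> x) I0 Y" using t hx by simp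
  have at: "Dis Y \<odot> (t \<odot> z) = a \<odot> z" if "hom z I0 A" for z
    using cmp_assoc[of z t "Dis Y"] ta t that by simp
  have "Dis Y \<odot> (t \<odot> x) = idn I0"
    unfolding at[OF hx] by (rule scalar_ext) (use 1 a hx in simp_all)
  then have "chan (t \<odot> x)" using chanI[of "t \<odot> x"] htx t hx by simp
  then have ptx: "pst (t \<odot> x) Y" using htx Pure_cmp[OF _ Pt, of x] x t by simp
  obtain g where g: "sharp g (t \<odot> x) Y" using sharp_exists[OF ptx] by blast
  note G = sharpD[OF g]
  obtain g' where g': "hom g' Y I0" "add (Dis Y) g g'" using complement_effect[of g Y] G by blast
  show thesis
  proof (rule that[of "g \<odot> t" "g' \<odot> t"])
    have "Pure (g \<odot> t)" using G Pt t by (intro Pure_cmp) simp_all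
    then show "sharp (g \<odot> t) x A" unfolding sharp_def using G t x hx by simp
    show "hom (g' \<odot> t) A I0" using g' t by simp
    show "\<forall>y. hom y I0 A \<longrightarrow> pr (a \<odot> y) = pr ((g \<odot> t) \<odot> y) + pr ((g' \<odot> t) \<odot> y)"
    proof (intro allI impI)
      fix y assume y: "hom y I0 A"
      have "pr (Dis Y \<odot> (t \<odot> y)) = pr (g \<odot> (t \<odot> y)) + pr (g' \<odot> (t \<odot> y))"
        by (rule add_eff[OF g'(2)]) (use t y in simp_all)
      then show "pr (a \<odot> y) = pr ((g \<odot> t) \<odot> y) + pr ((g' \<odot> t) \<odot> y)"
        unfolding at[OF y] using G g' t y by simp
    qed
  qed
qed

text \<open>The state \<open>c\<close> minus \<open>max_weight c A\<close> times the orthogonal states \<open>x i\<close> is positive, being steered by an effect \<open>r\<close>.\<close>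

lemma orthogonal_remainder:
  assumes c: "uniform c A" and P: "purif P c A Q" and I: "finite I"
    and f: "\<And>i. i \<in> I \<Longrightarrow> sharp (f i) (x i) A"
    and o: "\<And>i j. i \<in> I \<Longrightarrow> j \<in> I \<Longrightarrow> i \<noteq> j \<Longrightarrow> pr (f i \<odot> x j) = 0"
  shows "\<exists>r. hom r Q I0 \<and> (\<forall>a. hom a A I0 \<longrightarrow>
    pr ((a \<otimes> r) \<odot> P) = pr (a \<odot> c) - max_weight c A * (\<Sum>i\<in>I. pr (a \<odot> x i)))"
  using I f o
proof (induction I rule: finite_induct)
  case empty
  show ?case using purif_joint[OF P] by (intro exI[of _ "Dis Q"]) simp
next
  case (insert i I)
  have hP: "hom P I0 (A \<boxdot> Q)" by (rule purif_hom[OF P])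
  let ?l = "max_weight c A"
  note l = max_weight_bounds[OF c]
  have sl: "hom (scal ?l) I0 I0" "pr (scal ?l) = ?l" using scal[of ?l] l by simp_all
  have "\<exists>r. hom r Q I0 \<and> (\<forall>a. hom a A I0 \<longrightarrow>
    pr ((a \<otimes> r) \<odot> P) = pr (a \<odot> c) - ?l * (\<Sum>i\<in>I. pr (a \<odot> x i)))"
    by (rule insert.IH) (use insert.prems in simp_all)
  then obtain r where r: "hom r Q I0"
    "\<And>a. hom a A I0 \<Longrightarrow> pr ((a \<otimes> r) \<odot> P) = pr (a \<odot> c) - ?l * (\<Sum>i\<in>I. pr (a \<odot> x i))" by blast
  have fi: "sharp (f i) (x i) A" using insert.prems(1) by simp
  note F = sharpD[OF fi]
  obtain y where y: "pst y Q" "(f i \<otimes> idn Q) \<odot> P = scal ?l \<otimes> y"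
    "\<forall>b. sharp b y Q \<longrightarrow> (idn A \<otimes> b) \<odot> P = scal ?l \<otimes> x i"
    by (rule dual[OF c P fi])
  have hy: "hom y I0 Q" using y nst_hom by blast
  \<comment> \<open>By orthogonality the earlier states take nothing from the weight that
    \<open>f i\<close> sees. Hence \<open>r\<close> is certain on the dual \<open>y\<close> of
    \<open>x i\<close>, and the sharp effect \<open>b\<close> of \<open>y\<close> can be split off
    from it.\<close>
  have "(\<Sum>j\<in>I. pr (f i \<odot> x j)) = 0"
    using insert.prems(2)[of i] insert.hyps by (intro sum.neutral) auto
  then have "pr ((f i \<otimes> r) \<odot> P) = ?l" using r(2)[of "f i"] F max_weight[OF c fi] by simp
  moreover have "pr ((f i \<otimes> r) \<odot> P) = ?l * pr (r \<odot> y)"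
    using eff_act'[of "f i" A r Q P] F r(1) hP y(2) pr_scal[OF sl(1) hy r(1)] sl(2) by simp
  ultimately have "pr (r \<odot> y) = 1" using l by simp
  then obtain b r' where b: "sharp b y Q" "hom r' Q I0"
    "\<forall>z. hom z I0 Q \<longrightarrow> pr (r \<odot> z) = pr (b \<odot> z) + pr (r' \<odot> z)" using sharp_split[OF r(1) y(1)] by blast
  note B = sharpD[OF b(1)]
  have bP: "(idn A \<otimes> b) \<odot> P = scal ?l \<otimes> x i" using y(3) b(1) by blast
  have "pr ((a \<otimes> r') \<odot> P) = pr (a \<odot> c) - ?l * (\<Sum>i\<in>insert i I. pr (a \<odot> x i))" if a: "hom a A I0" for a
  proof -
    let ?z = "(a \<otimes> idn Q) \<odot> P"
    have "hom ?z I0 Q" using a hP by simp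
    then have "pr (r \<odot> ?z) = pr (b \<odot> ?z) + pr (r' \<odot> ?z)" using b(3) by blast
    then have 1: "pr ((a \<otimes> r) \<odot> P) = pr ((a \<otimes> b) \<odot> P) + pr ((a \<otimes> r') \<odot> P)"
      using eff_act'[of a A r Q P] eff_act'[of a A b Q P] eff_act'[of a A r' Q P] a r(1) b(2) B hP by simp
    have "pr ((a \<otimes> b) \<odot> P) = ?l * pr (a \<odot> x i)"
      using eff_act[of a A b Q P] a B hP bP pr_scal[OF sl(1) _ a, of "x i"] F sl(2) by simp
    then show ?thesis using 1 r(2)[OF a] insert.hyps by (simp add: algebra_simps)
  qed
  then show ?case using b(2) by blast
qed

section \<open>Frames of perfectly distinguishable pure states\<close>

lemma sharp_orthogonal:
  assumes "finite I" "i \<in> I" "\<And>i. i \<in> I \<Longrightarrow> sharp (f i) (x i) A" "\<And>i. i \<in> I \<Longrightarrow> hom (f i) A I0"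
    "\<And>y. hom y I0 A \<Longrightarrow> (\<Sum>i\<in>I. pr (f i \<odot> y)) \<le> pr (Dis A \<odot> y)" "nst y A" "pr (f i \<odot> y) = 1" "j \<in> I" "j \<noteq> i"
  shows "pr (f j \<odot> y) = 0"
proof -
  have hy: "hom y I0 A" by (rule nst_hom[OF assms(6)])
  have n: "0 \<le> pr (f k \<odot> y)" if "k \<in> I" for k using prob_bounds(1)[OF assms(4)[OF that] assms(6)] .
  have "pr (f j \<odot> y) \<le> (\<Sum>k\<in>I - {i}. pr (f k \<odot> y))"
    by (rule member_le_sum) (use assms(1,8,9) n in auto)
  moreover have "(\<Sum>k\<in>I. pr (f k \<odot> y)) = pr (f i \<odot> y) + (\<Sum>k\<in>I - {i}. pr (f k \<odot> y))"
    by (rule sum.remove[OF assms(1,2)])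
  moreover have "(\<Sum>k\<in>I. pr (f k \<odot> y)) \<le> 1" using assms(5)[OF hy] assms(6) by simp
  ultimately show ?thesis using assms(7) n[OF assms(8)] by linarith
qed

text \<open>A complete measurement by sharp effects together with the pure states that they
  identify, the analogue of an orthonormal basis.\<close>

definition frame :: "'i set \<Rightarrow> ('i \<Rightarrow> ('a, 'b) arrow) \<Rightarrow> ('i \<Rightarrow> ('a, 'b) arrow) \<Rightarrow> 'a \<Rightarrow> bool"
  where "frame I f x A \<longleftrightarrow> finite I \<and> (\<forall>i\<in>I. sharp (f i) (x i) A) \<and>
    (\<forall>y. hom y I0 A \<longrightarrow> pr (Dis A \<odot> y) = (\<Sum>i\<in>I. pr (f i \<odot> y)))"

text \<open>All sharp effects have the same value on \<open>c\<close> and these values add up to 1.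
  So subtracting the equally weighted states \<open>x i\<close> from \<open>c\<close> leaves a
  positive remainder of total weight 0.\<close>

lemma frame_decomposition:
  assumes c: "uniform c A" and F: "frame I f x A"
  shows "max_weight c A * real (card I) = 1" "\<And>a. hom a A I0 \<Longrightarrow> pr (a \<odot> c) = max_weight c A * (\<Sum>i\<in>I. pr (a \<odot> x i))"
proof -
  have fin: "finite I" and sh: "\<And>i. i \<in> I \<Longrightarrow> sharp (f i) (x i) A"
    and tot: "\<And>y. hom y I0 A \<Longrightarrow> pr (Dis A \<odot> y) = (\<Sum>i\<in>I. pr (f i \<odot> y))" using F by (simp_all add: frame_def)
  obtain P Q where P: "purif P c A Q" using uniform_purif[OF c] by blast
  have hP: "hom P I0 (A \<boxdot> Q)" by (rule purif_hom[OF P])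
  have hc: "hom c I0 A" and nc: "nst c A" using uniform_nst[OF c] nst_hom by blast+
  have "(\<Sum>i\<in>I. pr (f i \<odot> c)) = (\<Sum>i\<in>I. max_weight c A)" by (intro sum.cong refl max_weight[OF c sh])
  then show L: "max_weight c A * real (card I) = 1" using tot[OF hc] nc by (simp add: mult.commute)
  have o: "pr (f i \<odot> x j) = 0" if ij: "i \<in> I" "j \<in> I" "i \<noteq> j" for i j
  proof (rule sharp_orthogonal[OF fin ij(2) sh, of "\<lambda>k. k", OF _ _ _ _ _ ij(1,3)])
    show "hom (f k) A I0" if "k \<in> I" for k using sharpD[OF sh[OF that]] by blast
    show "nst (x j) A" "pr (f j \<odot> x j) = 1" using sharpD[OF sh[OF ij(2)]] by blast+
  qed (use tot in simp_all)
  obtain r where r: "hom r Q I0"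
    "\<And>a. hom a A I0 \<Longrightarrow> pr ((a \<otimes> r) \<odot> P) = pr (a \<odot> c) - max_weight c A * (\<Sum>i\<in>I. pr (a \<odot> x i))"
    using orthogonal_remainder[where f = f and x = x, OF c P fin sh o] by blast
  have "(\<Sum>i\<in>I. pr (Dis A \<odot> x i)) = (\<Sum>i\<in>I. 1)"
  proof (intro sum.cong refl)
    fix i assume "i \<in> I"
    then show "pr (Dis A \<odot> x i) = 1" using sharpD[OF sh[of i]] by simp
  qed
  then have 0: "pr ((Dis A \<otimes> r) \<odot> P) = 0" using r(2)[of "Dis A"] L nc by simp
  fix a assume a: "hom a A I0"
  show "pr (a \<odot> c) = max_weight c A * (\<Sum>i\<in>I. pr (a \<odot> x i))"
    using r(2)[OF a] 0 joint_le(1,2)[OF a r(1) hP] by linarith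
qed

text \<open>Greedy construction. Let \<open>a\<close> be the part of the deterministic effect not
  yet covered. It is certain on the normalised remainder \<open>t\<close> of \<open>c\<close>, hence
  on some pure state, which together with its sharp effect extends the family. Each step consumes
  the weight \<open>max_weight c A\<close>, so the process stops.\<close>

lemma frame_exists:
  obtains n :: nat and f x where "frame {..<n} f x A"
proof -
  obtain c where c: "uniform c A" using uniform_exists by blast
  let ?l = "max_weight c A"
  note l = max_weight_bounds[OF c]
  obtain P Q where P: "purif P c A Q" using uniform_purif[OF c] by blast
  have hP: "hom P I0 (A \<boxdot> Q)" by (rule purif_hom[OF P])
  have hc: "hom c I0 A" and nc: "nst c A" using uniform_nst[OF c] nst_hom by blast+
  define G where "G n f x a \<longleftrightarrow> (\<forall>i<n. sharp (f i) (x i) A) \<and> hom a A I0 \<and>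
    (\<forall>y. hom y I0 A \<longrightarrow> pr (Dis A \<odot> y) = (\<Sum>i<n. pr (f i \<odot> y)) + pr (a \<odot> y))" for n :: nat and f x a
  have step: "real n * ?l \<le> 1 \<and> ((\<forall>y. hom y I0 A \<longrightarrow> pr (a \<odot> y) = 0) \<or> (\<exists>f x a. G (Suc n) f x a))"
    if g: "G n f x a" for n f x a
  proof -
    have sh: "\<And>i. i \<in> {..<n} \<Longrightarrow> sharp (f i) (x i) A" and a: "hom a A I0"
      and tot: "\<And>y. hom y I0 A \<Longrightarrow> pr (Dis A \<odot> y) = (\<Sum>i<n. pr (f i \<odot> y)) + pr (a \<odot> y)"
      using g by (simp_all add: G_def)
    have S: "hom (f i) A I0" "nst (x i) A" "hom (x i) I0 A" "pr (f i \<odot> x i) = 1" if "i \<in> {..<n}" for i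
      using sharpD[OF sh[OF that]] by blast+
    have a0: "0 \<le> pr (a \<odot> y)" if "hom y I0 A" for y using a that by (intro pr_bounds) simp
    have sub: "(\<Sum>i\<in>{..<n}. pr (f i \<odot> y)) \<le> pr (Dis A \<odot> y)" if "hom y I0 A" for y
      using tot[OF that] a0[OF that] by simp
    have o: "pr (f i \<odot> x j) = 0" if ij: "i \<in> {..<n}" "j \<in> {..<n}" "i \<noteq> j" for i j
      by (rule sharp_orthogonal[OF _ ij(2) sh S(1) sub S(2)[OF ij(2)] S(4)[OF ij(2)] ij(1,3)]) simp
    obtain r where r: "hom r Q I0"
      "\<And>a. hom a A I0 \<Longrightarrow> pr ((a \<otimes> r) \<odot> P) = pr (a \<odot> c) - ?l * (\<Sum>i<n. pr (a \<odot> x i))"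
      using orthogonal_remainder[where f = f and x = x, OF c P _ sh o] by blast
    have "(\<Sum>i<n. pr (Dis A \<odot> x i)) = (\<Sum>i<n. 1)"
    proof (intro sum.cong refl)
      fix i assume "i \<in> {..<n}"
      then show "pr (Dis A \<odot> x i) = 1" using S(2)[of i] by simp
    qed
    then have D: "pr ((Dis A \<otimes> r) \<odot> P) = 1 - real n * ?l" using r(2)[of "Dis A"] nc by simp
    have n1: "real n * ?l \<le> 1" using D joint_le(1)[of "Dis A" A r Q P] r(1) hP by simp
    have ax: "pr (a \<odot> x i) = 0" if i: "i \<in> {..<n}" for i
    proof -
      have "pr (f i \<odot> x i) \<le> (\<Sum>k<n. pr (f k \<odot> x i))"
        by (rule member_le_sum[OF i]) (use prob_bounds(1)[OF S(1) S(2)[OF i]] in auto)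
      then show ?thesis using tot[OF S(3)[OF i]] S(2,4)[OF i] a0[OF S(3)[OF i]] by simp
    qed
    have ac: "pr (a \<odot> c) = 1 - real n * ?l"
    proof -
      have "(\<Sum>i<n. pr (f i \<odot> c)) = (\<Sum>i<n. ?l)" by (intro sum.cong refl max_weight[OF c sh])
      then show ?thesis using tot[OF hc] nc by simp
    qed
    show ?thesis
    proof (cases "real n * ?l < 1")
      case False
      then have "pr (a \<odot> c) = 0" using ac n1 by simp
      then show ?thesis using n1 uniform_zero[OF c a] by blast
    next
      case True
      let ?w = "(idn A \<otimes> r) \<odot> P"
      have hw: "hom ?w I0 A" using hP r by simp
      obtain t where t: "nst t A" "?w = (Dis A \<odot> ?w) \<otimes> t" using normalise[OF hw] by blast
      let ?s = "Dis A \<odot> ?w"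
      have s: "hom ?s I0 I0" using hw by simp
      have "?s = (Dis A \<otimes> r) \<odot> P" using eff_act[of "Dis A" A r Q P] r hP by simp
      then have s1: "pr ?s = 1 - real n * ?l" using D by simp
      have "pr ((a \<otimes> r) \<odot> P) = pr (a \<odot> c)" using r(2)[OF a] ax by simp
      moreover have "pr ((a \<otimes> r) \<odot> P) = pr ?s * pr (a \<odot> t)"
        using eff_act[of a A r Q P] a r hP t(2) pr_scal[OF s nst_hom[OF t(1)] a] by simp
      ultimately have "pr (a \<odot> t) = 1" using s1 ac True by simp
      then obtain d where d: "pst d A" "1 \<le> pr (a \<odot> d)" using pure_attains[OF a t(1)] by auto
      then have d1: "pr (a \<odot> d) = 1" using prob_bounds(2)[OF a, of d] by simp
      obtain b r' where b: "sharp b d A" "hom r' A I0"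
        "\<forall>y. hom y I0 A \<longrightarrow> pr (a \<odot> y) = pr (b \<odot> y) + pr (r' \<odot> y)" using sharp_split[OF a d(1) d1] by blast
      have "G (Suc n) (f(n := b)) (x(n := d)) r'"
        unfolding G_def using sh b(1,2) b(3) tot by (auto simp: less_Suc_eq)
      then show ?thesis using n1 by blast
    qed
  qed
  define R where "R n \<longleftrightarrow> (\<exists>f x a. G n f x a)" for n
  \<comment> \<open>The families are irrelevant for length 0, so identities serve as
    placeholders.\<close>
  have "G 0 (\<lambda>_. idn A) (\<lambda>_. idn A) (Dis A)" by (simp add: G_def)
  then have R0: "R 0" unfolding R_def by blast
  have bound: "n \<le> nat \<lceil>1 / ?l\<rceil>" if "R n" for n
  proof -
    have "real n * ?l \<le> 1" using that step unfolding R_def by blast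
    then have "real n \<le> 1 / ?l" using l by (simp add: pos_le_divide_eq)
    then show ?thesis by linarith
  qed
  define N where "N = (GREATEST n. R n)"
  have RN: "R N" unfolding N_def by (rule GreatestI_nat[of R 0, OF R0]) (use bound in blast)
  have nRN: "\<not> R (Suc N)"
  proof
    assume "R (Suc N)"
    then have "Suc N \<le> N" unfolding N_def by (rule Greatest_le_nat[of R]) (use bound in blast)
    then show False by simp
  qed
  obtain f x a where g: "G N f x a" using RN unfolding R_def by blast
  have z: "\<forall>y. hom y I0 A \<longrightarrow> pr (a \<odot> y) = 0" using step[OF g] nRN unfolding R_def by blast
  have "frame {..<N} f x A" unfolding frame_def using g z by (simp add: G_def)
  then show thesis by (rule that)
qed

text \<open>An invariant \<open>d\<close> need not be internal a priori, but its equal mixture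
  \<open>z\<close> with \<open>c\<close> is invariant and internal. Both \<open>z\<close> and
  \<open>c\<close> are the uniform mixture over the same frame, so they coincide, and so does
  \<open>d\<close>.\<close>

lemma uniform_unique:
  assumes c: "uniform c A" and d: "nst d A" "\<And>U. invertible U A A \<Longrightarrow> U \<odot> d = d" shows "d = c"
proof -
  have nc: "nst c A" by (rule uniform_nst[OF c])
  have hc: "hom c I0 A" and hd: "hom d I0 A" using nst_hom[OF nc] nst_hom[OF d(1)] by blast+
  obtain z where z: "nst z A" "\<forall>a. hom a A I0 \<longrightarrow> pr (a \<odot> z) = 1/2 * pr (a \<odot> c) + (1 - 1/2) * pr (a \<odot> d)"
    using binary_mixture_exists[OF nc d(1), of "1/2"] by auto
  have hz: "hom z I0 A" by (rule nst_hom[OF z(1)])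
  obtain p where p: "internal p c A" using c by (auto simp: uniform_def)
  then have p01: "0 < p" "p < 1" by (simp_all add: internal_def)
  have "weight (p / 2) w z A" if w: "nst w A" for w
  proof -
    have "weight p w c A" using p w by (simp add: internal_def)
    then obtain t where t: "nst t A" "\<forall>a. hom a A I0 \<longrightarrow> pr (a \<odot> c) = p * pr (a \<odot> w) + (1 - p) * pr (a \<odot> t)"
      by (rule weightE)
    \<comment> \<open>Chosen so that the remainder of \<open>z\<close> after removing
      \<open>p / 2\<close> times \<open>w\<close> has weight \<open>(1 - p) / 2\<close> on
      \<open>t\<close> and \<open>1 / 2\<close> on \<open>d\<close>.\<close>
    define q where "q = (1 - p) / (2 - p)"
    have q: "0 \<le> q" "q \<le> 1" "(2 - p) * q = 1 - p" using p01 by (simp_all add: q_def)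
    obtain v where v: "nst v A" "\<forall>a. hom a A I0 \<longrightarrow> pr (a \<odot> v) = q * pr (a \<odot> t) + (1 - q) * pr (a \<odot> d)"
      using binary_mixture_exists[OF t(1) d(1) q(1,2)] by blast
    show ?thesis
    proof (rule weightI[OF v(1)])
      fix a assume a: "hom a A I0"
      have key: "(1 - p / 2) * (q * T + (1 - q) * D) = 1/2 * (1 - p) * T + 1/2 * D" for T D
      proof -
        have "(1 - p / 2) * (q * T + (1 - q) * D) = 1/2 * ((2 - p) * q) * T + 1/2 * ((2 - p) - (2 - p) * q) * D"
          by (simp add: algebra_simps)
        then show ?thesis unfolding q(3) by simp
      qed
      show "pr (a \<odot> z) = p / 2 * pr (a \<odot> w) + (1 - p / 2) * pr (a \<odot> v)"
        unfolding z(2)[rule_format, OF a] t(2)[rule_format, OF a] v(2)[rule_format, OF a] key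
        by (simp add: field_simps)
    qed
  qed
  then have iz: "internal (p / 2) z A" using z(1) p01 by (simp add: internal_def)
  have "U \<odot> z = z" if U: "invertible U A A" for U
  proof (rule state_ext[of _ A])
    note u = invertible_chan[OF U]
    fix a assume a: "hom a A I0"
    have "hom (a \<odot> U) A I0" using a u by simp
    then have "pr ((a \<odot> U) \<odot> z) = 1/2 * pr ((a \<odot> U) \<odot> c) + (1 - 1/2) * pr ((a \<odot> U) \<odot> d)" using z(2) by blast
    moreover have "U \<odot> c = c" using c U by (simp add: uniform_def)
    ultimately show "pr (a \<odot> (U \<odot> z)) = pr (a \<odot> z)"
      using z(2)[rule_format, OF a] a u hc hd hz d(2)[OF U] by simp
  qed (use invertible_chan[OF U] hz in simp_all)
  then have uz: "uniform z A" using iz unfolding uniform_def by blast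
  obtain n :: nat and f x where F: "frame {..<n} f x A" using frame_exists by blast
  note C = frame_decomposition[OF c F] and Z = frame_decomposition[OF uz F]
  have "max_weight c A = max_weight z A" using C(1) Z(1) by (metis mult_cancel_right mult_zero_right zero_neq_one)
  then have e: "pr (a \<odot> c) = pr (a \<odot> z)" if "hom a A I0" for a using C(2)[OF that] Z(2)[OF that] by simp
  show ?thesis
  proof (rule state_ext[OF hd hc])
    fix a assume a: "hom a A I0"
    show "pr (a \<odot> d) = pr (a \<odot> c)" using e[OF a] z(2)[rule_format, OF a] by simp
  qed
qed

lemma uniform_tens:
  assumes c: "uniform c A" and d: "uniform d B" and e: "uniform e (A \<boxdot> B)" shows "e = c \<otimes> d"
proof -
  obtain n :: nat and f x where F: "frame {..<n} f x A" using frame_exists by blast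
  obtain m :: nat and g y where G: "frame {..<m} g y B" using frame_exists by blast
  have shF: "\<And>i. i \<in> {..<n} \<Longrightarrow> sharp (f i) (x i) A" and shG: "\<And>j. j \<in> {..<m} \<Longrightarrow> sharp (g j) (y j) B"
    using F G by (simp_all add: frame_def)
  have SF: "hom (f i) A I0" "Pure (f i)" "pst (x i) A" "hom (x i) I0 A" "pr (f i \<odot> x i) = 1" if "i \<in> {..<n}" for i
    using sharpD[OF shF[OF that]] by blast+
  have SG: "hom (g j) B I0" "Pure (g j)" "pst (y j) B" "hom (y j) I0 B" "pr (g j \<odot> y j) = 1" if "j \<in> {..<m}" for j
    using sharpD[OF shG[OF that]] by blast+
  let ?I = "{..<n} \<times> {..<m}"
  have fr: "frame ?I (\<lambda>(i, j). f i \<otimes> g j) (\<lambda>(i, j). x i \<otimes> y j) (A \<boxdot> B)"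
    unfolding frame_def
  proof (intro conjI allI impI ballI)
    fix k assume "k \<in> ?I"
    then obtain i j where k: "k = (i, j)" "i \<in> {..<n}" "j \<in> {..<m}" by auto
    note s = SF[OF k(2)] SG[OF k(3)]
    have "pr ((f i \<otimes> g j) \<odot> (x i \<otimes> y j)) = 1" using exch[of "x i" "f i" "y j" "g j"] s by simp
    then have "sharp (f i \<otimes> g j) (x i \<otimes> y j) (A \<boxdot> B)"
      unfolding sharp_def using s pst_tens[OF s(3) s(8)] Pure_tens[OF s(2) s(7)] by simp
    then show "sharp (case k of (i, j) \<Rightarrow> f i \<otimes> g j) (case k of (i, j) \<Rightarrow> x i \<otimes> y j) (A \<boxdot> B)" using k(1) by simp
  next
    fix w assume w: "hom w I0 (A \<boxdot> B)"
    have 1: "(\<Sum>i<n. pr ((f i \<otimes> g j) \<odot> w)) = pr (g j \<odot> ((Dis A \<otimes> idn B) \<odot> w))" if j: "j \<in> {..<m}" for j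
    proof -
      note s = SG[OF j]
      have hv: "hom ((idn A \<otimes> g j) \<odot> w) I0 A" using w s by simp
      have "(\<Sum>i<n. pr ((f i \<otimes> g j) \<odot> w)) = (\<Sum>i<n. pr (f i \<odot> ((idn A \<otimes> g j) \<odot> w)))"
        by (intro sum.cong refl) (use eff_act[OF SF(1) s(1) w] in simp)
      also have "\<dots> = pr (Dis A \<odot> ((idn A \<otimes> g j) \<odot> w))" using F hv by (simp add: frame_def)
      also have "Dis A \<odot> ((idn A \<otimes> g j) \<odot> w) = g j \<odot> ((Dis A \<otimes> idn B) \<odot> w)"
        using eff_act[of "Dis A" A "g j" B w] eff_act'[of "Dis A" A "g j" B w] s w by simp
      finally show ?thesis .
    qed
    have hv: "hom ((Dis A \<otimes> idn B) \<odot> w) I0 B" using w by simp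
    have "(\<Sum>k\<in>?I. pr ((case k of (i, j) \<Rightarrow> f i \<otimes> g j) \<odot> w)) = (\<Sum>i<n. \<Sum>j<m. pr ((f i \<otimes> g j) \<odot> w))"
      by (subst sum.cartesian_product) (simp add: case_prod_beta)
    also have "\<dots> = (\<Sum>j<m. \<Sum>i<n. pr ((f i \<otimes> g j) \<odot> w))" by (rule sum.swap)
    also have "\<dots> = (\<Sum>j<m. pr (g j \<odot> ((Dis A \<otimes> idn B) \<odot> w)))" by (intro sum.cong refl 1)
    also have "\<dots> = pr (Dis B \<odot> ((Dis A \<otimes> idn B) \<odot> w))" using G hv by (simp add: frame_def)
    also have "Dis B \<odot> ((Dis A \<otimes> idn B) \<odot> w) = Dis (A \<boxdot> B) \<odot> w"
      using eff_act'[of "Dis A" A "Dis B" B w] w by (simp add: Dis_tens)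
    finally show "pr (Dis (A \<boxdot> B) \<odot> w) = (\<Sum>k\<in>?I. pr ((case k of (i, j) \<Rightarrow> f i \<otimes> g j) \<odot> w))" by simp
  qed simp
  note C = frame_decomposition[OF c F] and D = frame_decomposition[OF d G] and E = frame_decomposition[OF e fr]
  have hc: "hom c I0 A" and hd: "hom d I0 B" and he: "hom e I0 (A \<boxdot> B)"
    using nst_hom[OF uniform_nst[OF c]] nst_hom[OF uniform_nst[OF d]] nst_hom[OF uniform_nst[OF e]] by blast+
  have l: "max_weight e (A \<boxdot> B) = max_weight c A * max_weight d B"
  proof -
    have "max_weight e (A \<boxdot> B) * (real n * real m) = 1" using E(1) by simp
    moreover have "(max_weight c A * max_weight d B) * (real n * real m) = (max_weight c A * real n) * (max_weight d B * real m)"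
      by (simp only: mult_ac)
    moreover have "max_weight c A * real n = 1" "max_weight d B * real m = 1" using C(1) D(1) by simp_all
    ultimately have 1: "(max_weight c A * max_weight d B) * (real n * real m) = 1" "max_weight e (A \<boxdot> B) * (real n * real m) = 1" by simp_all
    then have "real n * real m \<noteq> 0" by (metis mult_zero_right zero_neq_one)
    then show ?thesis using 1 by (metis mult_right_cancel)
  qed
  show ?thesis
  proof (rule state_ext[OF he])
    fix a assume a: "hom a (A \<boxdot> B) I0"
    have a1: "hom (a \<odot> (idn A \<otimes> d)) A I0" using a hd by simp
    have cd: "c \<otimes> d = (idn A \<otimes> d) \<odot> c" using cmp_stR[of c "idn A" d] hc hd by simp
    have "pr (a \<odot> (c \<otimes> d)) = pr ((a \<odot> (idn A \<otimes> d)) \<odot> c)" unfolding cd using a hc hd by simp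
    also have "\<dots> = max_weight c A * (\<Sum>i<n. pr ((a \<odot> (idn A \<otimes> d)) \<odot> x i))" by (rule C(2)[OF a1])
    also have "(\<Sum>i<n. pr ((a \<odot> (idn A \<otimes> d)) \<odot> x i)) = (\<Sum>i<n. max_weight d B * (\<Sum>j<m. pr (a \<odot> (x i \<otimes> y j))))"
    proof (intro sum.cong refl)
      fix i assume i: "i \<in> {..<n}"
      note s = SF[OF i]
      have a2: "hom (a \<odot> (x i \<otimes> idn B)) B I0" using a s by simp
      have "(idn A \<otimes> d) \<odot> x i = (x i \<otimes> idn B) \<odot> d"
        using cmp_stR[of "x i" "idn A" d] cmp_stL[of d "idn B" "x i"] s hd by simp
      then have "pr ((a \<odot> (idn A \<otimes> d)) \<odot> x i) = pr ((a \<odot> (x i \<otimes> idn B)) \<odot> d)" using a s hd by simp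
      also have "\<dots> = max_weight d B * (\<Sum>j<m. pr ((a \<odot> (x i \<otimes> idn B)) \<odot> y j))" by (rule D(2)[OF a2])
      also have "(\<Sum>j<m. pr ((a \<odot> (x i \<otimes> idn B)) \<odot> y j)) = (\<Sum>j<m. pr (a \<odot> (x i \<otimes> y j)))"
      proof (intro sum.cong refl)
        fix j assume j: "j \<in> {..<m}"
        show "pr ((a \<odot> (x i \<otimes> idn B)) \<odot> y j) = pr (a \<odot> (x i \<otimes> y j))"
          using cmp_stL[of "y j" "idn B" "x i"] a s SG[OF j] by simp
      qed
      finally show "pr ((a \<odot> (idn A \<otimes> d)) \<odot> x i) = max_weight d B * (\<Sum>j<m. pr (a \<odot> (x i \<otimes> y j)))" .
    qed
    also have "max_weight c A * (\<Sum>i<n. max_weight d B * (\<Sum>j<m. pr (a \<odot> (x i \<otimes> y j)))) =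
        max_weight e (A \<boxdot> B) * (\<Sum>i<n. \<Sum>j<m. pr (a \<odot> (x i \<otimes> y j)))"
      unfolding l by (simp add: sum_distrib_left mult.assoc)
    also have "(\<Sum>i<n. \<Sum>j<m. pr (a \<odot> (x i \<otimes> y j))) = (\<Sum>k\<in>?I. pr (a \<odot> (case k of (i, j) \<Rightarrow> x i \<otimes> y j)))"
      by (subst sum.cartesian_product) (simp add: case_prod_beta)
    also have "max_weight e (A \<boxdot> B) * \<dots> = pr (a \<odot> e)" using E(2)[OF a] by simp
    finally show "pr (a \<odot> e) = pr (a \<odot> (c \<otimes> d))" by simp
  qed (use hc hd in simp)
qed

section \<open>Controlled reversible channels\<close>

text \<open>Applying \<open>C\<close> to one half of the faithful state does not change the marginal
  on \<open>Q\<close>. So the result is steered from the faithful state by a dilated channel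
  \<open>D\<close>, and faithfulness turns equality on this state into equality of channels.
  \<open>D\<close> is pure because identities are.\<close>

lemma dilation:
  assumes C: "chan C" "src C = A" "tgt C = B"
  obtains Z D where "chan D" "src D = A" "tgt D = B \<boxdot> Z" "Pure D" "(idn B \<otimes> Dis Z) \<odot> D = C"
proof -
  obtain c where c: "uniform c A" using uniform_exists by blast
  obtain P Q where P: "purif P c A Q" using uniform_purif[OF c] by blast
  note X = purif_flip[OF P]
  let ?X = "Sw A Q \<odot> P"
  have okC: "ok C" by (rule chan_ok[OF C(1)])
  have r: "nst ((idn Q \<otimes> C) \<odot> ?X) (Q \<boxdot> B)" using X(1) C by simp
  have "(idn Q \<otimes> Dis B) \<odot> ((idn Q \<otimes> C) \<odot> ?X) = (idn Q \<otimes> (Dis B \<odot> C)) \<odot> ?X"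
    by (rule idn_act[symmetric]) (use C okC X(3) in simp_all)
  then have m: "(idn Q \<otimes> Dis A) \<odot> ?X = (idn Q \<otimes> Dis B) \<odot> ((idn Q \<otimes> C) \<odot> ?X)" using C by simp
  show thesis
  proof (rule steer_dilation[OF X(1) r m])
    fix Z D assume D: "chan D" "src D = A" "tgt D = B \<boxdot> Z"
      "(idn Q \<otimes> ((idn B \<otimes> Dis Z) \<odot> D)) \<odot> ?X = (idn Q \<otimes> C) \<odot> ?X" and p: "Pure (idn A) \<Longrightarrow> Pure D"
    have "(idn B \<otimes> Dis Z) \<odot> D = C"
      by (rule faithfulL[OF c P _ _ D(4)]) (use C okC D chan_ok[OF D(1)] in simp_all)
    then show thesis using that[OF D(1-3) p[OF Pure_idn]] by blast
  qed
qed

text \<open>The analogue of \<open>factor\<close> for channels, obtained by applying it to the image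
  of the faithful state.\<close>

lemma factor_channel:
  assumes L: "chan L" "src L = A" "tgt L = B \<boxdot> Y" and V: "(idn B \<otimes> Dis Y) \<odot> L = V" "Pure V"
  obtains y where "nst y Y" "L = V \<otimes> y"
proof -
  obtain c where c: "uniform c A" using uniform_exists by blast
  obtain P Q where P: "purif P c A Q" using uniform_purif[OF c] by blast
  note X = purif_flip[OF P]
  let ?X = "Sw A Q \<odot> P"
  have okL: "ok L" by (rule chan_ok[OF L(1)])
  have hV: "hom V A B" using V Pure_ok[OF V(2)] L by auto
  let ?W = "(idn Q \<otimes> L) \<odot> ?X"
  have W: "nst ?W ((Q \<boxdot> B) \<boxdot> Y)" using X(1) L by simp
  have "(idn (Q \<boxdot> B) \<otimes> Dis Y) \<odot> ?W = (idn Q \<otimes> (idn B \<otimes> Dis Y)) \<odot> ?W"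
    using tens_assoc[of "idn Q" "idn B" "Dis Y"] by simp
  also have "\<dots> = (idn Q \<otimes> ((idn B \<otimes> Dis Y) \<odot> L)) \<odot> ?X"
    by (rule idn_act[symmetric]) (use L okL X(3) in simp_all)
  finally have m: "(idn (Q \<boxdot> B) \<otimes> Dis Y) \<odot> ?W = (idn Q \<otimes> V) \<odot> ?X" using V(1) by simp
  have "Pure ((idn Q \<otimes> V) \<odot> ?X)"
    by (rule Pure_cmp[OF _ Pure_tens[OF Pure_idn V(2)]]) (use X(1) hV in simp_all)
  then obtain y where y: "nst y Y" "?W = ((idn Q \<otimes> V) \<odot> ?X) \<otimes> y" using factor[OF W] unfolding m by blast
  have hy: "hom y I0 Y" by (rule nst_hom[OF y(1)])
  have "L = V \<otimes> y"
  proof (rule faithfulL[OF c P])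
    have "(idn Q \<otimes> (V \<otimes> y)) \<odot> ?X = ((idn Q \<otimes> V) \<otimes> y) \<odot> ?X" using hV hy by simp
    also have "\<dots> = ((idn Q \<otimes> V) \<odot> ?X) \<otimes> y" by (rule cmp_stR) (use hV hy X(3) in simp_all)
    finally show "(idn Q \<otimes> L) \<odot> ?X = (idn Q \<otimes> (V \<otimes> y)) \<odot> ?X" using y(2) by simp
  qed (use L okL hV hy in simp_all)
  then show thesis using that y(1) by blast
qed

text \<open>\<open>purify_iso\<close> with the shared system on the right and the padding states
  written as operations on the unpadded purifications, the form to which \<open>faithful\<close> can
  be applied.\<close>

lemma purify_isoR:
  assumes P: "pst P (A \<boxdot> Q)" and R: "pst R (B \<boxdot> Q)"
    and m: "(Dis A \<otimes> idn Q) \<odot> P = (Dis B \<otimes> idn Q) \<odot> R" and x: "pst x B" and y: "pst y A"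
  obtains U where "invertible U (A \<boxdot> B) (B \<boxdot> A)"
    "(idn B \<otimes> (y \<otimes> idn Q)) \<odot> R = ((U \<odot> (idn A \<otimes> x)) \<otimes> idn Q) \<odot> P"
proof -
  have hP: "hom P I0 (A \<boxdot> Q)" and hR: "hom R I0 (B \<boxdot> Q)" and hx: "hom x I0 B" and hy: "hom y I0 A"
    using P R x y nst_hom by blast+
  let ?P = "Sw A Q \<odot> P" and ?R = "Sw B Q \<odot> R"
  have P': "pst ?P (Q \<boxdot> A)" by (rule pst_invertible[OF P invertible_Sw])
  have R': "pst ?R (Q \<boxdot> B)" by (rule pst_invertible[OF R invertible_Sw])
  have "(idn Q \<otimes> Dis A) \<odot> ?P = (idn Q \<otimes> Dis B) \<odot> ?R"
    using Sw_act[of "Dis A" "idn Q" P] Sw_act[of "Dis B" "idn Q" R] hP hR m by simp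
  from purify_iso[OF P' R' this x y] obtain U where
    U: "invertible U (A \<boxdot> B) (B \<boxdot> A)" "?R \<otimes> y = (idn Q \<otimes> U) \<odot> (?P \<otimes> x)" by blast
  note u = invertible_chan[OF U(1)]
  have mv: "Sw Q (D \<boxdot> E) \<odot> ((Sw D Q \<odot> w) \<otimes> z) = (idn D \<otimes> (z \<otimes> idn Q)) \<odot> w"
    if w: "hom w I0 (D \<boxdot> Q)" and z: "hom z I0 E" for w z D E
  proof -
    have "Sw Q (D \<boxdot> E) \<odot> ((Sw D Q \<odot> w) \<otimes> z) = (idn D \<otimes> Sw Q E) \<odot> ((Sw Q D \<otimes> idn E) \<odot> ((Sw D Q \<odot> w) \<otimes> z))"
      unfolding Sw_comp using w z by (subst cmp_assoc) simp_all
    also have "(Sw Q D \<otimes> idn E) \<odot> ((Sw D Q \<odot> w) \<otimes> z) = w \<otimes> z"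
      using exch[of "Sw D Q \<odot> w" "Sw Q D" z "idn E"] w z by simp
    also have "w \<otimes> z = (idn D \<otimes> (idn Q \<otimes> z)) \<odot> w"
      using cmp_stR[of w "idn (D \<boxdot> Q)" z] tens_assoc[of "idn D" "idn Q" z] w z by simp
    also have "(idn D \<otimes> Sw Q E) \<odot> ((idn D \<otimes> (idn Q \<otimes> z)) \<odot> w) = (idn D \<otimes> (Sw Q E \<odot> (idn Q \<otimes> z))) \<odot> w"
      by (rule idn_act[symmetric]) (use w z in simp_all)
    also have "Sw Q E \<odot> (idn Q \<otimes> z) = z \<otimes> idn Q"
      using Sw_nat[of "idn Q" z] z by simp
    finally show ?thesis .
  qed
  have "(idn B \<otimes> (y \<otimes> idn Q)) \<odot> R = Sw Q (B \<boxdot> A) \<odot> ((idn Q \<otimes> U) \<odot> (?P \<otimes> x))"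
    unfolding U(2)[symmetric] by (rule mv[OF hR hy, symmetric])
  also have "\<dots> = (U \<otimes> idn Q) \<odot> (Sw Q (A \<boxdot> B) \<odot> (?P \<otimes> x))"
    using Sw_act[of "idn Q" U "?P \<otimes> x"] u hP hx by simp
  also have "Sw Q (A \<boxdot> B) \<odot> (?P \<otimes> x) = (idn A \<otimes> (x \<otimes> idn Q)) \<odot> P" by (rule mv[OF hP hx])
  also have "(U \<otimes> idn Q) \<odot> ((idn A \<otimes> (x \<otimes> idn Q)) \<odot> P) = ((U \<odot> (idn A \<otimes> x)) \<otimes> idn Q) \<odot> P"
    using act_idn[of P "idn A \<otimes> x" U Q] tens_assoc[of "idn A" x "idn Q"] u hP hx by simp
  finally show thesis by (rule that[OF U(1)])
qed

section \<open>Cancellation and effects that are certain on the invariant state\<close>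

lemma add_zero:
  assumes "add f g (h \<otimes> s)" "hom s I0 I0" "pr s = 0" "ok h" shows "f = g"
proof (rule ap_ext)
  note ty = add_type[OF assms(1)]
  fix S x E assume x: "hom x I0 (src f \<boxdot> S)" "hom E (tgt f \<boxdot> S) I0"
  have "src f = src h" "tgt f = tgt h" using ty assms(2) by simp_all
  then have "ap S E (s \<otimes> h) x = 0" using ap_scalar[OF assms(2,4), of x S E] x assms(3) by simp
  then show "ap S E f x = ap S E g x" using add_ap[OF assms(1) x] scalar_comm[of s h] assms(2,4) by simp
qed (use add_type[OF assms(1)] in simp_all)

lemma add_commute: "add f g h \<Longrightarrow> add f h g"
  unfolding add_iff by (simp add: add.commute)

lemma tens_cancel_left:
  assumes b: "nst b B" and y: "hom y I0 Y" "hom z I0 Y" and e: "b \<otimes> y = b \<otimes> z" shows "y = z"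
proof -
  have hb: "hom b I0 B" by (rule nst_hom[OF b])
  have r: "(Dis B \<otimes> idn Y) \<odot> (b \<otimes> w) = w" if "hom w I0 Y" for w
    using exch[of b "Dis B" w "idn Y"] b hb that by simp
  have "y = (Dis B \<otimes> idn Y) \<odot> (b \<otimes> y)" by (rule r[OF y(1), symmetric])
  also have "\<dots> = z" unfolding e by (rule r[OF y(2)])
  finally show ?thesis .
qed

lemma uniform_tens_ex: assumes "uniform c A" "uniform d B" shows "uniform (c \<otimes> d) (A \<boxdot> B)"
proof -
  obtain e where "uniform e (A \<boxdot> B)" using uniform_exists by blast
  then show ?thesis using uniform_tens[OF assms] by metis
qed

text \<open>The complementary effect vanishes on \<open>c\<close>, hence on every state, because
  \<open>c\<close> contains every state.\<close>

lemma one_effect: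
  assumes c: "uniform c A" and e: "hom e A I0" and 1: "pr (e \<odot> c) = 1" shows "e = Dis A"
proof -
  obtain e' where e': "hom e' A I0" "add (Dis A) e e'" using complement_effect[OF e] by blast
  have nc: "nst c A" by (rule uniform_nst[OF c])
  have "pr (Dis A \<odot> c) = pr (e \<odot> c) + pr (e' \<odot> c)" by (rule add_eff[OF e'(2)]) (use nst_hom[OF nc] in simp_all)
  then have 0: "pr (e' \<odot> c) = 0" using 1 nc by simp
  show ?thesis
  proof (rule effect_ext[OF e])
    fix x assume x: "hom x I0 A"
    have "pr (Dis A \<odot> x) = pr (e \<odot> x) + pr (e' \<odot> x)" by (rule add_eff[OF e'(2)]) (use x in simp_all)
    then show "pr (e \<odot> x) = pr (Dis A \<odot> x)" using uniform_zero[OF c e'(1) 0 x] by simp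
  qed simp
qed

text \<open>A pure dilation of the channel that applies \<open>V\<close> if \<open>f\<close> occurs and nothing otherwise copies the control into
  its environment. Feeding the fixed point \<open>b\<close> of \<open>V\<close> exhibits this copy as a pure channel on \<open>F\<close>,
  which can be undone reversibly; what remains is the coherently controlled \<open>V\<close>.\<close>

lemma controlled:
  assumes f: "sharp f x F" and c: "uniform c F" and x': "nst x' F" "pr (f \<odot> x') = 0"
    and l: "\<And>a. hom a F I0 \<Longrightarrow> pr (a \<odot> c) = l * pr (a \<odot> x) + (1 - l) * pr (a \<odot> x')"
    and V: "invertible V B B" and b: "pst b B" and Vb: "V \<odot> b = b"
  obtains W where "invertible W (B \<boxdot> F) (B \<boxdot> F)" "W \<odot> (idn B \<otimes> x) = V \<otimes> x" "W \<odot> (idn B \<otimes> x') = idn B \<otimes> x'"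
proof -
  note sf = sharpD[OF f]
  note v = invertible_chan[OF V]
  have hx: "hom x I0 F" and hx': "hom x' I0 F" and hc: "hom c I0 F" and nc: "nst c F" and hb: "hom b I0 B" and nb: "nst b B"
    using sf nst_hom[OF x'(1)] uniform_nst[OF c] nst_hom[OF uniform_nst[OF c]] b nst_hom[of b B] by blast+
  obtain f' where f': "hom f' F I0" "arrow_test F I0 [f, f']" "add (Dis F) f f'" using complement_effect[of f F] sf by blast
  have hf: "hom f F I0" using sf by blast
  have sum1: "pr (f \<odot> w) + pr (f' \<odot> w) = 1" if w: "nst w F" for w
  proof -
    have "pr (Dis F \<odot> w) = pr (f \<odot> w) + pr (f' \<odot> w)" by (rule add_eff[OF f'(3)]) (use nst_hom[OF w] in simp_all)
    then show ?thesis using w by simp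
  qed
  have fx: "f \<odot> x = idn I0" by (rule scalar_ext) (use sf hx in simp_all)
  have f'x: "pr (f' \<odot> x) = 0" using sum1[of x] sf by simp
  have f'x': "f' \<odot> x' = idn I0" by (rule scalar_ext) (use sum1[OF x'(1)] x'(2) f' hx' in simp_all)
  have t1: "arrow_test (B \<boxdot> F) B [idn B \<otimes> f, idn B \<otimes> f']" using arrow_test_tensL[OF f'(2), of "idn B"] by simp
  have "arrow_test B B Ds" if "Ds \<in> set [[V], [idn B]]" for Ds using that v by (auto simp: arrow_test_chan)
  then have "arrow_test (B \<boxdot> F) B (concat (map (\<lambda>(F, Ds). map (\<lambda>D. D \<odot> F) Ds) (zip [idn B \<otimes> f, idn B \<otimes> f'] [[V], [idn B]])))"
    by (intro arrow_test_cond[OF t1]) simp_all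
  then have "arrow_test (B \<boxdot> F) B [V \<otimes> f, idn B \<otimes> f']" using v hf f' cmp_effR[of "idn B" V f] by simp
  then obtain C where C: "chan C" "src C = B \<boxdot> F" "tgt C = B" "add C (V \<otimes> f) (idn B \<otimes> f')" by (rule arrow_test_sum2)
  have okC: "ok C" by (rule chan_ok[OF C(1)])
  have Ck: "add (C \<odot> (idn B \<otimes> k)) (V \<otimes> (f \<odot> k)) (idn B \<otimes> (f' \<odot> k))" if k: "hom k I0 F" for k
  proof -
    have "add (C \<odot> (idn B \<otimes> k)) ((V \<otimes> f) \<odot> (idn B \<otimes> k)) ((idn B \<otimes> f') \<odot> (idn B \<otimes> k))"
      by (rule add_cmpR[OF C(4)]) (use C k in simp_all)
    then show ?thesis using exch[of "idn B" V k f] exch[of "idn B" "idn B" k f'] v hf f'(1) k by simp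
  qed
  have Cx: "C \<odot> (idn B \<otimes> x) = V"
  proof -
    have "add (C \<odot> (idn B \<otimes> x)) V (idn B \<otimes> (f' \<odot> x))" using Ck[OF hx] fx v by simp
    then show ?thesis by (rule add_zero) (use f'x f' hx in simp_all)
  qed
  have Cx': "C \<odot> (idn B \<otimes> x') = idn B"
  proof -
    have "add (C \<odot> (idn B \<otimes> x')) (idn B) (V \<otimes> (f \<odot> x'))" using add_commute[OF Ck[OF hx']] f'x' by simp
    then show ?thesis by (rule add_zero) (use x'(2) hf hx' v in simp_all)
  qed
  have Cc: "C \<odot> (b \<otimes> c) = b"
  proof (rule state_ext[of _ B])
    fix a assume a: "hom a B I0"
    have "add ((C \<odot> (idn B \<otimes> c)) \<odot> b) ((V \<otimes> (f \<odot> c)) \<odot> b) ((idn B \<otimes> (f' \<odot> c)) \<odot> b)"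
      by (rule add_cmpR[OF Ck[OF hc]]) (use hb hc in simp_all)
    moreover have "(C \<odot> (idn B \<otimes> c)) \<odot> b = C \<odot> (b \<otimes> c)"
      using cmp_stR[of b "idn B" c] hb hc okC C by simp
    moreover have "(V \<otimes> (f \<odot> c)) \<odot> b = (f \<odot> c) \<otimes> b"
      using cmp_stR[of b V "f \<odot> c"] scalar_comm[of "f \<odot> c" b] Vb v hb hc hf by simp
    moreover have "(idn B \<otimes> (f' \<odot> c)) \<odot> b = (f' \<odot> c) \<otimes> b"
      using cmp_stR[of b "idn B" "f' \<odot> c"] scalar_comm[of "f' \<odot> c" b] hb hc f'(1) by simp
    ultimately have ad: "add (C \<odot> (b \<otimes> c)) ((f \<odot> c) \<otimes> b) ((f' \<odot> c) \<otimes> b)" by simp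
    have "pr (a \<odot> (C \<odot> (b \<otimes> c))) = pr (a \<odot> ((f \<odot> c) \<otimes> b)) + pr (a \<odot> ((f' \<odot> c) \<otimes> b))"
      by (rule add_st[OF ad]) (use a hb hc C in simp_all)
    also have "\<dots> = (pr (f \<odot> c) + pr (f' \<odot> c)) * pr (a \<odot> b)"
      using pr_scal[of "f \<odot> c" b B a] pr_scal[of "f' \<odot> c" b B a] hf f'(1) hc hb a by (simp add: distrib_right)
    finally show "pr (a \<odot> (C \<odot> (b \<otimes> c))) = pr (a \<odot> b)" using sum1[OF nc] by simp
  qed (use okC C hb hc in simp_all)
  obtain Z D where D: "chan D" "src D = B \<boxdot> F" "tgt D = B \<boxdot> Z" "Pure D" "(idn B \<otimes> Dis Z) \<odot> D = C"
    by (rule dilation[OF C(1-3)])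
  have okD: "ok D" by (rule chan_ok[OF D(1)])
  obtain P G where P: "purif P c F G" using uniform_purif[OF c] by blast
  have hP: "hom P I0 (F \<boxdot> G)" and pP: "pst P (F \<boxdot> G)" and mP: "(idn F \<otimes> Dis G) \<odot> P = c"
    using purif_hom[OF P] P by (simp_all add: purif_def)
  \<comment> \<open>Since \<open>C\<close> sends \<open>b\<close> with the microcanonical control to
    \<open>b\<close>, the pure state \<open>?T\<close> has the pure marginal \<open>b\<close> and
    factorises. The other factor \<open>t\<close> has the same marginal on \<open>G\<close> as
    \<open>P\<close>.\<close>
  let ?T = "(D \<otimes> idn G) \<odot> (b \<otimes> P)"
  have T: "pst ?T (B \<boxdot> (Z \<boxdot> G))"
  proof -
    have "Pure ?T" by (rule Pure_cmp[OF Pure_tens Pure_tens]) (use b pP D Pure_idn in simp_all)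
    then show ?thesis using b pP D by simp
  qed
  have mT: "(idn B \<otimes> Dis (Z \<boxdot> G)) \<odot> ?T = b"
  proof -
    have "(idn B \<otimes> Dis (Z \<boxdot> G)) \<odot> ?T = ((idn B \<otimes> Dis Z) \<otimes> Dis G) \<odot> ((D \<otimes> idn G) \<odot> (b \<otimes> P))"
      by (simp add: Dis_tens)
    also have "\<dots> = (C \<otimes> Dis G) \<odot> (b \<otimes> P)"
      using exch3[of D "idn B \<otimes> Dis Z" "idn G" "Dis G" "b \<otimes> P"] D okD hb hP by simp
    also have "C \<otimes> Dis G = C \<odot> (idn (B \<boxdot> F) \<otimes> Dis G)"
      using cmp_effR[of "idn (B \<boxdot> F)" C "Dis G"] okC C by simp
    also have "(C \<odot> (idn (B \<boxdot> F) \<otimes> Dis G)) \<odot> (b \<otimes> P) = C \<odot> ((idn B \<otimes> (idn F \<otimes> Dis G)) \<odot> (b \<otimes> P))"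
      using okC C hb hP tens_assoc[of "idn B" "idn F" "Dis G"] by simp
    also have "(idn B \<otimes> (idn F \<otimes> Dis G)) \<odot> (b \<otimes> P) = b \<otimes> c"
      using exch[of b "idn B" P "idn F \<otimes> Dis G"] hb hP mP by simp
    finally show ?thesis using Cc by simp
  qed
  obtain t where t: "pst t (Z \<boxdot> G)" "?T = b \<otimes> t" using factor_pure[OF T] b unfolding mT by blast
  have ht: "hom t I0 (Z \<boxdot> G)" using t(1) nst_hom by blast
  have mt: "(Dis F \<otimes> idn G) \<odot> P = (Dis Z \<otimes> idn G) \<odot> t"
  proof -
    have rd: "(Dis (B \<boxdot> E) \<otimes> idn G) \<odot> (b \<otimes> w) = (Dis E \<otimes> idn G) \<odot> w" if w: "hom w I0 (E \<boxdot> G)" for w E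
    proof -
      have "(Dis (B \<boxdot> E) \<otimes> idn G) \<odot> (b \<otimes> w) = (Dis B \<otimes> (Dis E \<otimes> idn G)) \<odot> (b \<otimes> w)"
        using tens_assoc[of "Dis B" "Dis E" "idn G"] by (simp add: Dis_tens)
      also have "\<dots> = (Dis B \<odot> b) \<otimes> ((Dis E \<otimes> idn G) \<odot> w)" by (rule exch) (use hb w in simp_all)
      finally show ?thesis using nb w by simp
    qed
    have "(Dis Z \<otimes> idn G) \<odot> t = (Dis (B \<boxdot> Z) \<otimes> idn G) \<odot> ?T" unfolding t(2) using rd[OF ht] by simp
    also have "\<dots> = ((Dis (B \<boxdot> Z) \<odot> D) \<otimes> idn G) \<odot> (b \<otimes> P)"
      by (rule act_idn[symmetric]) (use D okD hb hP in simp_all)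
    also have "\<dots> = (Dis F \<otimes> idn G) \<odot> P" using D rd[OF hP] by simp
    finally show ?thesis by simp
  qed
  obtain z where z: "pst z Z" using pst_exists by blast
  obtain e where e: "pst e F" using pst_exists by blast
  have hz: "hom z I0 Z" and he: "hom e I0 F" using z e nst_hom by blast+
  \<comment> \<open>\<open>P\<close> and \<open>t\<close> purify the same state of \<open>G\<close>,
    so up to padding the environment \<open>Z\<close> is a reversible image of the control.\<close>
  obtain U where U: "invertible U (F \<boxdot> Z) (Z \<boxdot> F)"
    "(idn Z \<otimes> (e \<otimes> idn G)) \<odot> t = ((U \<odot> (idn F \<otimes> z)) \<otimes> idn G) \<odot> P"
    by (rule purify_isoR[OF pP t(1) mt z e])
  note u = invertible_chan[OF U(1)]
  let ?u = "U \<odot> (idn F \<otimes> z)"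
  have hu: "hom ?u F (Z \<boxdot> F)" using u hz by simp
  have L: "(D \<otimes> e) \<odot> (b \<otimes> idn F) = b \<otimes> ?u"
  proof (rule faithful[OF c P])
    show "hom ((D \<otimes> e) \<odot> (b \<otimes> idn F)) F (B \<boxdot> (Z \<boxdot> F))" using okD D hb he by simp
    show "hom (b \<otimes> ?u) F (B \<boxdot> (Z \<boxdot> F))" using hb hu hz by simp
    have "((b \<otimes> ?u) \<otimes> idn G) \<odot> P = b \<otimes> ((?u \<otimes> idn G) \<odot> P)"
      using cmp_stL[of P "?u \<otimes> idn G" b] tens_assoc[of b ?u "idn G"] hb hu hz hP by simp
    also have "\<dots> = b \<otimes> ((idn Z \<otimes> (e \<otimes> idn G)) \<odot> t)" using U(2) by simp
    also have "\<dots> = (idn B \<otimes> (idn Z \<otimes> (e \<otimes> idn G))) \<odot> (b \<otimes> t)"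
      using exch[of b "idn B" t "idn Z \<otimes> (e \<otimes> idn G)"] hb ht he by simp
    also have "\<dots> = (idn (B \<boxdot> Z) \<otimes> (e \<otimes> idn G)) \<odot> ?T"
      unfolding t(2) using tens_assoc[of "idn B" "idn Z" "e \<otimes> idn G"] he by simp
    also have "\<dots> = (D \<otimes> (e \<otimes> idn G)) \<odot> (b \<otimes> P)"
      using exch3[of D "idn (B \<boxdot> Z)" "idn G" "e \<otimes> idn G" "b \<otimes> P"] okD D he hb hP by simp
    also have "b \<otimes> P = ((b \<otimes> idn F) \<otimes> idn G) \<odot> P"
      using cmp_stL[of P "idn (F \<boxdot> G)" b] tens_assoc[of b "idn F" "idn G"] hb hP by simp
    also have "(D \<otimes> (e \<otimes> idn G)) \<odot> (((b \<otimes> idn F) \<otimes> idn G) \<odot> P) = (((D \<otimes> e) \<odot> (b \<otimes> idn F)) \<otimes> idn G) \<odot> P"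
      using act_idn[of P "b \<otimes> idn F" "D \<otimes> e" G] okD D he hb hP by simp
    finally show "(((D \<otimes> e) \<odot> (b \<otimes> idn F)) \<otimes> idn G) \<odot> P = ((b \<otimes> ?u) \<otimes> idn G) \<odot> P" by simp
  qed
  obtain U' where U': "invertible U' (Z \<boxdot> F) (F \<boxdot> Z)" "chan U'" "ok U'" "src U' = Z \<boxdot> F" "tgt U' = F \<boxdot> Z" "U' \<odot> U = idn (F \<boxdot> Z)" "U \<odot> U' = idn (Z \<boxdot> F)"
    using invertibleE[OF U(1)] by blast
  \<comment> \<open>The padding state \<open>e\<close> enlarges the environment so that the inverse
    of \<open>U\<close> can act on it. On input \<open>b\<close> this restores the control in
    \<open>F\<close> and leaves the fixed pure state \<open>z\<close> in \<open>Z\<close>.\<close>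
  let ?K = "(idn B \<otimes> U') \<odot> (D \<otimes> e)"
  have hK: "hom ?K (B \<boxdot> F) (B \<boxdot> (F \<boxdot> Z))" using okD D he U' by simp
  have cK: "chan ?K" using D e U' by simp
  have pK: "Pure ?K"
    by (rule Pure_cmp[OF Pure_tens Pure_tens[OF Pure_idn Pure_invertible[OF U'(1)]]]) (use D e U' in simp_all)
  have Kb: "?K \<odot> (b \<otimes> idn F) = b \<otimes> (idn F \<otimes> z)"
  proof -
    have "?K \<odot> (b \<otimes> idn F) = (idn B \<otimes> U') \<odot> ((D \<otimes> e) \<odot> (b \<otimes> idn F))" using okD D he U' hb by simp
    also have "\<dots> = (idn B \<otimes> U') \<odot> (b \<otimes> ?u)" unfolding L ..
    also have "\<dots> = b \<otimes> (U' \<odot> ?u)" using exch[of b "idn B" ?u U'] hb hu hz U' by simp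
    also have "U' \<odot> ?u = idn F \<otimes> z" using cmp_reassoc[OF U'(6), of "idn F \<otimes> z"] U' u hz by simp
    finally show ?thesis .
  qed
  have mK: "(idn B \<otimes> Dis (F \<boxdot> Z)) \<odot> ?K = C"
  proof -
    have "(idn B \<otimes> Dis (F \<boxdot> Z)) \<odot> ?K = (idn B \<otimes> Dis (Z \<boxdot> F)) \<odot> (D \<otimes> e)"
      using idn_act[of "D \<otimes> e" U' "Dis (F \<boxdot> Z)" B] okD D he U' by simp
    also have "\<dots> = ((idn B \<otimes> Dis Z) \<otimes> Dis F) \<odot> (D \<otimes> e)" by (simp add: Dis_tens)
    also have "\<dots> = C \<otimes> (Dis F \<odot> e)" using exch[of D "idn B \<otimes> Dis Z" e "Dis F"] okD D he by simp
    finally show ?thesis using e okC by simp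
  qed
  \<comment> \<open>For a control \<open>k\<close> that makes the action \<open>X\<close> on
    \<open>B\<close> pure, the environment is left in a state \<open>y\<close> independent of the
    input. The value of \<open>y\<close> is therefore found by feeding in \<open>b\<close>, where
    the answer is known.\<close>
  have Kk: "?K \<odot> (idn B \<otimes> k) = X \<otimes> (k \<otimes> z)"
    if k: "nst k F" and X: "C \<odot> (idn B \<otimes> k) = X" "Pure X" "X \<odot> b = b" for k X
  proof -
    have hk: "hom k I0 F" by (rule nst_hom[OF k])
    have hX: "hom X B B" using X Pure_ok[OF X(2)] C hk by auto
    have L1: "chan (?K \<odot> (idn B \<otimes> k))" "src (?K \<odot> (idn B \<otimes> k)) = B" "tgt (?K \<odot> (idn B \<otimes> k)) = B \<boxdot> (F \<boxdot> Z)"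
      using cK hK k by simp_all
    have "(idn B \<otimes> Dis (F \<boxdot> Z)) \<odot> (?K \<odot> (idn B \<otimes> k)) = ((idn B \<otimes> Dis (F \<boxdot> Z)) \<odot> ?K) \<odot> (idn B \<otimes> k)"
      by (rule cmp_assoc[symmetric]) (use hK hk in simp_all)
    then have m: "(idn B \<otimes> Dis (F \<boxdot> Z)) \<odot> (?K \<odot> (idn B \<otimes> k)) = X" unfolding mK X(1) .
    obtain y where y: "nst y (F \<boxdot> Z)" "?K \<odot> (idn B \<otimes> k) = X \<otimes> y" by (rule factor_channel[OF L1 m X(2)])
    have hy: "hom y I0 (F \<boxdot> Z)" by (rule nst_hom[OF y(1)])
    have "b \<otimes> y = (X \<otimes> y) \<odot> b" using cmp_stR[of b X y] hb hX hy X(3) by simp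
    also have "\<dots> = (?K \<odot> (idn B \<otimes> k)) \<odot> b" unfolding y(2) ..
    also have "\<dots> = ?K \<odot> ((idn B \<otimes> k) \<odot> b)" by (rule cmp_assoc) (use hb hk hK in simp_all)
    also have "(idn B \<otimes> k) \<odot> b = (b \<otimes> idn F) \<odot> k"
      using cmp_stR[of b "idn B" k] cmp_stL[of k "idn F" b] hb hk by simp
    also have "?K \<odot> ((b \<otimes> idn F) \<odot> k) = (?K \<odot> (b \<otimes> idn F)) \<odot> k" by (rule cmp_assoc[symmetric]) (use hb hk hK in simp_all)
    also have "\<dots> = b \<otimes> (k \<otimes> z)"
      unfolding Kb using cmp_stL[of k "idn F \<otimes> z" b] cmp_stR[of k "idn F" z] hb hk hz by simp
    finally have "y = k \<otimes> z" by (intro tens_cancel_left[OF nb hy]) (use hk hz in simp_all)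
    then show ?thesis using y(2) by simp
  qed
  obtain g where g: "sharp g z Z" using sharp_exists[OF z] by blast
  note sg = sharpD[OF g]
  have gz: "g \<odot> z = idn I0" by (rule scalar_ext) (use sg hz in simp_all)
  \<comment> \<open>The pure effect \<open>g\<close> removes the leftover \<open>z\<close> while
    preserving purity. It is not deterministic in general, so that \<open>?W\<close> is a channel
    has to be shown separately.\<close>
  let ?W = "(idn (B \<boxdot> F) \<otimes> g) \<odot> ?K"
  have hW: "hom ?W (B \<boxdot> F) (B \<boxdot> F)" using hK sg by simp
  have pW: "Pure ?W" by (rule Pure_cmp[OF pK Pure_tens[OF Pure_idn]]) (use sg hK in simp_all)
  have Wk: "?W \<odot> (idn B \<otimes> k) = X \<otimes> k"
    if k: "nst k F" and X: "C \<odot> (idn B \<otimes> k) = X" "Pure X" "X \<odot> b = b" for k X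
  proof -
    have hk: "hom k I0 F" by (rule nst_hom[OF k])
    have hX: "hom X B B" using X Pure_ok[OF X(2)] C hk by auto
    have "?W \<odot> (idn B \<otimes> k) = (idn (B \<boxdot> F) \<otimes> g) \<odot> (?K \<odot> (idn B \<otimes> k))"
      by (rule cmp_assoc) (use hK hk sg in simp_all)
    also have "\<dots> = (idn (B \<boxdot> F) \<otimes> g) \<odot> ((X \<otimes> k) \<otimes> z)" unfolding Kk[OF that] using hX hk hz by simp
    also have "\<dots> = X \<otimes> k" using exch[of "X \<otimes> k" "idn (B \<boxdot> F)" z g] hX hk hz sg gz by simp
    finally show ?thesis .
  qed
  have Wx: "?W \<odot> (idn B \<otimes> x) = V \<otimes> x" by (rule Wk[OF _ Cx Pure_invertible[OF V] Vb]) (use sf in blast)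
  have Wx': "?W \<odot> (idn B \<otimes> x') = idn B \<otimes> x'" by (rule Wk[OF x'(1) Cx' Pure_idn]) (use hb in simp)
  obtain d where d: "uniform d B" using uniform_exists by blast
  have nd: "nst d B" and hd: "hom d I0 B" using uniform_nst[OF d] nst_hom[OF uniform_nst[OF d]] by blast+
  let ?e = "Dis (B \<boxdot> F) \<odot> ?W"
  have he': "hom ?e (B \<boxdot> F) I0" using hW by simp
  have ev: "pr ((?e \<odot> (d \<otimes> idn F)) \<odot> k) = 1" if k: "nst k F" and X: "?W \<odot> (idn B \<otimes> k) = X \<otimes> k" "chan X" "src X = B" "tgt X = B" for k X
  proof -
    have hk: "hom k I0 F" by (rule nst_hom[OF k])
    have hX: "hom X B B" using X chan_ok[OF X(2)] by simp
    have "(?e \<odot> (d \<otimes> idn F)) \<odot> k = Dis (B \<boxdot> F) \<odot> (?W \<odot> ((d \<otimes> idn F) \<odot> k))" using hW hd hk sg hK by simp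
    also have "(d \<otimes> idn F) \<odot> k = (idn B \<otimes> k) \<odot> d"
      using cmp_stR[of d "idn B" k] cmp_stL[of k "idn F" d] hd hk by simp
    also have "?W \<odot> ((idn B \<otimes> k) \<odot> d) = (?W \<odot> (idn B \<otimes> k)) \<odot> d"
      by (rule cmp_assoc[symmetric]) (use hW hd hk in simp_all)
    also have "\<dots> = (X \<otimes> k) \<odot> d" unfolding X(1) ..
    also have "Dis (B \<boxdot> F) \<odot> ((X \<otimes> k) \<odot> d) = idn I0" using X(2-4) k nd by simp
    finally show ?thesis by simp
  qed
  \<comment> \<open>The microcanonical control is a mixture of \<open>x\<close> and
    \<open>x'\<close>, and with either of these \<open>?W\<close> acts as a channel. Thus
    \<open>?W\<close> preserves normalisation on the invariant state of the composite, which
    suffices by \<open>one_effect\<close>.\<close>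
  have "pr (?e \<odot> (d \<otimes> c)) = 1"
  proof -
    have "(d \<otimes> idn F) \<odot> c = d \<otimes> c" using cmp_stL[of c "idn F" d] hc hd by simp
    then have "pr (?e \<odot> (d \<otimes> c)) = pr ((?e \<odot> (d \<otimes> idn F)) \<odot> c)"
      using cmp_assoc[of c "d \<otimes> idn F" ?e] hc hd he' by simp
    also have "\<dots> = l * pr ((?e \<odot> (d \<otimes> idn F)) \<odot> x) + (1 - l) * pr ((?e \<odot> (d \<otimes> idn F)) \<odot> x')"
      by (rule l) (use he' hd in simp)
    also have "pr ((?e \<odot> (d \<otimes> idn F)) \<odot> x) = 1" by (rule ev[OF _ Wx]) (use sf v in blast)+
    also have "pr ((?e \<odot> (d \<otimes> idn F)) \<odot> x') = 1" by (rule ev[OF x'(1) Wx']) simp_all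
    finally show ?thesis by simp
  qed
  then have "?e = Dis (B \<boxdot> F)" by (rule one_effect[OF uniform_tens_ex[OF d c] he'])
  then have "chan ?W" using chanI[of ?W] hW by simp
  then have "invertible ?W (B \<boxdot> F) (B \<boxdot> F)" using pure_channel_invertible[OF pW] hW by simp
  then show thesis using that Wx Wx' by blast
qed

lemma microcanonical_eq:
  assumes c: "uniform c A" shows "\<chi> A = raw c"
  unfolding microcanonical_def
proof (rule the_equality)
  have nc: "nst c A" by (rule uniform_nst[OF c])
  have hc: "hom c I0 A" by (rule nst_hom[OF nc])
  have "normalised \<Theta> A (raw c)" using nst_raw[of c A] nc by blast
  moreover have "U \<cdot> raw c = raw c" if "reversible \<Theta> A A U" for U
  proof -
    have "invertible (Arr A U A) A A" using that by (simp add: invertible_reversible)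
    then have "Arr A U A \<odot> c = c" using c by (simp add: uniform_def)
    then have "raw (Arr A U A \<odot> c) = raw c" by simp
    then show ?thesis by simp
  qed
  ultimately show "normalised \<Theta> A (raw c) \<and> (\<forall>U. reversible \<Theta> A A U \<longrightarrow> U \<cdot> raw c = raw c)" by blast
  fix d assume d: "normalised \<Theta> A d \<and> (\<forall>U. reversible \<Theta> A A U \<longrightarrow> U \<cdot> d = d)"
  let ?d = "Arr I0 d A"
  have nd: "nst ?d A" using d normalised_iff by blast
  have "U \<odot> ?d = ?d" if U: "invertible U A A" for U
    by (rule arrow_eqI) (use d U invertible_reversible[of U A A] in simp_all)
  then have "?d = c" by (rule uniform_unique[OF c nd])
  then have "raw ?d = raw c" by simp
  then show "d = raw c" by simp
qed

text \<open>The swap has the fixed point \<open>b \<otimes> b\<close>, and \<open>V \<otimes> V\<^sup>-\<^sup>1\<close> is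
  the product of \<open>V \<otimes> 1\<close>, the swap, \<open>V\<^sup>-\<^sup>1 \<otimes> 1\<close> and the swap; only the swaps need to be controlled.\<close>

lemma controlled_pair:
  assumes f: "sharp f x F" and c: "uniform c F" and x': "nst x' F" "pr (f \<odot> x') = 0"
    and l: "\<And>a. hom a F I0 \<Longrightarrow> pr (a \<odot> c) = l * pr (a \<odot> x) + (1 - l) * pr (a \<odot> x')"
    and V: "invertible V P P"
  obtains W Y where "invertible W (P \<boxdot> (P \<boxdot> F)) (P \<boxdot> (P \<boxdot> F))" "invertible Y P P"
    "W \<odot> (idn (P \<boxdot> P) \<otimes> x) = (V \<otimes> Y) \<otimes> x" "W \<odot> (idn (P \<boxdot> P) \<otimes> x') = idn (P \<boxdot> P) \<otimes> x'"
proof -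
  obtain b where b: "pst b P" using pst_exists by blast
  have hb: "hom b I0 P" using b nst_hom by blast
  have bb: "pst (b \<otimes> b) (P \<boxdot> P)" by (rule pst_tens[OF b b])
  let ?S = "Sw P P" and ?B = "P \<boxdot> P"
  have Sb: "?S \<odot> (b \<otimes> b) = b \<otimes> b" using Sw_state[of b b] hb by simp
  obtain W where W: "invertible W (?B \<boxdot> F) (?B \<boxdot> F)" "W \<odot> (idn ?B \<otimes> x) = ?S \<otimes> x" "W \<odot> (idn ?B \<otimes> x') = idn ?B \<otimes> x'"
    by (rule controlled[OF f c x' l invertible_Sw bb Sb])
  obtain Y where Y: "invertible Y P P" "chan Y" "ok Y" "src Y = P" "tgt Y = P" "Y \<odot> V = idn P" "V \<odot> Y = idn P" using invertibleE[OF V] by blast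
  note v = invertible_chan[OF V] and w = invertible_chan[OF W(1)]
  have hx: "hom x I0 F" "hom x' I0 F" using sharpD[OF f] nst_hom[OF x'(1)] by blast+
  let ?v = "V \<otimes> idn (P \<boxdot> F)" and ?y = "Y \<otimes> idn (P \<boxdot> F)"
  have app: "(G \<otimes> idn (P \<boxdot> F)) \<odot> (X \<otimes> k) = ((G \<otimes> idn P) \<odot> X) \<otimes> k"
    if G: "hom G P P" and X: "hom X ?B ?B" and k: "hom k I0 F" for G X k
    using exch[of X "G \<otimes> idn P" k "idn F"] tens_assoc[of G "idn P" "idn F"] that by simp
  have Wapp: "W \<odot> (X \<otimes> k) = (R \<odot> X) \<otimes> k"
    if X: "hom X ?B ?B" and k: "hom k I0 F" and R: "W \<odot> (idn ?B \<otimes> k) = R \<otimes> k" "hom R ?B ?B" for X k R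
  proof -
    have "X \<otimes> k = (idn ?B \<otimes> k) \<odot> X" using cmp_stR[of X "idn ?B" k] X k by simp
    then have "W \<odot> (X \<otimes> k) = (W \<odot> (idn ?B \<otimes> k)) \<odot> X" using cmp_assoc[of X "idn ?B \<otimes> k" W] w X k by simp
    also have "\<dots> = (R \<odot> X) \<otimes> k" unfolding R(1) using cmp_stR[of X R k] X k R(2) by simp
    finally show ?thesis .
  qed
  \<comment> \<open>With control \<open>x'\<close> both swaps are absent and \<open>V\<close>
    cancels against its inverse \<open>Y\<close>.\<close>
  let ?W = "?v \<odot> (W \<odot> (?y \<odot> W))"
  have rv: "invertible ?v (P \<boxdot> (P \<boxdot> F)) (P \<boxdot> (P \<boxdot> F))" by (rule invertible_tens[OF V invertible_idn])
  have ry: "invertible ?y (P \<boxdot> (P \<boxdot> F)) (P \<boxdot> (P \<boxdot> F))" by (rule invertible_tens[OF Y(1) invertible_idn])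
  have rW: "invertible W (P \<boxdot> (P \<boxdot> F)) (P \<boxdot> (P \<boxdot> F))" using W(1) by simp
  have r: "invertible ?W (P \<boxdot> (P \<boxdot> F)) (P \<boxdot> (P \<boxdot> F))" by (rule invertible_cmp[OF invertible_cmp[OF invertible_cmp[OF rW ry] rW] rv])
  have gen: "?W \<odot> (idn ?B \<otimes> k) = ((V \<otimes> idn P) \<odot> (R \<odot> ((Y \<otimes> idn P) \<odot> R))) \<otimes> k"
    if k: "hom k I0 F" and R: "W \<odot> (idn ?B \<otimes> k) = R \<otimes> k" "hom R ?B ?B" for k R
  proof -
    have "?W \<odot> (idn ?B \<otimes> k) = ?v \<odot> (W \<odot> (?y \<odot> (W \<odot> (idn ?B \<otimes> k))))" using v w Y k by simp
    also have "\<dots> = ?v \<odot> (W \<odot> (?y \<odot> (R \<otimes> k)))" unfolding R(1) ..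
    also have "?y \<odot> (R \<otimes> k) = ((Y \<otimes> idn P) \<odot> R) \<otimes> k" by (rule app) (use Y R k in simp_all)
    also have "W \<odot> (((Y \<otimes> idn P) \<odot> R) \<otimes> k) = (R \<odot> ((Y \<otimes> idn P) \<odot> R)) \<otimes> k" by (rule Wapp[OF _ k R]) (use Y R in simp)
    also have "?v \<odot> ((R \<odot> ((Y \<otimes> idn P) \<odot> R)) \<otimes> k) = ((V \<otimes> idn P) \<odot> (R \<odot> ((Y \<otimes> idn P) \<odot> R))) \<otimes> k"
      by (rule app) (use v Y R k in simp_all)
    finally show ?thesis .
  qed
  have "?S \<odot> ((Y \<otimes> idn P) \<odot> ?S) = (idn P \<otimes> Y) \<odot> (?S \<odot> ?S)"
    using Sw_act[of Y "idn P" ?S] Y by simp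
  then have "?S \<odot> ((Y \<otimes> idn P) \<odot> ?S) = idn P \<otimes> Y" using Y by simp
  moreover have "(V \<otimes> idn P) \<odot> (idn P \<otimes> Y) = V \<otimes> Y" using exch[of "idn P" V Y "idn P"] v Y by simp
  ultimately have 1: "?W \<odot> (idn ?B \<otimes> x) = (V \<otimes> Y) \<otimes> x"
    using gen[OF hx(1) W(2)] by simp
  have "(V \<otimes> idn P) \<odot> (idn ?B \<odot> ((Y \<otimes> idn P) \<odot> idn ?B)) = idn ?B"
    using exch[of Y V "idn P" "idn P"] v Y by simp
  then have 2: "?W \<odot> (idn ?B \<otimes> x') = idn ?B \<otimes> x'" using gen[OF hx(2) W(3)] by simp
  show thesis by (rule that[OF r Y(1) 1 2])
qed

section \<open>Mixtures of noisy operations\<close>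

text \<open>The environment, the reversible channel and the microcanonical state are explicit
  arguments because the construction of mixtures combines them.\<close>

definition noisy_rep :: "('a, 'b) arrow \<Rightarrow> 'a \<Rightarrow> 'a \<Rightarrow> ('a, 'b) arrow \<Rightarrow> ('a, 'b) arrow \<Rightarrow> bool"
  where "noisy_rep R A E U c \<longleftrightarrow> uniform c E \<and> invertible U (A \<boxdot> E) (A \<boxdot> E) \<and> R = (idn A \<otimes> Dis E) \<odot> U \<odot> (idn A \<otimes> c)"

lemma noisy_rep_hom:
  assumes "noisy_rep R A E U c" shows "hom R A A" "chan R"
proof -
  have u: "chan U" "ok U" "src U = A \<boxdot> E" "tgt U = A \<boxdot> E" using assms invertible_chan unfolding noisy_rep_def by blast+
  have c: "nst c E" using assms uniform_nst unfolding noisy_rep_def by blast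
  have hc: "hom c I0 E" by (rule nst_hom[OF c])
  have R: "R = (idn A \<otimes> Dis E) \<odot> U \<odot> (idn A \<otimes> c)" using assms unfolding noisy_rep_def by blast
  show "hom R A A" "chan R" unfolding R using u c hc by simp_all
qed

lemma noisy_rep_invertible:
  assumes U: "invertible U A A" shows "\<exists>c. noisy_rep U A I0 U c"
proof -
  obtain c where c: "uniform c I0" using uniform_exists by blast
  have "c = Dis I0" by (rule Dis_unique) (use uniform_nst[OF c] in simp_all)
  then have "c = idn I0" by simp
  then have "noisy_rep U A I0 U c" unfolding noisy_rep_def using c U invertible_chan[OF U] by simp
  then show ?thesis by blast
qed

lemma noisy_rep_pad:
  assumes R: "noisy_rep R A E U c" and d: "uniform d G"
  shows "noisy_rep R A (E \<boxdot> G) (U \<otimes> idn G) (c \<otimes> d)"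
proof -
  have c: "uniform c E" and U: "invertible U (A \<boxdot> E) (A \<boxdot> E)" and R: "R = (idn A \<otimes> Dis E) \<odot> U \<odot> (idn A \<otimes> c)"
    using R unfolding noisy_rep_def by blast+
  note u = invertible_chan[OF U]
  have nc: "nst c E" "nst d G" by (rule uniform_nst[OF c], rule uniform_nst[OF d])
  have hc: "hom c I0 E" "hom d I0 G" by (rule nst_hom[OF nc(1)], rule nst_hom[OF nc(2)])
  have "(idn A \<otimes> Dis (E \<boxdot> G)) \<odot> (U \<otimes> idn G) \<odot> (idn A \<otimes> (c \<otimes> d))
      = ((idn A \<otimes> Dis E) \<otimes> Dis G) \<odot> (U \<otimes> idn G) \<odot> ((idn A \<otimes> c) \<otimes> d)" using hc by (simp add: Dis_tens)
  also have "\<dots> = ((idn A \<otimes> Dis E) \<otimes> Dis G) \<odot> ((U \<odot> (idn A \<otimes> c)) \<otimes> d)"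
    using exch[of "idn A \<otimes> c" U d "idn G"] u hc by simp
  also have "\<dots> = ((idn A \<otimes> Dis E) \<odot> (U \<odot> (idn A \<otimes> c))) \<otimes> (Dis G \<odot> d)"
    by (rule exch) (use u hc in simp_all)
  also have "\<dots> = R" using R nc u hc by simp
  finally have e: "R = (idn A \<otimes> Dis (E \<boxdot> G)) \<odot> (U \<otimes> idn G) \<odot> (idn A \<otimes> (c \<otimes> d))" by simp
  have r: "invertible (U \<otimes> idn G) (A \<boxdot> (E \<boxdot> G)) (A \<boxdot> (E \<boxdot> G))" using invertible_tens[OF U invertible_idn[of G]] by simp
  show ?thesis unfolding noisy_rep_def using uniform_tens_ex[OF c d] r e by blast
qed

lemma noisy_rep_swap:
  assumes R: "noisy_rep R A (E \<boxdot> G) U (c \<otimes> d)" and c: "uniform c E" and d: "uniform d G"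
  shows "\<exists>U'. noisy_rep R A (G \<boxdot> E) U' (d \<otimes> c)"
proof -
  have U: "invertible U (A \<boxdot> (E \<boxdot> G)) (A \<boxdot> (E \<boxdot> G))" and R: "R = (idn A \<otimes> Dis (E \<boxdot> G)) \<odot> U \<odot> (idn A \<otimes> (c \<otimes> d))"
    using R unfolding noisy_rep_def by blast+
  note u = invertible_chan[OF U]
  have hc: "hom c I0 E" "hom d I0 G" by (rule nst_hom[OF uniform_nst[OF c]], rule nst_hom[OF uniform_nst[OF d]])
  let ?a = "idn A \<otimes> Sw G E" and ?b = "idn A \<otimes> Sw E G"
  have b: "invertible ?b (A \<boxdot> (E \<boxdot> G)) (A \<boxdot> (G \<boxdot> E))" and a: "invertible ?a (A \<boxdot> (G \<boxdot> E)) (A \<boxdot> (E \<boxdot> G))"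
    by (rule invertible_tens[OF invertible_idn invertible_Sw])+
  let ?U = "?b \<odot> (U \<odot> ?a)"
  have r: "invertible ?U (A \<boxdot> (G \<boxdot> E)) (A \<boxdot> (G \<boxdot> E))" by (rule invertible_cmp[OF invertible_cmp[OF a U] b])
  have 1: "?a \<odot> (idn A \<otimes> (d \<otimes> c)) = idn A \<otimes> (c \<otimes> d)"
    using exch[of "idn A" "idn A" "d \<otimes> c" "Sw G E"] Sw_state[of d c] hc by simp
  have 2: "(idn A \<otimes> Dis (G \<boxdot> E)) \<odot> ?b = idn A \<otimes> Dis (E \<boxdot> G)"
    using exch[of "idn A" "idn A" "Sw E G" "Dis (G \<boxdot> E)"] by simp
  have "(idn A \<otimes> Dis (G \<boxdot> E)) \<odot> ?U \<odot> (idn A \<otimes> (d \<otimes> c))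
      = (idn A \<otimes> Dis (G \<boxdot> E)) \<odot> (?b \<odot> (U \<odot> (?a \<odot> (idn A \<otimes> (d \<otimes> c)))))"
    using u hc by simp
  also have "\<dots> = ((idn A \<otimes> Dis (G \<boxdot> E)) \<odot> ?b) \<odot> (U \<odot> (idn A \<otimes> (c \<otimes> d)))"
    unfolding 1 by (rule cmp_assoc[symmetric]) (use u hc in simp_all)
  also have "\<dots> = R" unfolding 2 R ..
  finally have "R = (idn A \<otimes> Dis (G \<boxdot> E)) \<odot> ?U \<odot> (idn A \<otimes> (d \<otimes> c))" by simp
  then have "noisy_rep R A (G \<boxdot> E) ?U (d \<otimes> c)" unfolding noisy_rep_def using uniform_tens_ex[OF d c] r by blast
  then show ?thesis by blast
qed

text \<open>Over the common environment \<open>V2\<close> is applied first and then, under control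
  of \<open>F\<close>, the channel \<open>V\<close> with \<open>V\<close> after \<open>V2\<close>
  equal to \<open>V1\<close>. Control \<open>x\<close> thus gives \<open>R1\<close> and control
  \<open>x'\<close> gives \<open>R2\<close>, while the microcanonical control gives the mixture by
  linearity. The second copy required by \<open>controlled_pair\<close> starts in the microcanonical
  state \<open>p\<close> and is discarded.\<close>

lemma noisy_rep_mix:
  assumes f: "sharp f x F" and c: "uniform c F" and x': "nst x' F" "pr (f \<odot> x') = 0"
    and l: "\<And>a. hom a F I0 \<Longrightarrow> pr (a \<odot> c) = l * pr (a \<odot> x) + (1 - l) * pr (a \<odot> x')"
    and R1: "noisy_rep R1 A E1 U1 c1" and R2: "noisy_rep R2 A E2 U2 c2"
  obtains R E U d where "noisy_rep R A E U d" "lin R UNIV (\<lambda>b. if b then l else 1 - l) (\<lambda>b. if b then R1 else R2)"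
proof -
  have u1: "uniform c1 E1" and u2: "uniform c2 E2" using R1 R2 unfolding noisy_rep_def by blast+
  let ?E = "E2 \<boxdot> E1" and ?e = "c2 \<otimes> c1"
  let ?P = "A \<boxdot> ?E"
  have ue: "uniform ?e ?E" by (rule uniform_tens_ex[OF u2 u1])
  obtain V1 where V1: "noisy_rep R1 A ?E V1 ?e" using noisy_rep_swap[OF noisy_rep_pad[OF R1 u2] u1 u2] by blast
  define V2 where "V2 = U2 \<otimes> idn E1"
  have V2: "noisy_rep R2 A ?E V2 ?e" unfolding V2_def by (rule noisy_rep_pad[OF R2 u1])
  have r1: "invertible V1 ?P ?P" and r2: "invertible V2 ?P ?P" and e1: "R1 = (idn A \<otimes> Dis ?E) \<odot> V1 \<odot> (idn A \<otimes> ?e)"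
    and e2: "R2 = (idn A \<otimes> Dis ?E) \<odot> V2 \<odot> (idn A \<otimes> ?e)" using V1 V2 unfolding noisy_rep_def by blast+
  obtain V2' where i2: "invertible V2' ?P ?P" "chan V2'" "ok V2'" "src V2' = ?P" "tgt V2' = ?P" "V2' \<odot> V2 = idn ?P" using invertibleE[OF r2] by blast
  define V where "V = V1 \<odot> V2'"
  have rV: "invertible V ?P ?P" unfolding V_def by (rule invertible_cmp[OF i2(1) r1])
  note v1 = invertible_chan[OF r1] and v2 = invertible_chan[OF r2] and v = invertible_chan[OF rV]
  have VV2: "V \<odot> V2 = V1" unfolding V_def using v1 v2 i2 by simp
  obtain W Y where W: "invertible W (?P \<boxdot> (?P \<boxdot> F)) (?P \<boxdot> (?P \<boxdot> F))" "invertible Y ?P ?P"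
    "W \<odot> (idn (?P \<boxdot> ?P) \<otimes> x) = (V \<otimes> Y) \<otimes> x" "W \<odot> (idn (?P \<boxdot> ?P) \<otimes> x') = idn (?P \<boxdot> ?P) \<otimes> x'"
    by (rule controlled_pair[OF f c x' l rV])
  note w = invertible_chan[OF W(1)]
  obtain p where p: "uniform p ?P" using uniform_exists by blast
  have ne: "nst ?e ?E" by (rule uniform_nst[OF ue])
  have he: "hom ?e I0 ?E" by (rule nst_hom[OF ne])
  have np: "nst p ?P" by (rule uniform_nst[OF p])
  have hp: "hom p I0 ?P" by (rule nst_hom[OF np])
  have nc: "nst c F" by (rule uniform_nst[OF c])
  have hc: "hom c I0 F" by (rule nst_hom[OF nc])
  have nx: "nst x F" and hx: "hom x I0 F" using sharpD[OF f] by blast+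
  have hx': "hom x' I0 F" by (rule nst_hom[OF x'(1)])
  let ?G = "?P \<boxdot> F"
  \<comment> \<open>The effect on system and environment of a control prepared in \<open>k\<close>,
    with the second copy in \<open>p\<close> and both discarded at the end. It is linear in
    \<open>k\<close>, and \<open>J\<close> completes it to an operation on \<open>A\<close>.\<close>
  define T where "T k = (idn ?P \<otimes> Dis ?G) \<odot> (W \<odot> (idn ?P \<otimes> (p \<otimes> k)))" for k
  define J where "J X = (idn A \<otimes> Dis ?E) \<odot> (X \<odot> (V2 \<odot> (idn A \<otimes> ?e)))" for X
  have Tk: "T k = X"
    if k: "nst k F" and X: "W \<odot> (idn (?P \<boxdot> ?P) \<otimes> k) = (X \<otimes> Z) \<otimes> k" "hom X ?P ?P" "chan Z" "src Z = ?P" "tgt Z = ?P" for k X Z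
  proof -
    have hk: "hom k I0 F" by (rule nst_hom[OF k])
    have okZ: "ok Z" by (rule chan_ok[OF X(3)])
    have "idn ?P \<otimes> (p \<otimes> k) = (idn (?P \<boxdot> ?P) \<otimes> k) \<odot> (idn ?P \<otimes> p)"
      using cmp_stR[of "idn ?P \<otimes> p" "idn (?P \<boxdot> ?P)" k] tens_assoc[of "idn ?P" p k] hp hk by simp
    then have "W \<odot> (idn ?P \<otimes> (p \<otimes> k)) = (W \<odot> (idn (?P \<boxdot> ?P) \<otimes> k)) \<odot> (idn ?P \<otimes> p)"
      using cmp_assoc[of "idn ?P \<otimes> p" "idn (?P \<boxdot> ?P) \<otimes> k" W] w hp hk by simp
    also have "\<dots> = ((X \<otimes> Z) \<odot> (idn ?P \<otimes> p)) \<otimes> k"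
      unfolding X(1) using cmp_stR[of "idn ?P \<otimes> p" "X \<otimes> Z" k] X okZ hp hk by simp
    also have "(X \<otimes> Z) \<odot> (idn ?P \<otimes> p) = X \<otimes> (Z \<odot> p)" using exch[of "idn ?P" X p Z] X okZ hp by simp
    finally have 1: "W \<odot> (idn ?P \<otimes> (p \<otimes> k)) = X \<otimes> ((Z \<odot> p) \<otimes> k)" using X okZ hp hk by simp
    have "T k = (idn ?P \<odot> X) \<otimes> (Dis ?G \<odot> ((Z \<odot> p) \<otimes> k))"
      unfolding T_def 1 by (rule exch) (use X okZ hp hk in simp_all)
    then show ?thesis using X np k by simp
  qed
  have Tx: "T x = V" by (rule Tk[OF nx W(3)]) (use v invertible_chan[OF W(2)] in simp_all)
  have Tx': "T x' = idn ?P" by (rule Tk[OF x'(1), of _ "idn ?P"]) (use W(4) in simp_all)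
  let ?w = "\<lambda>b. if b then l else 1 - l"
  have "lin c UNIV ?w (\<lambda>b. if b then x else x')"
    by (rule lin_stateI[OF hc]) (use hx hx' l in \<open>auto simp: UNIV_bool\<close>)
  then have "lin (T c) UNIV ?w (\<lambda>b. T (if b then x else x'))"
    unfolding T_def using w hp hc by (intro lin_cmpL lin_tensL) simp_all
  moreover have hT: "hom (T c) ?P ?P" unfolding T_def using w hp hc by simp
  ultimately have "lin (J (T c)) UNIV ?w (\<lambda>b. J (T (if b then x else x')))"
    unfolding J_def using v2 he by (intro lin_cmpL lin_cmpR) simp_all
  moreover have "J V = R1" unfolding J_def e1 using cmp_reassoc[OF VV2, of "idn A \<otimes> ?e"] v v2 he by simp
  moreover have "J (idn ?P) = R2" unfolding J_def e2 using v2 he by simp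
  ultimately have L: "lin (J (T c)) UNIV ?w (\<lambda>b. if b then R1 else R2)"
    by (elim lin_cong) (auto simp: Tx Tx')
  let ?H = "?E \<boxdot> ?G" and ?h = "?e \<otimes> (p \<otimes> c)" and ?U = "W \<odot> (V2 \<otimes> idn ?G)"
  have "invertible ?U (A \<boxdot> ?H) (A \<boxdot> ?H)"
  proof -
    have "invertible ?U (?P \<boxdot> ?G) (?P \<boxdot> ?G)" by (rule invertible_cmp[OF invertible_tens[OF r2 invertible_idn] W(1)])
    then show ?thesis by simp
  qed
  moreover have "uniform ?h ?H" by (rule uniform_tens_ex[OF ue uniform_tens_ex[OF p c]])
  moreover have "J (T c) = (idn A \<otimes> Dis ?H) \<odot> ?U \<odot> (idn A \<otimes> ?h)"
  proof -
    let ?pc = "p \<otimes> c" and ?q = "V2 \<odot> (idn A \<otimes> ?e)"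
    have hpc: "hom ?pc I0 ?G" using hp hc by simp
    have hq: "hom ?q A ?P" using v2 he by simp
    have "(V2 \<otimes> idn ?G) \<odot> (idn A \<otimes> ?h) = ?q \<otimes> ?pc"
      using exch[of "idn A \<otimes> ?e" V2 ?pc "idn ?G"] tens_assoc[of "idn A" ?e ?pc] v2 he hpc by simp
    also have "\<dots> = (idn ?P \<otimes> ?pc) \<odot> ?q" using cmp_stR[of ?q "idn ?P" ?pc] hq hpc by simp
    finally have 1: "(V2 \<otimes> idn ?G) \<odot> (idn A \<otimes> ?h) = (idn ?P \<otimes> ?pc) \<odot> ?q" .
    have 2: "idn A \<otimes> Dis ?H = (idn A \<otimes> Dis ?E) \<odot> (idn ?P \<otimes> Dis ?G)"
      using cmp_effR[of "idn ?P" "idn A \<otimes> Dis ?E" "Dis ?G"] tens_assoc[of "idn A" "Dis ?E" "Dis ?G"]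
      by (simp add: Dis_tens)
    have "(idn A \<otimes> Dis ?H) \<odot> ?U \<odot> (idn A \<otimes> ?h) = (idn A \<otimes> Dis ?H) \<odot> (W \<odot> ((V2 \<otimes> idn ?G) \<odot> (idn A \<otimes> ?h)))"
    proof -
      have "?U \<odot> (idn A \<otimes> ?h) = W \<odot> ((V2 \<otimes> idn ?G) \<odot> (idn A \<otimes> ?h))"
        by (rule cmp_assoc) (use w v2 he hpc in simp_all)
      then show ?thesis by simp
    qed
    also have "\<dots> = ((idn A \<otimes> Dis ?E) \<odot> (idn ?P \<otimes> Dis ?G)) \<odot> (W \<odot> ((idn ?P \<otimes> ?pc) \<odot> ?q))" unfolding 1 2 ..
    also have "\<dots> = (idn A \<otimes> Dis ?E) \<odot> ((idn ?P \<otimes> Dis ?G) \<odot> (W \<odot> ((idn ?P \<otimes> ?pc) \<odot> ?q)))"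
      by (rule cmp_assoc) (use w hq hpc in simp_all)
    also have "(idn ?P \<otimes> Dis ?G) \<odot> (W \<odot> ((idn ?P \<otimes> ?pc) \<odot> ?q)) = T c \<odot> ?q"
      unfolding T_def using w hq hpc by simp
    finally show ?thesis unfolding J_def by simp
  qed
  ultimately have "noisy_rep (J (T c)) A ?H ?U ?h" unfolding noisy_rep_def by blast
  then show thesis using L by (rule that)
qed

section \<open>From fixed-ratio mixtures to random reversible channels\<close>

lemma noisy_rep_basic:
  assumes "noisy_rep R A E U c" shows "basic_noisy_operation \<Theta> A A (raw R)"
proof -
  have c: "uniform c E" and U: "invertible U (A \<boxdot> E) (A \<boxdot> E)" and R: "R = (idn A \<otimes> Dis E) \<odot> U \<odot> (idn A \<otimes> c)"
    using assms unfolding noisy_rep_def by blast+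
  note u = invertible_chan[OF U]
  have hc: "hom c I0 E" by (rule nst_hom[OF uniform_nst[OF c]])
  have rU: "reversible \<Theta> (A \<boxdot> E) (A \<boxdot> E) (raw U)" using U invertible_reversible by blast
  have "R = ((idn A \<otimes> Dis E) \<odot> U) \<odot> (idn A \<otimes> c)" unfolding R using u hc by simp
  then have "raw R = raw (((idn A \<otimes> Dis E) \<odot> U) \<odot> (idn A \<otimes> c))" by (rule arg_cong)
  then have e: "raw R = (\<I> A \<boxtimes> \<u> E) \<cdot> raw U \<cdot> (\<I> A \<boxtimes> \<chi> E)" by (simp add: microcanonical_eq[OF c])
  have "channel \<Theta> A A (raw R)" using noisy_rep_hom[OF assms] by (simp add: chan_def)
  then show ?thesis unfolding basic_noisy_operation_def op_equivalent_def using rU e by blast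
qed

text \<open>Measure the purifying system with the sharp effect \<open>b\<close> dual to
  \<open>f\<close>. One outcome leaves \<open>x\<close> with weight \<open>max_weight c A\<close>,
  the other leaves \<open>y\<close>. That weight is already the full probability of \<open>f\<close>
  on \<open>c\<close>, so nothing remains for \<open>y\<close>.\<close>

lemma uniform_split:
  assumes c: "uniform c A" and f: "sharp f x A" and l: "max_weight c A < 1"
  obtains y where "nst y A" "pr (f \<odot> y) = 0"
    "\<And>a. hom a A I0 \<Longrightarrow> pr (a \<odot> c) = max_weight c A * pr (a \<odot> x) + (1 - max_weight c A) * pr (a \<odot> y)"
proof -
  obtain P Q where P: "purif P c A Q" using uniform_purif[OF c] by blast
  have hP: "hom P I0 (A \<boxdot> Q)" by (rule purif_hom[OF P])
  note F = sharpD[OF f]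
  let ?l = "max_weight c A"
  have sl: "hom (scal ?l) I0 I0" "pr (scal ?l) = ?l" using scal[of ?l] max_weight_bounds[OF c] by simp_all
  obtain z where z: "pst z Q" "\<forall>b. sharp b z Q \<longrightarrow> (idn A \<otimes> b) \<odot> P = scal ?l \<otimes> x"
    by (rule dual[OF c P f])
  obtain b where b: "sharp b z Q" using sharp_exists[OF z(1)] by blast
  have hb: "hom b Q I0" using sharpD[OF b] by blast
  have bP: "(idn A \<otimes> b) \<odot> P = scal ?l \<otimes> x" using z(2) b by blast
  obtain b' where b': "hom b' Q I0" "add (Dis Q) b b'" using complement_effect[OF hb] by blast
  let ?w = "(idn A \<otimes> b') \<odot> P"
  have hw: "hom ?w I0 A" using hP b' by simp
  obtain y where y: "nst y A" "?w = (Dis A \<odot> ?w) \<otimes> y" using normalise[OF hw] by blast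
  let ?s = "Dis A \<odot> ?w"
  have s: "hom ?s I0 I0" using hw by simp
  have nc: "nst c A" by (rule uniform_nst[OF c])
  have e: "pr (a \<odot> c) = ?l * pr (a \<odot> x) + pr ?s * pr (a \<odot> y)" if a: "hom a A I0" for a
  proof -
    have "pr (a \<odot> ((idn A \<otimes> Dis Q) \<odot> P)) = pr (a \<odot> ((idn A \<otimes> b) \<odot> P)) + pr (a \<odot> ?w)"
      by (rule add_st[OF add_cmpR[OF add_tensL[OF b'(2)]]]) (use hP a in simp_all)
    also have "(idn A \<otimes> Dis Q) \<odot> P = c" using P by (simp add: purif_def)
    also have "pr (a \<odot> ((idn A \<otimes> b) \<odot> P)) = ?l * pr (a \<odot> x)"
      unfolding bP using pr_scal[OF sl(1) _ a, of x] F sl(2) by simp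
    also have "pr (a \<odot> ?w) = pr ?s * pr (a \<odot> y)" using pr_scal[OF s nst_hom[OF y(1)] a] y(2) by simp
    finally show ?thesis .
  qed
  have x1: "pr (Dis A \<odot> x) = 1" using F by simp
  have "1 = ?l + pr ?s" using e[of "Dis A"] x1 nc y(1) by simp
  then have s1: "pr ?s = 1 - ?l" by simp
  have "pr (f \<odot> c) = ?l * 1 + (1 - ?l) * pr (f \<odot> y)" using e[of f] F s1 by simp
  then have "pr (f \<odot> y) = 0" using max_weight[OF c f] l by simp
  then show thesis using that[OF y(1)] e s1 by simp
qed

text \<open>A sharp effect is then certain on \<open>c\<close> and equals the deterministic effect,
  so \<open>A\<close> has only one normalised state by \<open>ident_unique\<close>. The purification
  of \<open>c\<close> is a product with this state, which every reversible channel fixes, and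
  faithfulness concludes.\<close>

lemma invertible_trivial:
  assumes c: "uniform c A" and l: "max_weight c A = 1" and U: "invertible U A A" shows "U = idn A"
proof -
  obtain x where x: "pst x A" using pst_exists by blast
  obtain f where f: "sharp f x A" using sharp_exists[OF x] by blast
  note F = sharpD[OF f] and u = invertible_chan[OF U]
  have hf: "hom f A I0" and Pf: "Pure f" using F by blast+
  have fD: "f = Dis A" by (rule one_effect[OF c hf]) (use max_weight[OF c f] l in simp)
  have one: "y = x" if y: "nst y A" for y
    by (rule ident_unique[OF Pf hf y _ _ _]) (use y x fD in simp_all)
  obtain P Q where P: "purif P c A Q" using uniform_purif[OF c] by blast
  have pP: "nst P (A \<boxdot> Q)" "(idn A \<otimes> Dis Q) \<odot> P = c" using P by (simp_all add: purif_def)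
  have "c = x" by (rule one[OF uniform_nst[OF c]])
  then have "Pure ((idn A \<otimes> Dis Q) \<odot> P)" using pP(2) x by simp
  then obtain y where y: "nst y Q" "P = ((idn A \<otimes> Dis Q) \<odot> P) \<otimes> y" using factor[OF pP(1)] by blast
  have Pxy: "P = x \<otimes> y" using y(2) pP(2) \<open>c = x\<close> by simp
  have hx: "hom x I0 A" and hy: "hom y I0 Q" using F nst_hom[OF y(1)] by blast+
  have Ux: "U \<odot> x = x" by (rule one) (use u x in simp)
  show ?thesis
  proof (rule faithful[OF c P])
    show "(U \<otimes> idn Q) \<odot> P = (idn A \<otimes> idn Q) \<odot> P"
      unfolding Pxy using exch[of x U y "idn Q"] exch[of x "idn A" y "idn Q"] Ux u hx hy by simp
  qed (use u in simp_all)
qed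

lemma noisy_operation_invertible:
  assumes U: "invertible U A A" shows "noisy_operation \<Theta> A A (raw U)"
proof -
  obtain c where c: "noisy_rep U A I0 U c" using noisy_rep_invertible[OF U] by blast
  have "raw U \<in> transf \<Theta> A A" using invertible_chan[OF U] unfolding ok_def by auto
  moreover have "tends_to \<Theta> A A (\<lambda>_. raw U) (raw U)" by (simp add: tends_to_def)
  ultimately show ?thesis unfolding noisy_operation_def
    using noisy_rep_basic[OF c] by (intro conjI exI[of _ "\<lambda>_. raw U"] allI)
qed

lemma rare_channel_noisy:
  assumes R: "rare_channel \<Theta> A R" shows "noisy_operation \<Theta> A A R"
proof -
  obtain n :: nat and p :: "nat \<Rightarrow> real" and U where ch: "channel \<Theta> A A R"
    and p: "\<forall>i<n. 0 \<le> p i" "(\<Sum>i<n. p i) = 1" and U: "\<forall>i<n. reversible \<Theta> A A (U i)"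
    and lc: "lincomb \<Theta> A A R {..<n} p U"
    using R unfolding rare_channel_def by blast
  define V where "V i = Arr A (U i) A" for i
  have rV: "invertible (V i) A A" if "i < n" for i using U that by (simp add: V_def invertible_reversible)
  obtain c where c: "uniform c A" using uniform_exists by blast
  note lb = max_weight_bounds[OF c]
  show ?thesis
  proof (cases "max_weight c A = 1")
    case True
    have "R = raw (idn A)"
    proof -
      define T where "T = Arr A R A"
      have hT: "hom T A A" using channel_transf[OF ch] by (simp add: T_def ok_def)
      have Vi: "V i = idn A" if "i < n" for i by (rule invertible_trivial[OF c True rV[OF that]])
      have hV: "hom (V j) (src T) (tgt T)" if "j \<in> {..<n}" for j using invertible_chan[OF rV, of j] that hT by simp
      have l: "lin T {..<n} p V"
      proof (rule iffD2[OF lin_lincomb])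
        show "ok T" using hT by blast
        show "hom (V j) (src T) (tgt T)" if "j \<in> {..<n}" for j by (rule hV[OF that])
        show "lincomb \<Theta> (src T) (tgt T) (raw T) {..<n} p (\<lambda>j. raw (V j))" using lc by (simp add: T_def V_def)
      qed
      have "T = idn A"
      proof (rule ap_ext)
        fix S x E assume x: "hom x I0 (src T \<boxdot> S)" "hom E (tgt T \<boxdot> S) I0"
        have "ap S E T x = (\<Sum>j<n. p j * ap S E (V j) x)" using l x unfolding lin_def by blast
        also have "\<dots> = (\<Sum>j<n. p j * ap S E (idn A) x)" by (intro sum.cong refl) (simp add: Vi)
        also have "\<dots> = ap S E (idn A) x" using p(2) by (simp add: sum_distrib_right[symmetric])
        finally show "ap S E T x = ap S E (idn A) x" .
      qed (use hT in simp_all)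
      then have "raw T = raw (idn A)" by (rule arg_cong)
      then show ?thesis by (simp add: T_def)
    qed
    then show ?thesis using noisy_operation_invertible[OF invertible_idn[of A]] by simp
  next
    case False
    then have l: "0 < max_weight c A" "max_weight c A < 1" using lb by simp_all
    obtain x where x: "pst x A" using pst_exists by blast
    obtain f where f: "sharp f x A" using sharp_exists[OF x] by blast
    obtain y where y: "nst y A" "pr (f \<odot> y) = 0"
      "\<And>a. hom a A I0 \<Longrightarrow> pr (a \<odot> c) = max_weight c A * pr (a \<odot> x) + (1 - max_weight c A) * pr (a \<odot> y)"
      using uniform_split[OF c f l(2)] by blast
    \<comment> \<open>The weights of those mixtures of the \<open>V i\<close> that are exactly noisy
      operations with a finite dilation. The bounds on the weights are recorded because
      \<open>simplex_dense\<close> asks for them.\<close>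
    define D where "D = {q :: nat \<Rightarrow> real. (\<forall>i. 0 \<le> q i \<and> q i \<le> 1) \<and>
      (\<exists>B E W d. noisy_rep B A E W d \<and> lin B {..<n} q V)}"
    have "\<exists>q. (\<forall>m. q m \<in> D) \<and> (\<forall>i<n. (\<lambda>m. q m i) \<longlonglongrightarrow> p i)"
    proof (rule simplex_dense[OF l])
      fix i assume i: "i < n"
      note v = invertible_chan[OF rV[OF i]]
      obtain d where d: "noisy_rep (V i) A I0 (V i) d" using noisy_rep_invertible[OF rV[OF i]] by blast
      have "lin (V i) {..<n} (\<lambda>j. if j = i then 1 else 0) V"
        unfolding lin_def
      proof (intro conjI ballI allI impI)
        fix j assume "j \<in> {..<n}"
        then show "ok (V j)" "src (V j) = src (V i)" "tgt (V j) = tgt (V i)" using invertible_chan[OF rV, of j] v by simp_all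
      next
        fix S r E
        have "(\<Sum>j<n. (if j = i then 1 else 0) * ap S E (V j) r) = (\<Sum>j<n. if j = i then ap S E (V j) r else 0)"
          by (intro sum.cong) auto
        then show "ap S E (V i) r = (\<Sum>j<n. (if j = i then 1 else 0) * ap S E (V j) r)" using i by simp
      qed (use v in simp)
      then show "(\<lambda>j. if j = i then 1 else 0) \<in> D" unfolding D_def using d by auto
    next
      fix r q assume r: "r \<in> D" and q: "q \<in> D"
      obtain B E W d where B: "noisy_rep B A E W d" "lin B {..<n} q V" using q unfolding D_def by blast
      obtain B' E' W' d' where B': "noisy_rep B' A E' W' d'" "lin B' {..<n} r V" using r unfolding D_def by blast
      obtain H G Z e where H: "noisy_rep H A G Z e"
        "lin H UNIV (\<lambda>b. if b then max_weight c A else 1 - max_weight c A) (\<lambda>b. if b then B' else B)"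
        by (rule noisy_rep_mix[OF f c y B'(1) B(1)])
      have h: "hom H A A" "hom B A A" "hom B' A A" using noisy_rep_hom(1)[OF H(1)] noisy_rep_hom(1)[OF B(1)] noisy_rep_hom(1)[OF B'(1)] by blast+
      have "lin H {..<n} (\<lambda>i. max_weight c A * r i + (1 - max_weight c A) * q i) V"
        unfolding lin_def
      proof (intro conjI ballI allI impI)
        fix j assume "j \<in> {..<n}"
        then show "ok (V j)" "src (V j) = src H" "tgt (V j) = tgt H" using invertible_chan[OF rV, of j] h by simp_all
      next
        fix S w E assume "hom w I0 (src H \<boxdot> S)" "hom E (tgt H \<boxdot> S) I0"
        then have w: "hom w I0 (A \<boxdot> S)" "hom E (A \<boxdot> S) I0" using h by simp_all
        have 1: "ap S E B w = (\<Sum>j<n. q j * ap S E (V j) w)" "ap S E B' w = (\<Sum>j<n. r j * ap S E (V j) w)"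
          using B(2) B'(2) w h unfolding lin_def by simp_all
        have "ap S E H w = max_weight c A * ap S E B' w + (1 - max_weight c A) * ap S E B w"
          using H(2) w h unfolding lin_def by (simp add: UNIV_bool)
        then show "ap S E H w = (\<Sum>j<n. (max_weight c A * r j + (1 - max_weight c A) * q j) * ap S E (V j) w)"
          unfolding 1 by (simp add: sum_distrib_left sum.distrib distrib_right mult.assoc)
      qed (use h in simp)
      moreover have "0 \<le> max_weight c A * r i + (1 - max_weight c A) * q i \<and> max_weight c A * r i + (1 - max_weight c A) * q i \<le> 1" for i
      proof
        have b: "0 \<le> r i" "r i \<le> 1" "0 \<le> q i" "q i \<le> 1" using q r unfolding D_def by blast+
        show "0 \<le> max_weight c A * r i + (1 - max_weight c A) * q i" using b l by simp
        show "max_weight c A * r i + (1 - max_weight c A) * q i \<le> 1" using b l by (intro convex_bound_le) simp_all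
      qed
      ultimately show "(\<lambda>i. max_weight c A * r i + (1 - max_weight c A) * q i) \<in> D" unfolding D_def using H(1) by blast
    next
      fix q i assume "q \<in> D"
      then show "0 \<le> q i \<and> q i \<le> 1" unfolding D_def by blast
    qed (use p in simp_all)
    then obtain q where q: "\<And>m. q m \<in> D" "\<And>i. i < n \<Longrightarrow> (\<lambda>m. q m i) \<longlonglongrightarrow> p i" by blast
    have "\<forall>m. \<exists>B. (\<exists>E W d. noisy_rep B A E W d) \<and> lin B {..<n} (q m) V" using q(1) unfolding D_def by blast
    then obtain B where B: "\<And>m. \<exists>E W d. noisy_rep (B m) A E W d" "\<And>m. lin (B m) {..<n} (q m) V" by metis
    have hB: "hom (B m) A A" for m using B(1)[of m] noisy_rep_hom(1) by blast
    have "tends_to \<Theta> A A (\<lambda>m. raw (B m)) R"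
      unfolding tends_to_def
    proof (intro allI ballI)
      fix S r E assume r: "r \<in> states \<Theta> (A \<boxdot> S)" and E: "E \<in> effects \<Theta> (A \<boxdot> S)"
      let ?r = "Arr I0 r (A \<boxdot> S)" and ?E = "Arr (A \<boxdot> S) E I0"
      have h: "hom ?r I0 (A \<boxdot> S)" "hom ?E (A \<boxdot> S) I0" using r E by (simp_all add: ok_def states_def effects_def)
      have "prob \<Theta> S E (raw (B m)) r = (\<Sum>j<n. q m j * prob \<Theta> S E (U j) r)" for m
      proof -
        have "ap S ?E (B m) ?r = (\<Sum>j<n. q m j * ap S ?E (V j) ?r)"
          using B(2)[of m] h hB[of m] unfolding lin_def by simp
        then show ?thesis by (simp add: ap_prob V_def)
      qed
      moreover have "(\<lambda>m. \<Sum>j<n. q m j * prob \<Theta> S E (U j) r) \<longlonglongrightarrow> (\<Sum>j<n. p j * prob \<Theta> S E (U j) r)"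
        using q(2) by (intro tendsto_sum tendsto_mult tendsto_const) auto
      ultimately show "(\<lambda>m. prob \<Theta> S E (raw (B m)) r) \<longlonglongrightarrow> prob \<Theta> S E R r"
        using lc r E by (simp add: lincomb_def)
    qed
    moreover have "basic_noisy_operation \<Theta> A A (raw (B m))" for m using B(1)[of m] noisy_rep_basic by blast
    ultimately show ?thesis unfolding noisy_operation_def
      using channel_transf[OF ch] by (intro conjI exI[of _ "\<lambda>m. raw (B m)"] allI)
  qed
qed

end

theorem theorem5p2p8:
  fixes \<Theta> :: "('s, 't) opt" and A :: 's and R :: 't
  assumes "sharp_theory_with_purification \<Theta>"
    and "rare_channel \<Theta> A R"
  shows "noisy_operation \<Theta> A A R"
  using sharp_theory_with_purification.rare_channel_noisy[OF assms] .

end
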